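(* Let $\ell$ be any complex number. Then there exists an $(r+1)$-toroidal vertex algebra structure on $V_{\mathcal{L}}(\ell,0)$, which is uniquely determined by the conditions that $\mathbf{1}$ is the vacuum vector and that $$Y(a;x_0,\mathbf{x})=a^{\mathcal{L}}(x_0,\mathbf{x})\quad\text{for } a\in\mathfrak{g}.$$
   Context: Conventions. All vector spaces are over $\mathbb{C}$; $\mathbb{N}$ is the set of nonnegative integers; $r$ is a fixed positive integer. $\mathbf{x}=(x_1,\dots,x_r)$ (similarly $\mathbf{y},\mathbf{z}$) are commuting formal variables, $\mathbf{x}^{\mathbf{m}}=x_1^{m_1}\cdots x_r^{m_r}$ (and $\mathbf{t}^{\mathbf{m}}$ likewise) for $\mathbf{m}\in\mathbb{Z}^r$, and $\mathbf{z}\mathbf{y}=(z_1y_1,\dots,z_ry_r)$. $\delta(z)=\sum_{n\in\mathbb{Z}}z^n$, and $(x_0\pm y_0)^{n}$ is expanded in nonnegative integer powers of $y_0$. $\omega_N=\exp(2\pi\sqrt{-1}/N)$. For a vector space $W$, $\mathcal{E}(W,r)=\mathrm{Hom}\big(W,W[[x_1^{\pm1},\dots,x_r^{\pm1}]]((x_0))\big)$. Toroidal vertex algebra. An $(r+1)$-toroidal vertex algebra is a vector space $V$ with a linear map $Y(\cdot;x_0,\mathbf{x}):V\to\mathcal{E}(V,r)$, $v\mapsto Y(v;x_0,\mathbf{x})=\sum_{(m_0,\mathbf{m})\in\mathbb{Z}\times\mathbb{Z}^r}v_{m_0,\mathbf{m}}x_0^{-m_0-1}\mathbf{x}^{-\mathbf{m}}$,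 and a distinguished vector $\mathbf{1}\in V$ (the vacuum vector), such that $Y(\mathbf{1};x_0,\mathbf{x})v=v$ and $Y(v;x_0,\mathbf{x})\mathbf{1}\in V[[x_0,x_1^{\pm1},\dots,x_r^{\pm1}]]$ for $v\in V$, and for $u,v\in V$ $$z_0^{-1}\delta\Big(\frac{x_0-y_0}{z_0}\Big)Y(u;x_0,\mathbf{z}\mathbf{y})Y(v;y_0,\mathbf{y})-z_0^{-1}\delta\Big(\frac{y_0-x_0}{-z_0}\Big)Y(v;y_0,\mathbf{y})Y(u;x_0,\mathbf{z}\mathbf{y})=y_0^{-1}\delta\Big(\frac{x_0-z_0}{y_0}\Big)Y(Y(u;z_0,\mathbf{z})v;y_0,\mathbf{y}).$$ Lie algebras. $\mathfrak{g}$ is a finite dimensional simple Lie algebra with Killing form $\langle\cdot,\cdot\rangle$ normalized so that $\langle\alpha,\alpha\rangle=2$ for long roots $\alpha$; $\sigma_0,\sigma_1,\dots,\sigma_r$ are mutually commuting automorphisms of $\mathfrak{g}$ of finite orders $N_0,N_1,\dots,N_r$ (only $\sigma_1,\dots,\sigma_r$ enter here). $\Lambda(\mathbf{N})=\mathbb{Z}N_1\times\cdots\times\mathbb{Z}N_r\subset\mathbb{Z}^r$. For $\mathbf{m}\in\mathbb{Z}^r$, $\mathfrak{g}_{\mathbf{m}}=\{a\in\mathfrak{g}:\sigma_i(a)=\omega_{N_i}^{m_i}a,\ 1\le i\le r\}$. $\widehat{L_{r+1}}(\mathfrak{g})=\mathfrak{g}\otimes\mathbb{C}[t_0^{\pm1},t_1^{\pm1},\dots,t_r^{\pm1}]\oplus\mathbb{C}\mathfrak{c}$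 with $\mathfrak{c}$ central and $$[a\otimes t_0^{m_0}\mathbf{t}^{\mathbf{m}},b\otimes t_0^{n_0}\mathbf{t}^{\mathbf{n}}]=[a,b]\otimes t_0^{m_0+n_0}\mathbf{t}^{\mathbf{m}+\mathbf{n}}+m_0\langle a,b\rangle\delta_{m_0+n_0,0}\delta_{\mathbf{m}+\mathbf{n},0}\mathfrak{c}.$$ $\mathcal{L}$ is its subalgebra $\big(\bigoplus_{\mathbf{m}\in\mathbb{Z}^r}\mathfrak{g}_{\mathbf{m}}\otimes\mathbf{t}^{\mathbf{m}}\mathbb{C}[t_0^{\pm1}]\big)\oplus\mathbb{C}\mathfrak{c}$, and $\mathcal{L}^{\ge0}=\big(\bigoplus_{\mathbf{m}}\mathfrak{g}_{\mathbf{m}}\otimes\mathbf{t}^{\mathbf{m}}\mathbb{C}[t_0]\big)\oplus\mathbb{C}\mathfrak{c}$. For $a\in\mathfrak{g}_{\mathbf{k}}$ put $a^{\mathcal{L}}(x_0,\mathbf{x})=\sum_{m_0\in\mathbb{Z},\ \mathbf{m}\in\mathbf{k}+\Lambda(\mathbf{N})}(a\otimes t_0^{m_0}\mathbf{t}^{\mathbf{m}})x_0^{-m_0-1}\mathbf{x}^{-\mathbf{m}}$, extended linearly to $a\in\mathfrak{g}$. The space $V_{\mathcal{L}}(\ell,0)$. $(\mathfrak{g}\oplus\mathbb{C})_\ell$ is the $\mathcal{L}^{\ge0}$-module $\mathfrak{g}\oplus\mathbb{C}$ on which $\mathfrak{c}$ acts as $\ell$ and, for $a\in\mathfrak{g}_{\mathbf{k}}$,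 $b\in\mathfrak{g}$, $j\in\mathbb{N}$, $\mathbf{m}\in\mathbf{k}+\Lambda(\mathbf{N})$: $(a\otimes t_0^j\mathbf{t}^{\mathbf{m}})\cdot\mathbb{C}=0$, and $(a\otimes t_0^j\mathbf{t}^{\mathbf{m}})\cdot b$ equals $[a,b]$ if $j=0$, $\langle a,b\rangle\ell$ if $j=1$, $0$ if $j\ge2$. $V_{\mathcal{L}}(\ell,0)=U(\mathcal{L})\otimes_{U(\mathcal{L}^{\ge0})}(\mathfrak{g}\oplus\mathbb{C})_\ell$ is the induced $\mathcal{L}$-module, $\mathbf{1}=1\otimes1$, and $\mathfrak{g}$ is identified with the subspace $1\otimes\mathfrak{g}$. In the claim the coefficients of $a^{\mathcal{L}}(x_0,\mathbf{x})$ act through the $\mathcal{L}$-module structure. *)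

theory Defs
  imports
    "HOL-Analysis.Finite_Cartesian_Product"
    "HOL-Analysis.Product_Vector"
    "HOL-Library.Poly_Mapping"
    "HOL-Algebra.QuotRing"
    "HOL-Algebra.Module"
begin

section \<open>Conventions\<close>

text \<open>
  Lie algebras are given on types of class \<^class>\<open>ab_group_add\<close> with an explicit complex scalar
  multiplication; a Lie subalgebra is a subset of such a type.  Spaces that are built as
  quotients (universal enveloping algebras, tensor products, toroidal vertex algebras) are
  \<^typ>\<open>(complex, 'a) module\<close> records in the sense of HOL-Algebra, with elements that are cosets.
  The multiplicative fields of such a record are meaningful only for universal enveloping
  algebras.  The rank is the cardinality of a finite index type \<open>'r\<close> (hence positive), and
  multi-indices are elements of \<^typ>\<open>int ^ 'r\<close>.
\<close>

definition complex_ring :: "complex ring" where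
  "complex_ring = \<lparr>carrier = UNIV, mult = (*), one = 1, zero = 0, add = (+)\<rparr>"


section \<open>Toroidal vertex algebras\<close>

text \<open>The coefficient of \<open>x\<^sup>i y\<^sup>j\<close> in \<open>(x - y)\<^sup>n\<close>, expanded in nonnegative powers of \<open>y\<close>.\<close>

definition binomial_coeff :: "int \<Rightarrow> int \<Rightarrow> int \<Rightarrow> complex" where
  "binomial_coeff n i j =
     (if 0 \<le> j \<and> i + j = n then (-1) ^ nat j * (of_int n gchoose nat j) else 0)"

text \<open>
  For \<open>s = 1\<close> or \<open>s = -1\<close>, the coefficient of \<open>z\<^sup>a x\<^sup>i y\<^sup>j\<close> in
  \<open>z\<^sup>-\<^sup>1 \<delta>((x - y) / (s z)) = \<Sum>n. s\<^sup>-\<^sup>n z\<^sup>-\<^sup>n\<^sup>-\<^sup>1 (x - y)\<^sup>n\<close>.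
  Only \<open>n = -a - 1\<close> contributes.
\<close>

definition delta_coeff :: "complex \<Rightarrow> int \<Rightarrow> int \<Rightarrow> int \<Rightarrow> complex" where
  "delta_coeff s a i j = s powi (a + 1) * binomial_coeff (- a - 1) i j"

text \<open>
  Product of a scalar and a vector valued formal series; exponents are triples.  The sum runs
  over the nonzero terms; in the Jacobi identity below there are finitely many of them.
\<close>

definition series_mult ::
  "(complex, 'v) module \<Rightarrow> (int \<times> int \<times> int \<Rightarrow> complex) \<Rightarrow> (int \<times> int \<times> int \<Rightarrow> 'v)
     \<Rightarrow> int \<times> int \<times> int \<Rightarrow> 'v" where
  "series_mult V K F e =
     finsum V (\<lambda>d. K d \<odot>\<^bsub>V\<^esub> F (e - d)) {d. K d \<odot>\<^bsub>V\<^esub> F (e - d) \<noteq> \<zero>\<^bsub>V\<^esub>}"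

text \<open>
  \<open>Y v m0 m\<close> is the operator \<open>v\<^sub>m\<^sub>0\<^sub>,\<^sub>m\<close>, that is, the coefficient of \<open>x0\<^sup>-\<^sup>m\<^sup>0\<^sup>-\<^sup>1 x\<^sup>-\<^sup>m\<close> in \<open>Y(v; x0, x)\<close>.
  \<open>vertex_coeff Y v j p w\<close> is the coefficient of \<open>x0\<^sup>j x\<^sup>p\<close> in \<open>Y(v; x0, x) w\<close>.
\<close>

definition vertex_coeff ::
  "('v \<Rightarrow> int \<Rightarrow> int ^ 'r \<Rightarrow> 'v \<Rightarrow> 'v) \<Rightarrow> 'v \<Rightarrow> int \<Rightarrow> int ^ 'r \<Rightarrow> 'v \<Rightarrow> 'v" where
  "vertex_coeff Y v j p w = Y v (- j - 1) (- p) w"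

text \<open>
  The three terms of the Jacobi identity, applied to \<open>w\<close>.  The triple \<open>(a, b, c)\<close> consists of the
  exponents of \<open>z0\<close>, \<open>x0\<close>, \<open>y0\<close>, and \<open>p\<close>, \<open>q\<close> are the exponents of \<open>z\<close>, \<open>y\<close>.  Since
  \<open>Y(u; x0, z y)\<close> contributes the same exponent \<open>p\<close> to \<open>z\<close> and to \<open>y\<close>, the other factor
  contributes \<open>q - p\<close> to \<open>y\<close>.
\<close>

definition jacobi_uv ::
  "(complex, 'v) module \<Rightarrow> ('v \<Rightarrow> int \<Rightarrow> int ^ 'r \<Rightarrow> 'v \<Rightarrow> 'v) \<Rightarrow> 'v \<Rightarrow> 'v \<Rightarrow> 'v
     \<Rightarrow> int ^ 'r \<Rightarrow> int ^ 'r \<Rightarrow> int \<times> int \<times> int \<Rightarrow> 'v" where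
  "jacobi_uv V Y u v w p q =
     series_mult V (\<lambda>(a, b, c). delta_coeff 1 a b c)
       (\<lambda>(a, b, c). if a = 0
          then vertex_coeff Y u b p (vertex_coeff Y v c (q - p) w) else \<zero>\<^bsub>V\<^esub>)"

definition jacobi_vu ::
  "(complex, 'v) module \<Rightarrow> ('v \<Rightarrow> int \<Rightarrow> int ^ 'r \<Rightarrow> 'v \<Rightarrow> 'v) \<Rightarrow> 'v \<Rightarrow> 'v \<Rightarrow> 'v
     \<Rightarrow> int ^ 'r \<Rightarrow> int ^ 'r \<Rightarrow> int \<times> int \<times> int \<Rightarrow> 'v" where
  "jacobi_vu V Y u v w p q =
     series_mult V (\<lambda>(a, b, c). delta_coeff (-1) a c b)
       (\<lambda>(a, b, c). if a = 0
          then vertex_coeff Y v c (q - p) (vertex_coeff Y u b p w) else \<zero>\<^bsub>V\<^esub>)"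

definition jacobi_iterate ::
  "(complex, 'v) module \<Rightarrow> ('v \<Rightarrow> int \<Rightarrow> int ^ 'r \<Rightarrow> 'v \<Rightarrow> 'v) \<Rightarrow> 'v \<Rightarrow> 'v \<Rightarrow> 'v
     \<Rightarrow> int ^ 'r \<Rightarrow> int ^ 'r \<Rightarrow> int \<times> int \<times> int \<Rightarrow> 'v" where
  "jacobi_iterate V Y u v w p q =
     series_mult V (\<lambda>(a, b, c). delta_coeff 1 c b a)
       (\<lambda>(a, b, c). if b = 0
          then vertex_coeff Y (vertex_coeff Y u a p v) c q w else \<zero>\<^bsub>V\<^esub>)"

text \<open>
  Only the values of \<open>Y\<close> on the carrier are constrained.  In \<open>truncation\<close>, the bound on \<open>m0\<close> is
  uniform in \<open>m\<close>: this is membership of \<open>Y(v; x0, x) w\<close> in \<open>V[[x\<^sup>\<plusminus>\<^sup>1]]((x0))\<close>.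
\<close>

locale toroidal_vertex_algebra = module complex_ring V
  for V :: "(complex, 'v) module" (structure) +
  fixes Y :: "'v \<Rightarrow> int \<Rightarrow> int ^ ('r :: finite) \<Rightarrow> 'v \<Rightarrow> 'v"
    and vac :: 'v
  assumes vac_closed: "vac \<in> carrier V"
    and Y_closed: "\<lbrakk>v \<in> carrier V; w \<in> carrier V\<rbrakk> \<Longrightarrow> Y v m0 m w \<in> carrier V"
    and Y_add_left: "\<lbrakk>u \<in> carrier V; v \<in> carrier V; w \<in> carrier V\<rbrakk>
      \<Longrightarrow> Y (u \<oplus> v) m0 m w = Y u m0 m w \<oplus> Y v m0 m w"
    and Y_smult_left: "\<lbrakk>v \<in> carrier V; w \<in> carrier V\<rbrakk>
      \<Longrightarrow> Y (c \<odot> v) m0 m w = c \<odot> Y v m0 m w"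
    and Y_add_right: "\<lbrakk>v \<in> carrier V; w \<in> carrier V; w' \<in> carrier V\<rbrakk>
      \<Longrightarrow> Y v m0 m (w \<oplus> w') = Y v m0 m w \<oplus> Y v m0 m w'"
    and Y_smult_right: "\<lbrakk>v \<in> carrier V; w \<in> carrier V\<rbrakk>
      \<Longrightarrow> Y v m0 m (c \<odot> w) = c \<odot> Y v m0 m w"
    and truncation: "\<lbrakk>v \<in> carrier V; w \<in> carrier V\<rbrakk>
      \<Longrightarrow> \<exists>n. \<forall>m0 \<ge> n. \<forall>m. Y v m0 m w = \<zero>"
    and vacuum: "v \<in> carrier V \<Longrightarrow> Y vac m0 m v = (if m0 = -1 \<and> m = 0 then v else \<zero>)"
    and creation: "\<lbrakk>v \<in> carrier V; 0 \<le> m0\<rbrakk> \<Longrightarrow> Y v m0 m vac = \<zero>"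
    and jacobi: "\<lbrakk>u \<in> carrier V; v \<in> carrier V; w \<in> carrier V\<rbrakk>
      \<Longrightarrow> jacobi_uv V Y u v w p q e \<ominus> jacobi_vu V Y u v w p q e = jacobi_iterate V Y u v w p q e"


section \<open>Simple Lie algebras and the normalized Killing form\<close>

definition (in vector_space) endo_trace :: "('b \<Rightarrow> 'b) \<Rightarrow> 'a" where
  "endo_trace f =
     (let B = (SOME B. independent B \<and> span B = UNIV) in \<Sum>b\<in>B. representation B (f b) b)"

locale lie_algebra = vector_space scale
  for scale :: "complex \<Rightarrow> 'g :: ab_group_add \<Rightarrow> 'g" +
  fixes bracket :: "'g \<Rightarrow> 'g \<Rightarrow> 'g"
  assumes bracket_linear_left: "Vector_Spaces.linear scale scale (\<lambda>x. bracket x y)"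
    and bracket_linear_right: "Vector_Spaces.linear scale scale (bracket x)"
    and bracket_self: "bracket x x = 0"
    and bracket_jacobi:
      "bracket x (bracket y z) + bracket y (bracket z x) + bracket z (bracket x y) = 0"
begin

definition lie_automorphism :: "('g \<Rightarrow> 'g) \<Rightarrow> bool" where
  "lie_automorphism f \<longleftrightarrow>
     Vector_Spaces.linear scale scale f \<and> bij f \<and>
     (\<forall>x y. f (bracket x y) = bracket (f x) (f y))"

definition lie_ideal :: "'g set \<Rightarrow> bool" where
  "lie_ideal I \<longleftrightarrow> subspace I \<and> (\<forall>x. \<forall>y\<in>I. bracket x y \<in> I)"

definition lie_subalgebra :: "'g set \<Rightarrow> bool" where
  "lie_subalgebra H \<longleftrightarrow> subspace H \<and> (\<forall>x\<in>H. \<forall>y\<in>H. bracket x y \<in> H)"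

primrec lower_central_series :: "'g set \<Rightarrow> nat \<Rightarrow> 'g set" where
  "lower_central_series H 0 = H"
| "lower_central_series H (Suc n) =
     span {bracket x y |x y. x \<in> H \<and> y \<in> lower_central_series H n}"

definition cartan_subalgebra :: "'g set \<Rightarrow> bool" where
  "cartan_subalgebra H \<longleftrightarrow>
     lie_subalgebra H \<and> (\<exists>n. lower_central_series H n = {0}) \<and>
     {x. \<forall>h\<in>H. bracket x h \<in> H} = H"

text \<open>
  A root is a nonzero linear form on \<open>H\<close>; it is represented by a function on the whole Lie algebra of
  which only the restriction to \<open>H\<close> matters.  Its linearity on \<open>H\<close> is automatic.
\<close>

definition is_root :: "'g set \<Rightarrow> ('g \<Rightarrow> complex) \<Rightarrow> bool" where
  "is_root H \<alpha> \<longleftrightarrow>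
     (\<exists>h\<in>H. \<alpha> h \<noteq> 0) \<and> (\<exists>x. x \<noteq> 0 \<and> (\<forall>h\<in>H. bracket h x = scale (\<alpha> h) x))"

definition killing_form :: "'g \<Rightarrow> 'g \<Rightarrow> complex" where
  "killing_form x y = endo_trace (\<lambda>z. bracket x (bracket y z))"

text \<open>
  The form induced on the dual of \<open>H\<close> by a bilinear form \<open>\<kappa>\<close> that is nondegenerate on \<open>H\<close>.
\<close>

definition dual_form ::
  "('g \<Rightarrow> 'g \<Rightarrow> complex) \<Rightarrow> 'g set \<Rightarrow> ('g \<Rightarrow> complex) \<Rightarrow> ('g \<Rightarrow> complex) \<Rightarrow> complex" where
  "dual_form \<kappa> H \<alpha> \<beta> =
     (let rep = (\<lambda>\<gamma>. THE t. t \<in> H \<and> (\<forall>h\<in>H. \<kappa> t h = \<gamma> h)) in \<kappa> (rep \<alpha>) (rep \<beta>))"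

text \<open>The square lengths of roots with respect to the Killing form are positive reals.\<close>

definition long_root :: "'g set \<Rightarrow> ('g \<Rightarrow> complex) \<Rightarrow> bool" where
  "long_root H \<alpha> \<longleftrightarrow> is_root H \<alpha> \<and>
     (\<forall>\<beta>. is_root H \<beta> \<longrightarrow> Re (dual_form killing_form H \<beta> \<beta>) \<le> Re (dual_form killing_form H \<alpha> \<alpha>))"

definition normalized_killing_form :: "('g \<Rightarrow> 'g \<Rightarrow> complex) \<Rightarrow> bool" where
  "normalized_killing_form \<kappa> \<longleftrightarrow>
     (\<exists>c. \<kappa> = (\<lambda>x y. c * killing_form x y)) \<and>
     (\<forall>H \<alpha>. cartan_subalgebra H \<and> long_root H \<alpha> \<longrightarrow> dual_form \<kappa> H \<alpha> \<alpha> = 2)"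

end

locale simple_lie_algebra = lie_algebra +
  assumes finite_dimensional: "\<exists>B. finite B \<and> span B = UNIV"
    and nonabelian: "\<exists>x y. bracket x y \<noteq> 0"
    and simple: "lie_ideal I \<Longrightarrow> I = {0} \<or> I = UNIV"

definition has_order :: "('a \<Rightarrow> 'a) \<Rightarrow> nat \<Rightarrow> bool" where
  "has_order f n \<longleftrightarrow> 0 < n \<and> f ^^ n = id \<and> (\<forall>k. 0 < k \<and> k < n \<longrightarrow> f ^^ k \<noteq> id)"


section \<open>Universal enveloping algebras\<close>

text \<open>
  The free monoid.  Its monoid algebra, the type of finitely supported complex functions on
  words with the convolution product, is the free associative algebra.
\<close>

datatype 'a word = Word (letters: "'a list")

instantiation word :: (type) monoid_add
begin

definition zero_word :: "'a word" where
  "zero_word = Word []"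

definition plus_word :: "'a word \<Rightarrow> 'a word \<Rightarrow> 'a word" where
  "plus_word u v = Word (letters u @ letters v)"

instance
  by standard (simp_all add: zero_word_def plus_word_def)

end

definition free_algebra :: "'a set \<Rightarrow> ('a word \<Rightarrow>\<^sub>0 complex) ring" where
  "free_algebra A =
     \<lparr>carrier = {f. \<forall>w\<in>Poly_Mapping.keys f. set (letters w) \<subseteq> A},
      mult = (*), one = 1, zero = 0, add = (+)\<rparr>"

definition letter :: "'a \<Rightarrow> ('a word \<Rightarrow>\<^sub>0 complex)" where
  "letter x = Poly_Mapping.single (Word [x]) 1"

definition free_scalar :: "complex \<Rightarrow> ('a word \<Rightarrow>\<^sub>0 complex)" where
  "free_scalar c = Poly_Mapping.single 0 c"

text \<open>
  In the following definitions, \<open>A\<close> is a Lie subalgebra of the Lie algebra with scalar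
  multiplication \<open>sc\<close> and bracket \<open>br\<close>.  The linearity relations cut the free algebra on the set
  \<open>A\<close> down to the tensor algebra of the vector space \<open>A\<close>.
\<close>

definition uea_ideal ::
  "(complex \<Rightarrow> 'a :: ab_group_add \<Rightarrow> 'a) \<Rightarrow> ('a \<Rightarrow> 'a \<Rightarrow> 'a) \<Rightarrow> 'a set
     \<Rightarrow> ('a word \<Rightarrow>\<^sub>0 complex) set" where
  "uea_ideal sc br A = genideal (free_algebra A)
     ({letter (x + y) - letter x - letter y |x y. x \<in> A \<and> y \<in> A} \<union>
      {letter (sc c x) - free_scalar c * letter x |c x. x \<in> A} \<union>
      {letter x * letter y - letter y * letter x - letter (br x y) |x y. x \<in> A \<and> y \<in> A})"

definition uea_class ::
  "(complex \<Rightarrow> 'a :: ab_group_add \<Rightarrow> 'a) \<Rightarrow> ('a \<Rightarrow> 'a \<Rightarrow> 'a) \<Rightarrow> 'a set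
     \<Rightarrow> ('a word \<Rightarrow>\<^sub>0 complex) \<Rightarrow> ('a word \<Rightarrow>\<^sub>0 complex) set" where
  "uea_class sc br A f = uea_ideal sc br A +>\<^bsub>free_algebra A\<^esub> f"

definition uea ::
  "(complex \<Rightarrow> 'a :: ab_group_add \<Rightarrow> 'a) \<Rightarrow> ('a \<Rightarrow> 'a \<Rightarrow> 'a) \<Rightarrow> 'a set
     \<Rightarrow> (complex, ('a word \<Rightarrow>\<^sub>0 complex) set) module" where
  "uea sc br A =
     (let Q = free_algebra A Quot uea_ideal sc br A in
      \<lparr>carrier = carrier Q, mult = mult Q, one = one Q, zero = zero Q, add = add Q,
       smult = (\<lambda>c X. uea_class sc br A (free_scalar c) \<otimes>\<^bsub>Q\<^esub> X)\<rparr>)"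

text \<open>
  For \<open>B \<subseteq> A\<close>, the homomorphism of universal enveloping algebras that the inclusion induces:
  the union of cosets below is a single coset.
\<close>

definition uea_incl ::
  "(complex \<Rightarrow> 'a :: ab_group_add \<Rightarrow> 'a) \<Rightarrow> ('a \<Rightarrow> 'a \<Rightarrow> 'a) \<Rightarrow> 'a set
     \<Rightarrow> ('a word \<Rightarrow>\<^sub>0 complex) set \<Rightarrow> ('a word \<Rightarrow>\<^sub>0 complex) set" where
  "uea_incl sc br A X = (\<Union>f\<in>X. uea_class sc br A f)"

text \<open>
  The action of a universal enveloping algebra on a Lie algebra module with scalar
  multiplication \<open>sm\<close> and action \<open>act\<close>: all representatives of a coset act in the same way.
\<close>

definition free_algebra_act ::
  "(complex \<Rightarrow> 'm :: ab_group_add \<Rightarrow> 'm) \<Rightarrow> ('a \<Rightarrow> 'm \<Rightarrow> 'm)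
     \<Rightarrow> ('a word \<Rightarrow>\<^sub>0 complex) \<Rightarrow> 'm \<Rightarrow> 'm" where
  "free_algebra_act sm act f m =
     (\<Sum>w\<in>Poly_Mapping.keys f. sm (Poly_Mapping.lookup f w) (foldr act (letters w) m))"

definition uea_act ::
  "(complex \<Rightarrow> 'm :: ab_group_add \<Rightarrow> 'm) \<Rightarrow> ('a \<Rightarrow> 'm \<Rightarrow> 'm)
     \<Rightarrow> ('a word \<Rightarrow>\<^sub>0 complex) set \<Rightarrow> 'm \<Rightarrow> 'm" where
  "uea_act sm act X m = the_elem ((\<lambda>f. free_algebra_act sm act f m) ` X)"


section \<open>Tensor products and induced modules\<close>

definition free_scale :: "complex \<Rightarrow> ('s \<Rightarrow>\<^sub>0 complex) \<Rightarrow> ('s \<Rightarrow>\<^sub>0 complex)" where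
  "free_scale c = Poly_Mapping.map ((*) c)"

definition free_space :: "'s set \<Rightarrow> (complex, 's \<Rightarrow>\<^sub>0 complex) module" where
  "free_space S =
     \<lparr>carrier = {F. Poly_Mapping.keys F \<subseteq> S}, mult = undefined, one = undefined,
      zero = 0, add = (+), smult = free_scale\<rparr>"

definition quotient_module :: "(complex, 'f) module \<Rightarrow> 'f set \<Rightarrow> (complex, 'f set) module" where
  "quotient_module M N =
     \<lparr>carrier = a_rcosets\<^bsub>M\<^esub> N, mult = undefined, one = undefined,
      zero = N, add = set_add M, smult = (\<lambda>c P. \<Union>x\<in>P. N +>\<^bsub>M\<^esub> (c \<odot>\<^bsub>M\<^esub> x))\<rparr>"

text \<open>
  The tensor product over an algebra with carrier \<open>H\<close> of a right module \<open>X\<close> (a record, with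
  action \<open>ract\<close>) and a left module \<open>'m\<close> (a type, with scalar multiplication \<open>sm\<close> and action
  \<open>lact\<close>): the free vector space on all pairs modulo the span of the usual relations.
\<close>

definition tensor_relations ::
  "(complex, 'x) module \<Rightarrow> (complex \<Rightarrow> 'm :: ab_group_add \<Rightarrow> 'm) \<Rightarrow> 'h set
     \<Rightarrow> ('x \<Rightarrow> 'h \<Rightarrow> 'x) \<Rightarrow> ('h \<Rightarrow> 'm \<Rightarrow> 'm) \<Rightarrow> ('x \<times> 'm \<Rightarrow>\<^sub>0 complex) set" where
  "tensor_relations X sm H ract lact =
     (let \<delta> = (\<lambda>x m. Poly_Mapping.single (x, m) 1) in
      module.span free_scale
       ({\<delta> (x \<oplus>\<^bsub>X\<^esub> y) m - \<delta> x m - \<delta> y m |x y m. x \<in> carrier X \<and> y \<in> carrier X} \<union>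
        {\<delta> x (m + n) - \<delta> x m - \<delta> x n |x m n. x \<in> carrier X} \<union>
        {\<delta> (c \<odot>\<^bsub>X\<^esub> x) m - free_scale c (\<delta> x m) |c x m. x \<in> carrier X} \<union>
        {\<delta> x (sm c m) - free_scale c (\<delta> x m) |c x m. x \<in> carrier X} \<union>
        {\<delta> (ract x h) m - \<delta> x (lact h m) |x h m. x \<in> carrier X \<and> h \<in> H}))"

text \<open>
  \<open>U(A) \<otimes>\<^bsub>U(B)\<^esub> M\<close> for Lie subalgebras \<open>B \<subseteq> A\<close> and a \<open>B\<close>-module \<open>M\<close> given by \<open>sm\<close> and \<open>act\<close>.
\<close>

definition induced_relations where
  "induced_relations sc br A B sm act =
     tensor_relations (uea sc br A) sm (carrier (uea sc br B))
       (\<lambda>x h. x \<otimes>\<^bsub>uea sc br A\<^esub> uea_incl sc br A h) (uea_act sm act)"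

definition induced_module where
  "induced_module sc br A B sm act =
     quotient_module (free_space (carrier (uea sc br A) \<times> UNIV))
       (induced_relations sc br A B sm act)"

definition induced_class where
  "induced_class sc br A B sm act F =
     induced_relations sc br A B sm act +>\<^bsub>free_space (carrier (uea sc br A) \<times> UNIV)\<^esub> F"

text \<open>The vector \<open>1 \<otimes> m\<close>.\<close>

definition induced_unit where
  "induced_unit sc br A B sm act m =
     induced_class sc br A B sm act (Poly_Mapping.single (one (uea sc br A), m) 1)"

text \<open>
  The action of \<open>x \<in> A\<close>, which sends \<open>u \<otimes> m\<close> to \<open>x u \<otimes> m\<close>: all representatives \<open>F\<close> of \<open>P\<close> give
  the same coset.
\<close>

definition induced_act where
  "induced_act sc br A B sm act x P =
     (\<Union>F\<in>P. induced_class sc br A B sm act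
        (\<Sum>(u, m)\<in>Poly_Mapping.keys F.
           Poly_Mapping.single (uea_class sc br A (letter x) \<otimes>\<^bsub>uea sc br A\<^esub> u, m)
             (Poly_Mapping.lookup F (u, m))))"


section \<open>The toroidal Lie algebra\<close>

text \<open>
  Pairs \<open>(f, c)\<close> with \<open>f\<close> finitely supported stand for \<open>(\<Sum>(m0, m). f(m0, m) \<otimes> t0\<^sup>m\<^sup>0 t\<^sup>m) + c \<c>\<close>.
\<close>

type_synonym ('g, 'r) toroidal = "(int \<times> (int ^ 'r) \<Rightarrow>\<^sub>0 'g) \<times> complex"

definition tor_elem :: "'g \<Rightarrow> int \<Rightarrow> int ^ 'r \<Rightarrow> ('g :: ab_group_add, 'r :: finite) toroidal" where
  "tor_elem a m0 m = (Poly_Mapping.single (m0, m) a, 0)"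

definition tor_scale ::
  "(complex \<Rightarrow> 'g \<Rightarrow> 'g) \<Rightarrow> complex
     \<Rightarrow> ('g :: ab_group_add, 'r :: finite) toroidal \<Rightarrow> ('g, 'r) toroidal" where
  "tor_scale scl c x = (Poly_Mapping.map (scl c) (fst x), c * snd x)"

definition tor_bracket ::
  "('g \<Rightarrow> 'g \<Rightarrow> 'g) \<Rightarrow> ('g \<Rightarrow> 'g \<Rightarrow> complex)
     \<Rightarrow> ('g :: ab_group_add, 'r :: finite) toroidal \<Rightarrow> ('g, 'r) toroidal \<Rightarrow> ('g, 'r) toroidal" where
  "tor_bracket bracket \<kappa> x y =
     (\<Sum>p\<in>Poly_Mapping.keys (fst x). \<Sum>q\<in>Poly_Mapping.keys (fst y).
        let a = Poly_Mapping.lookup (fst x) p; b = Poly_Mapping.lookup (fst y) q in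
        (Poly_Mapping.single (p + q) (bracket a b),
         if p + q = 0 then of_int (fst p) * \<kappa> a b else 0))"

definition grading_space ::
  "(complex \<Rightarrow> 'g \<Rightarrow> 'g) \<Rightarrow> ('r \<Rightarrow> 'g \<Rightarrow> 'g) \<Rightarrow> ('r \<Rightarrow> nat) \<Rightarrow> int ^ 'r \<Rightarrow> 'g set" where
  "grading_space scl \<sigma> N m =
     {a. \<forall>i. \<sigma> i a = scl (exp (2 * of_real pi * \<i> / of_nat (N i)) powi (m $ i)) a}"

definition lattice_coset :: "('r \<Rightarrow> nat) \<Rightarrow> int ^ 'r \<Rightarrow> (int ^ 'r) set" where
  "lattice_coset N k = {m. \<exists>l. \<forall>i. m $ i = k $ i + l $ i * int (N i)}"

definition L_alg ::
  "(complex \<Rightarrow> 'g \<Rightarrow> 'g) \<Rightarrow> ('r \<Rightarrow> 'g \<Rightarrow> 'g) \<Rightarrow> ('r \<Rightarrow> nat)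
     \<Rightarrow> ('g :: ab_group_add, 'r :: finite) toroidal set" where
  "L_alg scl \<sigma> N =
     {x. \<forall>m0 m. Poly_Mapping.lookup (fst x) (m0, m) \<in> grading_space scl \<sigma> N m}"

definition L_nonneg ::
  "(complex \<Rightarrow> 'g \<Rightarrow> 'g) \<Rightarrow> ('r \<Rightarrow> 'g \<Rightarrow> 'g) \<Rightarrow> ('r \<Rightarrow> nat)
     \<Rightarrow> ('g :: ab_group_add, 'r :: finite) toroidal set" where
  "L_nonneg scl \<sigma> N =
     {x \<in> L_alg scl \<sigma> N. \<forall>m0 m. m0 < 0 \<longrightarrow> Poly_Mapping.lookup (fst x) (m0, m) = 0}"

text \<open>
  \<open>a_L scl \<sigma> N a m0 m\<close> is the coefficient of \<open>x0\<^sup>-\<^sup>m\<^sup>0\<^sup>-\<^sup>1 x\<^sup>-\<^sup>m\<close> in \<open>a\<^sup>L(x0, x)\<close>, the linear extension in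
  \<open>a\<close> of the formula for homogeneous \<open>a\<close>.
\<close>

definition a_L ::
  "(complex \<Rightarrow> 'g \<Rightarrow> 'g) \<Rightarrow> ('r \<Rightarrow> 'g \<Rightarrow> 'g) \<Rightarrow> ('r \<Rightarrow> nat)
     \<Rightarrow> 'g \<Rightarrow> int \<Rightarrow> int ^ 'r \<Rightarrow> ('g :: ab_group_add, 'r :: finite) toroidal" where
  "a_L scl \<sigma> N = (THE F.
     (\<forall>m0 m. Vector_Spaces.linear scl (tor_scale scl) (\<lambda>a. F a m0 m)) \<and>
     (\<forall>k. \<forall>a \<in> grading_space scl \<sigma> N k. \<forall>m0 m.
        F a m0 m = (if m \<in> lattice_coset N k then tor_elem a m0 m else 0)))"


section \<open>The space \<open>V\<^sub>L(lvl, 0)\<close>\<close>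

text \<open>The module structure of the direct sum of \<open>\<g>\<close> and the complex numbers, of level \<open>lvl\<close>.\<close>

definition gC_scale :: "(complex \<Rightarrow> 'g \<Rightarrow> 'g) \<Rightarrow> complex \<Rightarrow> 'g \<times> complex \<Rightarrow> 'g \<times> complex" where
  "gC_scale scl c b = (scl c (fst b), c * snd b)"

definition gC_act ::
  "(complex \<Rightarrow> 'g \<Rightarrow> 'g) \<Rightarrow> ('g \<Rightarrow> 'g \<Rightarrow> 'g) \<Rightarrow> ('g \<Rightarrow> 'g \<Rightarrow> complex) \<Rightarrow> complex
     \<Rightarrow> ('g :: ab_group_add, 'r :: finite) toroidal \<Rightarrow> 'g \<times> complex \<Rightarrow> 'g \<times> complex" where
  "gC_act scl bracket \<kappa> lvl x b =
     (\<Sum>p\<in>Poly_Mapping.keys (fst x).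
        let a = Poly_Mapping.lookup (fst x) p in
        (if fst p = 0 then bracket a (fst b) else 0,
         if fst p = 1 then \<kappa> a (fst b) * lvl else 0))
     + gC_scale scl (snd x * lvl) b"

definition V_L where
  "V_L scl bracket \<kappa> \<sigma> N lvl =
     induced_module (tor_scale scl) (tor_bracket bracket \<kappa>)
       (L_alg scl \<sigma> N) (L_nonneg scl \<sigma> N) (gC_scale scl) (gC_act scl bracket \<kappa> lvl)"

definition V_L_act where
  "V_L_act scl bracket \<kappa> \<sigma> N lvl =
     induced_act (tor_scale scl) (tor_bracket bracket \<kappa>)
       (L_alg scl \<sigma> N) (L_nonneg scl \<sigma> N) (gC_scale scl) (gC_act scl bracket \<kappa> lvl)"

definition V_L_unit where
  "V_L_unit scl bracket \<kappa> \<sigma> N lvl =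
     induced_unit (tor_scale scl) (tor_bracket bracket \<kappa>)
       (L_alg scl \<sigma> N) (L_nonneg scl \<sigma> N) (gC_scale scl) (gC_act scl bracket \<kappa> lvl)"

definition V_L_vacuum where
  "V_L_vacuum scl bracket \<kappa> \<sigma> N lvl = V_L_unit scl bracket \<kappa> \<sigma> N lvl (0, 1)"

text \<open>The identification of \<open>\<g>\<close> with \<open>1 \<otimes> \<g>\<close>.\<close>

definition V_L_embed where
  "V_L_embed scl bracket \<kappa> \<sigma> N lvl a = V_L_unit scl bracket \<kappa> \<sigma> N lvl (a, 0)"

text \<open>
  A toroidal vertex algebra structure on \<open>V\<^sub>L(lvl, 0)\<close> with vacuum vector \<open>1\<close> and with
  \<open>Y(a; x0, x) = a\<^sup>L(x0, x)\<close> for all \<open>a \<in> \<g>\<close>.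
\<close>

definition V_L_structure where
  "V_L_structure scl bracket \<kappa> \<sigma> N lvl Y \<longleftrightarrow>
     toroidal_vertex_algebra (V_L scl bracket \<kappa> \<sigma> N lvl) Y (V_L_vacuum scl bracket \<kappa> \<sigma> N lvl) \<and>
     (\<forall>a m0 m. \<forall>v \<in> carrier (V_L scl bracket \<kappa> \<sigma> N lvl).
        Y (V_L_embed scl bracket \<kappa> \<sigma> N lvl a) m0 m v =
        V_L_act scl bracket \<kappa> \<sigma> N lvl (a_L scl \<sigma> N a m0 m) v)"

end

(*
The induced module V is realized as a complement of the tensor relations, and the currents of g
act on it by modes that satisfy the affine commutation relations.  Formal series of operators on V
carry a representation of L: a (x) t_0^j t^p sends a series to its j-th product with the current of a,
where both expansions of (x - y)^j occur.  This is a module action without any locality, because the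
action splits into a left and a right action that commute.  By the universal property of the induced
module, the currents of 1 (x) (g + C) extend to all of V; the extension is the vertex operator map.
By construction it satisfies the iterate formula for the generators; the commutator formula between
generators is the affine bracket, and both together propagate to the Borcherds identity for all pairs
of vectors, which is the coefficientwise form of the Jacobi identity.
Uniqueness holds since the Jacobi identity expresses the modes of u_{k,p} v by those of u and v, while
g and the vacuum generate V under these products.
*)
theory Submission
  imports Defs "HOL-Computational_Algebra.Formal_Power_Series" "HOL-Library.Function_Algebras"
    "HOL-Analysis.Complex_Transcendental"
begin

section \<open>Binomial sums\<close>

text \<open>The difficulty is to attach a vertex operator to every vector of a module that is given
  only by generators and relations. The universal property asks for a map from g + C to the series
  that commutes with the nonnegative part of \<open>L\<close>, and this comes down to one
  computation: for k >= 0, the k-th product of the currents of a and b is a k-th finite difference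
  in i of the commutators [a_(k-i), b_(n+i)]. These are constant in i up to a central term linear in
  i, so differences of order above 1 vanish, and orders 0 and 1 give [a, b] and the form times the
  level: exactly the module structure of g + C. The same closure of g + C under nonnegative products
  starts the induction for the Borcherds identity. All binomial expansions take place in the
  direction of x_0, since the exponents of x only add up; the multi-indices in
  \<open>vertex_modes\<close> may therefore lie in any abelian group. A vector space locale needs a
  whole type as carrier, so the operators act on a free space and factor through a projection
  \<open>pr\<close>, which stands in for the identity map.\<close>

definition ev0 :: "(nat \<Rightarrow> 'v :: zero) \<Rightarrow> bool" where
  "ev0 g \<longleftrightarrow> (\<exists>K. \<forall>i\<ge>K. g i = 0)"

text \<open>One bound serves both indices. Truncation of modes yields families of this kind, and for
  them the order of the two summations may be exchanged.\<close>

definition fin2 :: "(nat \<Rightarrow> nat \<Rightarrow> 'v :: zero) \<Rightarrow> bool" where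
  "fin2 g \<longleftrightarrow> (\<exists>K. \<forall>i k. K \<le> i \<or> K \<le> k \<longrightarrow> g i k = 0)"

lemma fin2_flip: "fin2 (\<lambda>k i. g i k) \<longleftrightarrow> fin2 g"
  unfolding fin2_def by blast

lemma fin2I:
  assumes "\<exists>K. \<forall>i\<ge>K. \<forall>k. g i k = 0" and "\<And>i. ev0 (g i)"
  shows "fin2 g"
proof -
  obtain K where K: "\<And>i k. i \<ge> K \<Longrightarrow> g i k = 0" using assms(1) by blast
  obtain M where M: "\<And>i k. k \<ge> M i \<Longrightarrow> g i k = 0"
    using assms(2) unfolding ev0_def by metis
  \<comment> \<open>Beyond \<open>K\<close> whole rows vanish. Each of the finitely many remaining
    rows has its own bound, which is at most the sum of all of them.\<close>
  let ?L = "K + (\<Sum>i<K. M i)"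
  have "g i k = 0" if "?L \<le> i \<or> ?L \<le> k" for i k
  proof (cases "i < K")
    case True
    then have "M i \<le> (\<Sum>i<K. M i)" by (intro member_le_sum) auto
    then show ?thesis using that True by (intro M) auto
  qed (use K in auto)
  then show ?thesis unfolding fin2_def by blast
qed

lemma fin2_ev0: "fin2 g \<Longrightarrow> ev0 (g i)"
  unfolding fin2_def ev0_def by blast

lemma ev0_shift: "ev0 g \<Longrightarrow> ev0 (\<lambda>i. g (k + i))"
  unfolding ev0_def by (meson trans_le_add2)

lemma ev0_map: "ev0 g \<Longrightarrow> (\<And>i. h i 0 = 0) \<Longrightarrow> ev0 (\<lambda>i. h i (g i))"
  unfolding ev0_def by (elim exE, rule_tac x = K in exI) simp

lemma ev0_diff:
  assumes "ev0 f" "ev0 g"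
  shows "ev0 (\<lambda>i. f i - g i :: 'v :: group_add)"
proof -
  obtain K L where "\<forall>i\<ge>K. f i = 0" "\<forall>i\<ge>L. g i = 0"
    using assms unfolding ev0_def by blast
  then have "\<forall>i\<ge>max K L. f i - g i = 0" by simp
  then show ?thesis unfolding ev0_def by blast
qed

text \<open>The sign that appears when (x - y)^j is expanded in powers of x, that is, as (-1)^j (y -
  x)^j with j an integer.\<close>

definition eps :: "int \<Rightarrow> 'a :: field" where
  "eps j = (-1) powi j"

lemma eps_add: "eps (i + j) = (eps i * eps j :: 'a :: field)"
  by (simp add: eps_def power_int_add)

lemma eps_square [simp]: "eps j * eps j = (1 :: 'a :: field)"
  by (simp add: eps_def power_int_mult_distrib[symmetric])

lemma eps_0 [simp]: "eps 0 = (1 :: 'a :: field)"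
  by (simp add: eps_def)

lemma eps_1 [simp]: "eps 1 = (- 1 :: 'a :: field)"
  by (simp add: eps_def)

lemma eps_of_nat: "eps (int n) = ((-1) ^ n :: 'a :: field)"
  by (simp add: eps_def)

lemma eps_diff_of_nat: "eps (j - int n) = (eps j * (-1) ^ n :: 'a :: field)"
  by (simp add: eps_def power_int_diff divide_inverse power_inverse[symmetric])

text \<open>The coefficient of x^(z-i) y^i in (x + c y)^z, expanded in nonnegative powers of y.
  Below, \<open>c\<close> is 1 or -1, and the identities between such sums are identities between
  powers of linear forms.\<close>

definition bcoef :: "'a \<Rightarrow> int \<Rightarrow> nat \<Rightarrow> 'a :: field_char_0" where
  "bcoef c z i = c ^ i * (of_int z gchoose i)"

lemma bcoef_0 [simp]: "bcoef c z 0 = 1"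
  by (simp add: bcoef_def)

lemma bcoef_0_left: "bcoef c 0 i = (if i = 0 then 1 else 0)"
  by (simp add: bcoef_def gbinomial_0_left)

lemma bcoef_Suc: "bcoef c (z + 1) (Suc i) = bcoef c z (Suc i) + c * bcoef c z i"
  by (simp add: bcoef_def gbinomial_Suc_Suc distrib_left mult_ac)

lemma bcoef_Vandermonde: "(\<Sum>i\<le>n. bcoef c y i * bcoef c z (n - i)) = bcoef c (y + z) n"
proof -
  have "(\<Sum>i\<le>n. bcoef c y i * bcoef c z (n - i)) =
      (\<Sum>i\<le>n. c ^ n * ((of_int y gchoose i) * (of_int z gchoose (n - i))))"
    by (intro sum.cong) (auto simp: bcoef_def power_add[symmetric] algebra_simps)
  also have "\<dots> = c ^ n * ((of_int y + of_int z) gchoose n)"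
    by (simp add: sum_distrib_left[symmetric] gbinomial_Vandermonde[symmetric] atLeast0AtMost)
  finally show ?thesis by (simp add: bcoef_def)
qed

lemma bcoef_eq_0: "int k < int i \<Longrightarrow> bcoef c (int k) i = 0"
  by (simp add: bcoef_def flip: binomial_gbinomial)

text \<open>The coefficient of y^s z^r in (x + c (y + z))^j, computed on the left one variable at a
  time and on the right through the powers of y + z.\<close>

lemma bcoef_trinomial:
  "bcoef c j s * bcoef c (j - int s) r = bcoef c j (s + r) * bcoef 1 (int (s + r)) s"
proof -
  have "(of_int j gchoose (s + r)) * (of_nat (s + r) gchoose s) =
      (of_int j gchoose s) * ((of_int j - of_nat s :: 'a) gchoose r)"
    by (subst gbinomial_trinomial_revision) auto
  then show ?thesis by (simp add: bcoef_def power_add algebra_simps)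
qed

text \<open>The coefficient of y^s z^r in (x + c y + d z)^j, which may be expanded in y or in z
  first.\<close>

lemma bcoef_trinomial_swap:
  "bcoef c j s * bcoef d (j - int s) r = bcoef d j r * bcoef c (j - int r) s"
proof -
  have *: "(of_int j gchoose s) * ((of_int j - of_nat s :: 'a) gchoose r)
      = (of_int j gchoose (s + r)) * (of_nat (s + r) gchoose s)" for j :: int and r s
    by (subst gbinomial_trinomial_revision) auto
  have "(of_nat (s + r) gchoose s) = (of_nat (r + s) gchoose r :: 'a)"
    by (subst gbinomial_of_nat_symmetric) (auto simp: add.commute)
  then have "(of_int j gchoose s) * ((of_int j - of_nat s :: 'a) gchoose r) =
      (of_int j gchoose r) * ((of_int j - of_nat r) gchoose s)"
    by (simp only: * add.commute)
  then show ?thesis by (simp add: bcoef_def algebra_simps)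
qed

lemma bcoef_minus_one_eps: "eps (j - int s) * bcoef (-1) j s = eps j * bcoef 1 j s"
  by (simp add: bcoef_def eps_diff_of_nat power_mult_distrib[symmetric] mult.assoc[symmetric])

locale char_0_vector_space = vector_space scale
  for scale :: "'a :: field_char_0 \<Rightarrow> 'v :: ab_group_add \<Rightarrow> 'v"
begin

text \<open>The linear functional that replaces x^(z-i) y^i by \<open>g i\<close> in (x + c y)^z.
  Summing over the support avoids an explicit bound; a family of infinite support yields 0, which is
  why \<open>ev0\<close> is a frequent hypothesis.\<close>

definition bsum :: "'a \<Rightarrow> int \<Rightarrow> (nat \<Rightarrow> 'v) \<Rightarrow> 'v" where
  "bsum c z g = (\<Sum>i | g i \<noteq> 0. scale (bcoef c z i) (g i))"

lemma bsum_eq: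
  assumes "\<And>i. K \<le> i \<Longrightarrow> g i = 0"
  shows "bsum c z g = (\<Sum>i<K. scale (bcoef c z i) (g i))"
  unfolding bsum_def
proof (rule sum.mono_neutral_left)
  show "{i. g i \<noteq> 0} \<subseteq> {..<K}"
    using assms by (metis (mono_tags, lifting) lessThan_iff mem_Collect_eq not_le subsetI)
qed auto

lemma bsum_zero [simp]: "bsum c z (\<lambda>i. 0) = 0"
  by (simp add: bsum_def)

lemma bsum_eq_single:
  assumes "\<And>i. i \<noteq> k \<Longrightarrow> g i = 0"
  shows "bsum c z g = scale (bcoef c z k) (g k)"
proof -
  have "bsum c z g = (\<Sum>i<Suc k. scale (bcoef c z i) (g i))"
    using assms by (intro bsum_eq) auto
  also have "\<dots> = (\<Sum>i<Suc k. if i = k then scale (bcoef c z k) (g k) else 0)"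
    using assms by (intro sum.cong) auto
  finally show ?thesis by simp
qed

lemma bsum_0_left:
  assumes "ev0 g"
  shows "bsum c 0 g = g 0"
proof -
  obtain K where K: "\<And>i. K \<le> i \<Longrightarrow> g i = 0" using assms unfolding ev0_def by blast
  have "bsum c 0 g = (\<Sum>i<Suc K. scale (bcoef c 0 i) (g i))"
    using K by (intro bsum_eq) auto
  also have "\<dots> = (\<Sum>i<Suc K. if i = 0 then g 0 else 0)"
    by (intro sum.cong) (auto simp: bcoef_0_left)
  finally show ?thesis by simp
qed

lemma bsum_hom:
  assumes "ev0 g" and "\<And>x y. h (x + y) = h x + h y" and "\<And>c x. h (scale c x) = scale c (h x)"
  shows "h (bsum c z g) = bsum c z (\<lambda>i. h (g i))"
proof -
  obtain K where K: "\<And>i. K \<le> i \<Longrightarrow> g i = 0" using assms(1) unfolding ev0_def by blast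
  have h0: "h 0 = 0" using assms(2)[of 0 0] by simp
  have hsum: "h (sum f A) = (\<Sum>i\<in>A. h (f i))" for f and A :: "nat set"
    using h0 assms(2) by (induction A rule: infinite_finite_induct) auto
  show ?thesis using K by (simp add: bsum_eq[of K] h0 hsum assms(3))
qed

lemma bsum_scale: "ev0 g \<Longrightarrow> bsum c z (\<lambda>i. scale d (g i)) = scale d (bsum c z g)"
  by (rule bsum_hom[symmetric]) (auto simp: scale_right_distrib scale_left_commute)

lemma bsum_add:
  assumes "ev0 f" "ev0 g"
  shows "bsum c z (\<lambda>i. f i + g i) = bsum c z f + bsum c z g"
proof -
  obtain K L where "\<forall>i\<ge>K. f i = 0" "\<forall>i\<ge>L. g i = 0"
    using assms unfolding ev0_def by blast
  then show ?thesis
    by (simp add: bsum_eq[of "max K L"] scale_right_distrib sum.distrib)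
qed

lemma bsum_diff:
  assumes "ev0 f" "ev0 g"
  shows "bsum c z (\<lambda>i. f i - g i) = bsum c z f - bsum c z g"
proof -
  obtain K L where "\<forall>i\<ge>K. f i = 0" "\<forall>i\<ge>L. g i = 0"
    using assms unfolding ev0_def by blast
  then show ?thesis
    by (simp add: bsum_eq[of "max K L"] scale_right_diff_distrib sum_subtractf)
qed

text \<open>This is (x + c y)^(z+1) = x (x + c y)^z + c y (x + c y)^z, where the factor y shifts the
  family.\<close>

lemma bsum_Pascal:
  assumes "ev0 g"
  shows "bsum c (z + 1) g = bsum c z g + scale c (bsum c z (\<lambda>i. g (Suc i)))"
proof -
  obtain K where K: "\<And>i. K \<le> i \<Longrightarrow> g i = 0" using assms unfolding ev0_def by blast
  have 1: "bsum c y g = g 0 + (\<Sum>i<K. scale (bcoef c y (Suc i)) (g (Suc i)))" for y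
    using K by (subst bsum_eq[of "Suc K"]) (auto simp: sum.lessThan_Suc_shift simp del: sum.lessThan_Suc)
  have 2: "bsum c z (\<lambda>i. g (Suc i)) = (\<Sum>i<K. scale (bcoef c z i) (g (Suc i)))"
    using K by (intro bsum_eq) auto
  show ?thesis
    by (simp add: 1 2 bcoef_Suc scale_left_distrib sum.distrib scale_sum_right add.assoc)
qed

lemma bsum_bsum:
  assumes "\<And>i k. K \<le> i + k \<Longrightarrow> g i k = 0"
  shows "bsum c y (\<lambda>i. bsum d (z i) (g i)) =
    (\<Sum>e<K. \<Sum>i\<le>e. scale (bcoef c y i * bcoef d (z i) (e - i)) (g i (e - i)))"
proof -
  let ?f = "\<lambda>i k. scale (bcoef c y i * bcoef d (z i) k) (g i k)"
  have inner: "bsum d (z i) (g i) = (\<Sum>k<K. scale (bcoef d (z i) k) (g i k))" for i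
    using assms by (intro bsum_eq) auto
  have "bsum c y (\<lambda>i. bsum d (z i) (g i)) = (\<Sum>i<K. \<Sum>k<K. ?f i k)"
    unfolding inner using assms by (subst bsum_eq[of K]) (auto simp: scale_sum_right)
  also have "\<dots> = (\<Sum>(i, k)\<in>{..<K} \<times> {..<K}. ?f i k)"
    by (simp add: sum.cartesian_product)
  also have "\<dots> = (\<Sum>(i, k)\<in>{(i, k). i + k < K}. ?f i k)"
    using assms by (intro sum.mono_neutral_right) (auto, meson not_le)
  also have "\<dots> = (\<Sum>e<K. \<Sum>i\<le>e. ?f i (e - i))"
    by (rule sum.triangle_reindex)
  finally show ?thesis .
qed

lemma ev0_bsum: "fin2 g \<Longrightarrow> ev0 (\<lambda>i. bsum c (z i) (g i))"
proof -
  assume "fin2 g"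
  then obtain K where K: "\<And>i k. K \<le> i \<Longrightarrow> g i k = 0" unfolding fin2_def by blast
  have "bsum c (z i) (g i) = 0" if "K \<le> i" for i
  proof -
    have "g i = (\<lambda>k. 0)" using K[OF that] by blast
    then show ?thesis by simp
  qed
  then show ?thesis unfolding ev0_def by blast
qed

lemma fin2_triangle:
  assumes "fin2 g"
  obtains K where "\<And>i k. K \<le> i + k \<Longrightarrow> g i k = 0"
proof -
  obtain K where K: "\<And>i k. K \<le> i \<or> K \<le> k \<Longrightarrow> g i k = 0"
    using assms unfolding fin2_def by blast
  have "g i k = 0" if "2 * K \<le> i + k" for i k
    using that by (intro K) linarith
  then show ?thesis by (rule that)
qed

text \<open>Multiplication of two powers of one linear form: the exponents add up, as the family
  depends only on the total power.\<close>

lemma bsum_Vandermonde: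
  assumes "ev0 g"
  shows "bsum c y (\<lambda>i. bsum c z (\<lambda>k. g (i + k))) = bsum c (y + z) g"
proof -
  obtain K where K: "\<And>i. K \<le> i \<Longrightarrow> g i = 0" using assms unfolding ev0_def by blast
  have "bsum c y (\<lambda>i. bsum c z (\<lambda>k. g (i + k))) =
      (\<Sum>e<K. \<Sum>i\<le>e. scale (bcoef c y i * bcoef c z (e - i)) (g (i + (e - i))))"
    using K by (rule bsum_bsum)
  also have "\<dots> = (\<Sum>e<K. scale (\<Sum>i\<le>e. bcoef c y i * bcoef c z (e - i)) (g e))"
    by (intro sum.cong) (auto simp: scale_sum_left)
  also have "\<dots> = bsum c (y + z) g"
    by (simp add: bcoef_Vandermonde bsum_eq[OF K])
  finally show ?thesis .
qed

lemma bsum_swap: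
  assumes "fin2 g"
  shows "bsum c y (\<lambda>i. bsum d z (\<lambda>k. g i k)) = bsum d z (\<lambda>k. bsum c y (\<lambda>i. g i k))"
proof -
  obtain K where K: "\<And>i k. K \<le> i \<or> K \<le> k \<Longrightarrow> g i k = 0"
    using assms unfolding fin2_def by blast
  have 1: "bsum d z (\<lambda>k. g i k) = (\<Sum>k<K. scale (bcoef d z k) (g i k))" for i
    using K by (intro bsum_eq) auto
  have 2: "bsum c y (\<lambda>i. g i k) = (\<Sum>i<K. scale (bcoef c y i) (g i k))" for k
    using K by (intro bsum_eq) auto
  show ?thesis unfolding 1 2
    by (subst (1 2) bsum_eq[of K])
      (auto simp: K scale_sum_right mult.commute intro: sum.swap)
qed

text \<open>Regroups the powers s of y and r of z by the total power h, through
  \<open>bcoef_trinomial\<close>; the inner sum on the right is then an expansion of (y +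
  z)^h.\<close>

lemma bsum_trinomial:
  assumes "fin2 g"
  shows "bsum c j (\<lambda>s. bsum c (j - int s) (\<lambda>r. g s r)) =
    bsum c j (\<lambda>h. bsum 1 (int h) (\<lambda>s. g s (h - s)))"
proof -
  obtain K where K: "\<And>i k. K \<le> i + k \<Longrightarrow> g i k = 0"
    using fin2_triangle[OF assms] by blast
  have inner: "bsum 1 (int h) (\<lambda>s. g s (h - s)) =
      (\<Sum>s\<le>h. scale (bcoef 1 (int h) s) (g s (h - s)))" for h
  proof -
    \<comment> \<open>The bound has to exceed both the support and h; the terms with s > h drop out
      because their binomial coefficient is 0.\<close>
    have "bsum 1 (int h) (\<lambda>s. g s (h - s)) =
        (\<Sum>s<K + Suc h. scale (bcoef 1 (int h) s) (g s (h - s)))"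
      using K by (intro bsum_eq) auto
    also have "\<dots> = (\<Sum>s\<le>h. scale (bcoef 1 (int h) s) (g s (h - s)))"
      by (intro sum.mono_neutral_right) (auto simp: bcoef_eq_0)
    finally show ?thesis .
  qed
  have "bsum c j (\<lambda>s. bsum c (j - int s) (\<lambda>r. g s r)) =
      (\<Sum>h<K. \<Sum>s\<le>h. scale (bcoef c j s * bcoef c (j - int s) (h - s)) (g s (h - s)))"
    using K by (rule bsum_bsum)
  also have "\<dots> = (\<Sum>h<K. \<Sum>s\<le>h. scale (bcoef c j h * bcoef 1 (int h) s) (g s (h - s)))"
    by (intro sum.cong) (auto simp: bcoef_trinomial)
  also have "\<dots> = bsum c j (\<lambda>h. bsum 1 (int h) (\<lambda>s. g s (h - s)))"
    unfolding inner using K by (subst bsum_eq[of K]) (auto simp: scale_sum_right intro!: sum.neutral)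
  finally show ?thesis .
qed

lemma bsum_trinomial_swap:
  assumes "fin2 g"
  shows "bsum c j (\<lambda>s. bsum d (j - int s) (\<lambda>r. g s r)) =
    bsum d j (\<lambda>r. bsum c (j - int r) (\<lambda>s. g s r))"
proof -
  obtain K where K: "\<And>i k. K \<le> i \<or> K \<le> k \<Longrightarrow> g i k = 0"
    using assms unfolding fin2_def by blast
  have 1: "bsum d z (\<lambda>k. g i k) = (\<Sum>k<K. scale (bcoef d z k) (g i k))" for i z
    using K by (intro bsum_eq) auto
  have 2: "bsum c y (\<lambda>i. g i k) = (\<Sum>i<K. scale (bcoef c y i) (g i k))" for k y
    using K by (intro bsum_eq) auto
  have "(\<Sum>s<K. \<Sum>r<K. scale (bcoef c j s * bcoef d (j - int s) r) (g s r)) =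
      (\<Sum>r<K. \<Sum>s<K. scale (bcoef d j r * bcoef c (j - int r) s) (g s r))"
    unfolding bcoef_trinomial_swap[of c] by (rule sum.swap)
  then show ?thesis unfolding 1 2
    by (subst (1 2) bsum_eq[of K]) (auto simp: K scale_sum_right)
qed

text \<open>This is (-1)^j (x + y)^j = (-x - y)^j: the sign of x^(j-i) goes into the family, and
  that of y^i turns 1 into -1.\<close>

lemma bsum_eps:
  "scale (eps j) (bsum 1 j g) = bsum (-1) j (\<lambda>i. scale (eps (j - int i)) (g i))"
proof -
  have nz: "(scale (eps (j - int i)) (g i) = 0) \<longleftrightarrow> g i = 0" for i
    by (metis eps_square mult_zero_left scale_eq_0_iff zero_neq_one)
  show ?thesis unfolding bsum_def nz scale_sum_right
    by (intro sum.cong) (simp_all add: bcoef_minus_one_eps mult.commute flip: bcoef_minus_one_eps)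
qed

end

section \<open>The Borcherds identity\<close>

text \<open>The index type is any abelian group because the multi-index of a product enters the
  identities only through sums and differences. The Jacobi identity is not an axiom: the closure
  theorems below derive it for given vectors.\<close>

locale vertex_modes = char_0_vector_space scale
  for scale :: "'a :: field_char_0 \<Rightarrow> 'v :: ab_group_add \<Rightarrow> 'v" +
  fixes Y :: "'v \<Rightarrow> int \<Rightarrow> 'i :: ab_group_add \<Rightarrow> 'v \<Rightarrow> 'v"
  assumes Y_add_left: "Y (u + v) m p w = Y u m p w + Y v m p w"
    and Y_scale_left: "Y (scale c u) m p w = scale c (Y u m p w)"
    and Y_add_right: "Y u m p (v + w) = Y u m p v + Y u m p w"
    and Y_scale_right: "Y u m p (scale c w) = scale c (Y u m p w)"
    and truncation: "\<exists>n. \<forall>m\<ge>n. \<forall>p. Y u m p w = 0"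
begin

lemma Y_0_left [simp]: "Y 0 m p w = 0"
  using Y_add_left[of 0 0 m p w] by simp

lemma Y_0_right [simp]: "Y u m p 0 = 0"
  using Y_add_right[of u m p 0 0] by simp

lemma Y_diff_left: "Y (u - v) m p w = Y u m p w - Y v m p w"
  using Y_add_left[of "u - v" v m p w] by (simp add: algebra_simps)

lemma Y_diff_right: "Y u m p (v - w) = Y u m p v - Y u m p w"
  using Y_add_right[of u m p "v - w" w] by (simp add: algebra_simps)

lemma Y_bsum_left: "ev0 g \<Longrightarrow> Y (bsum c z g) m p w = bsum c z (\<lambda>i. Y (g i) m p w)"
  by (rule bsum_hom) (auto simp: Y_add_left Y_scale_left)

lemma Y_bsum_right: "ev0 g \<Longrightarrow> Y u m p (bsum c z g) = bsum c z (\<lambda>i. Y u m p (g i))"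
  by (rule bsum_hom) (auto simp: Y_add_right Y_scale_right)

lemma ev0_trunc: "ev0 (\<lambda>i. Y u (m + int i) p w)"
proof -
  obtain n where n: "\<And>m. n \<le> m \<Longrightarrow> Y u m p w = 0" using truncation by blast
  have "Y u (m + int i) p w = 0" if "nat (n - m) \<le> i" for i
    using that by (intro n) linarith
  then show ?thesis unfolding ev0_def by blast
qed

lemma ev0_Y_left: "ev0 g \<Longrightarrow> ev0 (\<lambda>i. Y (g i) (f i) p (h i))"
  unfolding ev0_def by (elim exE, rule_tac x = K in exI) simp

lemma ev0_Y_right: "ev0 g \<Longrightarrow> ev0 (\<lambda>i. Y (h i) (f i) p (g i))"
  unfolding ev0_def by (elim exE, rule_tac x = K in exI) simp

lemma trunc_left_family:
  assumes "ev0 g"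
  shows "\<exists>n. \<forall>i. \<forall>m\<ge>n. Y (g i) m p w = 0"
proof -
  obtain K where K: "\<And>i. K \<le> i \<Longrightarrow> g i = 0" using assms unfolding ev0_def by blast
  have "\<forall>i. \<exists>n. \<forall>m\<ge>n. Y (g i) m p w = 0" using truncation by blast
  from choice[OF this] obtain N where N: "\<And>i m. N i \<le> m \<Longrightarrow> Y (g i) m p w = 0" by blast
  have "Y (g i) m p w = 0" if "(\<Sum>i<K. \<bar>N i\<bar>) \<le> m" for i m
  proof (cases "i < K")
    case True
    then have "\<bar>N i\<bar> \<le> (\<Sum>i<K. \<bar>N i\<bar>)" by (intro member_le_sum) auto
    then show ?thesis using that by (intro N) linarith
  qed (use K in auto)
  then show ?thesis by blast
qed

text \<open>
  The component of the Jacobi identity at exponents \<open>p\<close>, \<open>q\<close> is the equality of the following two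
  sides; \<open>l\<close>, \<open>m\<close>, \<open>n\<close> are the powers of \<open>x - y\<close>, \<open>x\<close>, \<open>y\<close> in the residue that extracts it.
\<close>

definition iterate_side where
  "iterate_side u v p q l m n w =
     bsum 1 m (\<lambda>i. Y (Y u (l + int i) p v) (m + n - int i) q w)"

definition commutator_side where
  "commutator_side u v p q l m n w =
     bsum (-1) l (\<lambda>i. Y u (l + m - int i) p (Y v (n + int i) (q - p) w)) -
     scale (eps l) (bsum (-1) l (\<lambda>i. Y v (n + l - int i) (q - p) (Y u (m + int i) p w)))"

definition borcherds where
  "borcherds u v \<longleftrightarrow>
     (\<forall>p q l m n w. iterate_side u v p q l m n w = commutator_side u v p q l m n w)"

text \<open>The case m = 0 of the Borcherds identity, see \<open>iterate_side_0\<close>; it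
  determines the modes of a product of two vectors.\<close>

definition iterate_formula where
  "iterate_formula u v \<longleftrightarrow>
     (\<forall>p q l n w. Y (Y u l p v) n q w = commutator_side u v p q l 0 n w)"

text \<open>The case l = 0 of the Borcherds identity, see \<open>commutator_side_0\<close>.\<close>

definition commutator_formula where
  "commutator_formula u v \<longleftrightarrow>
     (\<forall>p q m n w. Y u m p (Y v n (q - p) w) - Y v n (q - p) (Y u m p w) =
        iterate_side u v p q 0 m n w)"

lemma iterate_side_0: "iterate_side u v p q l 0 n w = Y (Y u l p v) n q w"
  unfolding iterate_side_def by (subst bsum_0_left) (auto intro: ev0_Y_left ev0_trunc)

lemma commutator_side_0:
  "commutator_side u v p q 0 m n w = Y u m p (Y v n (q - p) w) - Y v n (q - p) (Y u m p w)"
  unfolding commutator_side_def by (subst (1 2) bsum_0_left) (auto intro: ev0_Y_right ev0_trunc)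

text \<open>In the residue, x = (x - y) + y: one more factor x splits into one more factor x - y and
  one more factor y.\<close>

lemma iterate_side_rec:
  "iterate_side u v p q l (m + 1) n w =
     iterate_side u v p q (l + 1) m n w + iterate_side u v p q l m (n + 1) w"
  unfolding iterate_side_def
  by (subst bsum_Pascal) (auto intro: ev0_Y_left ev0_trunc simp: algebra_simps)

lemma commutator_side_rec:
  "commutator_side u v p q l (m + 1) n w =
     commutator_side u v p q (l + 1) m n w + commutator_side u v p q l m (n + 1) w"
proof -
  \<comment> \<open>Both expansions of (x - y)^(l+1) are reduced to (x - y)^l by Pascal's rule; the
    sign change from \<open>eps l\<close> to \<open>eps (l + 1)\<close> makes the second one match
    the first.\<close>
  have 1: "bsum (-1) (l + 1) (\<lambda>i. Y u (l + 1 + m - int i) p (Y v (n + int i) (q - p) w)) =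
      bsum (-1) l (\<lambda>i. Y u (l + (m + 1) - int i) p (Y v (n + int i) (q - p) w)) -
      bsum (-1) l (\<lambda>i. Y u (l + m - int i) p (Y v (n + 1 + int i) (q - p) w))"
    by (subst bsum_Pascal) (auto intro: ev0_Y_right ev0_trunc simp: algebra_simps)
  have 2: "bsum (-1) (l + 1) (\<lambda>i. Y v (n + (l + 1) - int i) (q - p) (Y u (m + int i) p w)) =
      bsum (-1) l (\<lambda>i. Y v (n + 1 + l - int i) (q - p) (Y u (m + int i) p w)) -
      bsum (-1) l (\<lambda>i. Y v (n + l - int i) (q - p) (Y u (m + 1 + int i) p w))"
    by (subst bsum_Pascal) (auto intro: ev0_Y_right ev0_trunc simp: algebra_simps)
  show ?thesis
    unfolding commutator_side_def 1 2
    by (simp add: eps_add scale_right_diff_distrib algebra_simps)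
qed

text \<open>The difference D of the two sides satisfies D(l, m+1, n) = D(l+1, m, n) + D(l, m, n+1),
  and the two formulas say that it vanishes for l = 0 and for m = 0. Upward in l the recursion
  determines D(l+1, m, n) directly. Downward in l it only moves weight between m and n, and m = 0 is
  the starting point of a second induction.\<close>

lemma borcherds_iff: "borcherds u v \<longleftrightarrow> iterate_formula u v \<and> commutator_formula u v"
proof
  assume B: "borcherds u v"
  then show "iterate_formula u v \<and> commutator_formula u v"
    unfolding iterate_formula_def commutator_formula_def borcherds_def
    by (simp flip: iterate_side_0 commutator_side_0)
next
  assume *: "iterate_formula u v \<and> commutator_formula u v"
  have "iterate_side u v p q l m n w = commutator_side u v p q l m n w" for p q l m n w
  proof -
    define D where
      "D = (\<lambda>l m n. iterate_side u v p q l m n w - commutator_side u v p q l m n w)"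
    have rec: "D l (m + 1) n = D (l + 1) m n + D l m (n + 1)" for l m n
      by (simp add: D_def iterate_side_rec commutator_side_rec)
    have l0: "D 0 m n = 0" for m n
      using * by (simp add: D_def commutator_side_0 commutator_formula_def)
    have m0: "D l 0 n = 0" for l n
      using * by (simp add: D_def iterate_side_0 iterate_formula_def)
    have "\<forall>m n. D l m n = 0"
    proof (induction l rule: int_induct[of _ 0])
      case (step1 i)
      show ?case
      proof (intro allI)
        fix m n
        show "D (i + 1) m n = 0" using rec[of i m n] step1 by simp
      qed
    next
      case (step2 i)
      have shift: "D (i - 1) (m + 1) n = D (i - 1) m (n + 1)" for m n
        using rec[of "i - 1" m n] step2 by simp
      have "\<forall>n. D (i - 1) m n = 0" for m
      proof (induction m rule: int_induct[of _ 0])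
        case (step2 m)
        have "D (i - 1) (m - 1) n = 0" for n
          using shift[of "m - 1" "n - 1"] step2(2) by simp
        then show ?case by blast
      qed (simp_all add: m0 shift)
      then show ?case by blast
    qed (simp add: l0)
    then show ?thesis by (simp add: D_def)
  qed
  then show "borcherds u v" unfolding borcherds_def by blast
qed

end

lemma fin2I_ev0:
  assumes "ev0 f" and "\<And>i k. f i = 0 \<Longrightarrow> g i k = 0" and "\<And>i. ev0 (g i)"
  shows "fin2 g"
proof (rule fin2I)
  show "\<exists>K. \<forall>i\<ge>K. \<forall>k. g i k = 0"
    using assms(1,2) unfolding ev0_def by blast
qed (rule assms(3))

lemma fin2_map:
  assumes "fin2 g" and "\<And>i k. h i k 0 = 0"
  shows "fin2 (\<lambda>i k. h i k (g i k))"
proof -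
  obtain K where K: "\<And>i k. K \<le> i \<or> K \<le> k \<Longrightarrow> g i k = 0"
    using assms(1) unfolding fin2_def by blast
  then have "\<forall>i k. K \<le> i \<or> K \<le> k \<longrightarrow> h i k (g i k) = 0" using assms(2) by simp
  then show ?thesis unfolding fin2_def by blast
qed

context char_0_vector_space
begin

lemma ev0_scale: "ev0 g \<Longrightarrow> ev0 (\<lambda>i. scale c (g i))"
  unfolding ev0_def by (elim exE, rule_tac x = K in exI) simp

text \<open>\<open>bsum_trinomial\<close> for a family given by s and the total power h. For s > h
  the entry \<open>G s h\<close> does not come from the double family on the left and may be
  nonzero, but its coefficient \<open>bcoef 1 (int h) s\<close> is 0; this also covers the truncated
  subtraction in h - s.\<close>

lemma bsum_trinomial':
  assumes fin: "fin2 (\<lambda>s r. G s (s + r))" and ev: "\<And>h. ev0 (\<lambda>s. G s h)"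
  shows "bsum c j (\<lambda>s. bsum c (j - int s) (\<lambda>r. G s (s + r))) =
    bsum c j (\<lambda>h. bsum 1 (int h) (\<lambda>s. G s h))"
proof -
  have "bsum 1 (int h) (\<lambda>s. G s (s + (h - s))) = bsum 1 (int h) (\<lambda>s. G s h)" for h
  proof -
    obtain K where K: "\<And>i. K \<le> i \<Longrightarrow> G i h = 0" using ev[of h] unfolding ev0_def by blast
    obtain L where L: "\<And>s r. L \<le> s + r \<Longrightarrow> G s (s + r) = 0"
      using fin2_triangle[OF fin] by blast
    let ?M = "K + L + Suc h"
    have "bsum 1 (int h) (\<lambda>s. G s (s + (h - s))) =
        (\<Sum>s<?M. scale (bcoef 1 (int h) s) (G s (s + (h - s))))"
    proof (rule bsum_eq)
      fix s assume "?M \<le> s"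
      then have "L \<le> s + (h - s)" by simp
      then show "G s (s + (h - s)) = 0" by (rule L)
    qed
    also have "\<dots> = (\<Sum>s<?M. scale (bcoef 1 (int h) s) (G s h))"
    proof (rule sum.cong)
      fix s show "scale (bcoef 1 (int h) s) (G s (s + (h - s))) = scale (bcoef 1 (int h) s) (G s h)"
        by (cases "s \<le> h") (auto simp: bcoef_eq_0)
    qed simp
    also have "\<dots> = bsum 1 (int h) (\<lambda>s. G s h)"
      using K by (intro bsum_eq[symmetric]) auto
    finally show ?thesis .
  qed
  then show ?thesis
    using bsum_trinomial[OF fin, of c j] by simp
qed

end

section \<open>Regrouping residues of three fields\<close>

context vertex_modes
begin

lemma iterate_formulaD:
  assumes "iterate_formula a x"
  shows "Y (Y a j s x) k p y =
    bsum (-1) j (\<lambda>h. Y a (j - int h) s (Y x (k + int h) (p - s) y)) -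
    scale (eps j) (bsum (-1) j (\<lambda>h. Y x (k + j - int h) (p - s) (Y a (int h) s y)))"
  using assms by (simp add: iterate_formula_def commutator_side_def)

lemma commutator_formulaD:
  assumes "commutator_formula a v"
  shows "Y a m s (Y v n q w) - Y v n q (Y a m s w) =
    bsum 1 m (\<lambda>i. Y (Y a (int i) s v) (m + n - int i) (q + s) w)"
proof -
  have "Y a m s (Y v n (q + s - s) w) - Y v n (q + s - s) (Y a m s w) =
      iterate_side a v s (q + s) 0 m n w"
    using assms unfolding commutator_formula_def by blast
  then show ?thesis by (simp add: iterate_side_def)
qed

lemma fin2_trunc: "fin2 (\<lambda>i h. Y u (m + int i + int h) p w)"
proof -
  obtain n where n: "\<And>m. n \<le> m \<Longrightarrow> Y u m p w = 0" using truncation by blast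
  have "Y u (m + int i + int h) p w = 0" if "nat (n - m) \<le> i \<or> nat (n - m) \<le> h" for i h
    using that by (intro n) linarith
  then show ?thesis unfolding fin2_def by blast
qed

lemma ev0_convolution:
  assumes "ev0 g"
  shows "ev0 (\<lambda>k. bsum c (z k) (\<lambda>h. Y (g h) (e + int k - int h) q w))"
proof -
  obtain K where K: "\<And>h. K \<le> h \<Longrightarrow> g h = 0" using assms unfolding ev0_def by blast
  obtain n where n: "\<And>h m. n \<le> m \<Longrightarrow> Y (g h) m q w = 0"
    using trunc_left_family[OF assms] by blast
  \<comment> \<open>The threshold pushes the mode index beyond the common truncation bound
    \<open>n\<close> for each h < K; for larger h the vector itself is 0.\<close>
  have "Y (g h) (e + int k - int h) q w = 0" if "nat (n - e) + K \<le> k" for h k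
  proof (cases "h < K")
    case True
    then show ?thesis using that by (intro n) linarith
  qed (use K in auto)
  then have "\<forall>k\<ge>nat (n - e) + K. bsum c (z k) (\<lambda>h. Y (g h) (e + int k - int h) q w) = 0"
    by simp
  then show ?thesis unfolding ev0_def by blast
qed

text \<open>Let t, x, y be the variables of a, u, v. Here h is the power of x - y and r that of y in
  (t - (x - y) - y)^j. Grouping by k = h + r replaces ((x - y) + y)^k by x^k, which is absorbed in
  the exponent m.\<close>

lemma mode_mode_iterate:
  fixes p :: 'i
  shows "bsum 1 m (\<lambda>i. bsum (-1) j (\<lambda>h. bsum (-1) (j - int h)
      (\<lambda>r. Y a (j - int h - int r) s
        (Y (Y u (l + int i + int h) p v) (m + n - int i + int r) q w)))) =
    bsum (-1) j (\<lambda>k. Y a (j - int k) s (iterate_side u v p q l (m + int k) n w))"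
    (is "?lhs = ?rhs")
proof -
  define X where "X = (\<lambda>i k h. Y (Y u (l + int i + int h) p v) (m + n - int i + int k - int h) q w)"
  have evX: "ev0 (X i k)" for i k
    unfolding X_def by (rule ev0_Y_left) (rule ev0_trunc)
  have finX: "fin2 (\<lambda>i h. Y u (l + int i + int h) p v)" by (rule fin2_trunc)
  have inner: "bsum (-1) j (\<lambda>h. bsum (-1) (j - int h)
      (\<lambda>r. Y a (j - int h - int r) s
        (Y (Y u (l + int i + int h) p v) (m + n - int i + int r) q w))) =
      bsum (-1) j (\<lambda>k. Y a (j - int k) s (bsum 1 (int k) (X i k)))" for i
  proof -
    let ?G = "\<lambda>h e. Y a (j - int e) s (X i e h)"
    have "fin2 (\<lambda>h r. ?G h (h + r))"
    proof (rule fin2I_ev0)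
      show "ev0 (\<lambda>h. Y u (l + int i + int h) p v)" by (rule ev0_trunc)
      have *: "X i (h + r) h = Y (Y u (l + int i + int h) p v) (m + n - int i + int r) q w" for h r
        by (simp add: X_def algebra_simps)
      show "ev0 (\<lambda>r. ?G h (h + r))" for h
        unfolding * by (intro ev0_Y_right ev0_trunc)
    qed (simp add: X_def)
    moreover have "ev0 (\<lambda>h. ?G h e)" for e
      by (intro ev0_Y_right evX)
    ultimately have "bsum (-1) j (\<lambda>h. bsum (-1) (j - int h) (\<lambda>r. ?G h (h + r))) =
        bsum (-1) j (\<lambda>k. bsum 1 (int k) (\<lambda>h. ?G h k))"
      by (rule bsum_trinomial')
    then show ?thesis
      by (simp add: Y_bsum_right[OF evX]) (simp add: X_def algebra_simps)
  qed
  have fin: "fin2 (\<lambda>i k. Y a (j - int k) s (bsum 1 (int k) (X i k)))"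
  proof (rule fin2I)
    obtain K where K: "\<And>i h. K \<le> i \<Longrightarrow> Y u (l + int i + int h) p v = 0"
      using finX unfolding fin2_def by blast
    show "\<exists>K. \<forall>i\<ge>K. \<forall>k. Y a (j - int k) s (bsum 1 (int k) (X i k)) = 0"
      by (rule exI[of _ K]) (simp add: X_def K)
    show "ev0 (\<lambda>k. Y a (j - int k) s (bsum 1 (int k) (X i k)))" for i
      unfolding X_def by (intro ev0_Y_right ev0_convolution ev0_trunc)
  qed
  have "?lhs = bsum (-1) j (\<lambda>k. bsum 1 m (\<lambda>i. Y a (j - int k) s (bsum 1 (int k) (X i k))))"
    unfolding inner by (rule bsum_swap[OF fin])
  moreover have "bsum 1 m (\<lambda>i. Y a (j - int k) s (bsum 1 (int k) (X i k))) =
      Y a (j - int k) s (iterate_side u v p q l (m + int k) n w)" for k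
  proof -
    let ?g = "\<lambda>e. Y (Y u (l + int e) p v) (m + int k + n - int e) q w"
    have g: "ev0 ?g" by (intro ev0_Y_left ev0_trunc)
    have X: "X i k = (\<lambda>h. ?g (i + h))" for i
      by (rule ext) (simp add: X_def algebra_simps)
    have "fin2 (X' :: nat \<Rightarrow> nat \<Rightarrow> 'v)" if "X' = (\<lambda>i. X i k)" for X'
      unfolding that X_def by (rule fin2_map[OF finX]) simp
    then have "ev0 (\<lambda>i. bsum 1 (int k) (X i k))"
      using ev0_bsum[of "\<lambda>i. X i k" 1 "\<lambda>_. int k"] by blast
    then have "bsum 1 m (\<lambda>i. Y a (j - int k) s (bsum 1 (int k) (X i k))) =
        Y a (j - int k) s (bsum 1 m (\<lambda>i. bsum 1 (int k) (X i k)))"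
      by (rule Y_bsum_right[symmetric])
    also have "bsum 1 m (\<lambda>i. bsum 1 (int k) (X i k)) = bsum 1 (m + int k) ?g"
      unfolding X by (rule bsum_Vandermonde[OF g])
    finally show ?thesis by (simp add: iterate_side_def)
  qed
  ultimately show ?thesis by simp
qed

text \<open>The companion for the expansion in powers of t: for a fixed power r of t, the powers of
  x - y and of y combine to ((x - y) + y)^(j-r) = x^(j-r).\<close>

lemma mode_mode_iterate':
  fixes p :: 'i
  shows "bsum 1 m (\<lambda>i. bsum (-1) j (\<lambda>h. scale (eps (j - int h)) (bsum (-1) (j - int h)
      (\<lambda>r. Y (Y u (l + int i + int h) p v) (m + n - int i + (j - int h) - int r) q
        (Y a (int r) s w))))) =
    scale (eps j) (bsum (-1) j (\<lambda>r. iterate_side u v p q l (m + j - int r) n (Y a (int r) s w)))"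
proof -
  define X where "X = (\<lambda>i h r. Y (Y u (l + int i + int h) p v) (m + n - int i + (j - int h) - int r) q
        (Y a (int r) s w))"
  have finu: "fin2 (\<lambda>i h. Y u (l + int i + int h) p v)" by (rule fin2_trunc)
  have eva: "ev0 (\<lambda>r. Y a (int r) s w)" using ev0_trunc[of a 0] by simp
  have finX: "fin2 (X i)" for i
  proof (rule fin2I_ev0)
    show "ev0 (\<lambda>h. Y u (l + int i + int h) p v)" by (rule ev0_trunc)
    show "ev0 (X i h)" for h
      unfolding X_def by (rule ev0_Y_right[OF eva])
  qed (simp add: X_def)
  have finX': "fin2 (\<lambda>i h. X i h r)" for r
    unfolding X_def by (rule fin2_map[OF finu]) simp
  have inner: "bsum (-1) j (\<lambda>h. scale (eps (j - int h)) (bsum (-1) (j - int h) (X i h))) =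
      scale (eps j) (bsum (-1) j (\<lambda>r. bsum 1 (j - int r) (\<lambda>h. X i h r)))" for i
    unfolding bsum_eps[symmetric] bsum_trinomial_swap[OF finX] ..
  have fin: "fin2 (\<lambda>i r. bsum 1 (j - int r) (\<lambda>h. X i h r))"
  proof (rule fin2I)
    obtain K where K: "\<And>i h. K \<le> i \<Longrightarrow> Y u (l + int i + int h) p v = 0"
      using finu unfolding fin2_def by blast
    show "\<exists>K. \<forall>i\<ge>K. \<forall>r. bsum 1 (j - int r) (\<lambda>h. X i h r) = 0"
      by (rule exI[of _ K]) (simp add: X_def K)
    show "ev0 (\<lambda>r. bsum 1 (j - int r) (\<lambda>h. X i h r))" for i
      using eva unfolding ev0_def by (elim exE, rule_tac x = K in exI) (simp add: X_def)
  qed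
  have "bsum 1 m (\<lambda>i. bsum (-1) j (\<lambda>h. scale (eps (j - int h)) (bsum (-1) (j - int h) (X i h)))) =
      scale (eps j) (bsum 1 m (\<lambda>i. bsum (-1) j (\<lambda>r. bsum 1 (j - int r) (\<lambda>h. X i h r))))"
    unfolding inner by (rule bsum_scale) (rule ev0_bsum[OF fin])
  moreover have "bsum 1 m (\<lambda>i. bsum (-1) j (\<lambda>r. bsum 1 (j - int r) (\<lambda>h. X i h r))) =
      bsum (-1) j (\<lambda>r. bsum 1 m (\<lambda>i. bsum 1 (j - int r) (\<lambda>h. X i h r)))"
    by (rule bsum_swap[OF fin])
  moreover have "bsum 1 m (\<lambda>i. bsum 1 (j - int r) (\<lambda>h. X i h r)) =
      iterate_side u v p q l (m + j - int r) n (Y a (int r) s w)" for r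
  proof -
    let ?g = "\<lambda>e. Y (Y u (l + int e) p v) (m + j - int r + n - int e) q (Y a (int r) s w)"
    have g: "ev0 ?g" by (intro ev0_Y_left ev0_trunc)
    have X: "(\<lambda>h. X i h r) = (\<lambda>h. ?g (i + h))" for i
      by (rule ext) (simp add: X_def algebra_simps)
    show ?thesis
      unfolding X bsum_Vandermonde[OF g] by (simp add: iterate_side_def algebra_simps)
  qed
  ultimately show ?thesis unfolding X_def by simp
qed

text \<open>In the commutator of a(t) and v(y), the power h of t - y produces the vector a_h v.
  Writing (x - t)^j = ((x - y) - (t - y))^j separates these powers, and the remaining (x - y)^(j-h)
  joins (x - y)^l.\<close>

lemma mode_commutator_inside:
  assumes C: "commutator_formula a v"
  shows "bsum (-1) l (\<lambda>i. bsum (-1) j (\<lambda>h. Y u (l + m - int i + j - int h) p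
      (Y a (int h) s (Y v (n + int i) q w) - Y v (n + int i) q (Y a (int h) s w)))) =
    bsum (-1) j (\<lambda>h. bsum (-1) (l + j - int h) (\<lambda>i. Y u (l + j - int h + m - int i) p
      (Y (Y a (int h) s v) (n + int i) (q + s) w)))"
    (is "?lhs = ?rhs")
proof -
  have eva: "ev0 (\<lambda>r. Y a (int r) s v)" using ev0_trunc[of a 0] by simp
  then obtain K where K: "\<And>h. K \<le> h \<Longrightarrow> Y a (int h) s v = 0" unfolding ev0_def by blast
  define X where "X = (\<lambda>h e. Y u (l + j - int h + m - int e) p
      (Y (Y a (int h) s v) (n + int e) (q + s) w))"
  have evX: "ev0 (X h)" for h unfolding X_def by (intro ev0_Y_right ev0_trunc)
  have inner: "bsum (-1) j (\<lambda>h. Y u (l + m - int i + j - int h) p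
      (Y a (int h) s (Y v (n + int i) q w) - Y v (n + int i) q (Y a (int h) s w))) =
      bsum (-1) j (\<lambda>h. bsum (-1) (j - int h) (\<lambda>r. X h (i + r)))" for i
  proof -
    let ?G = "\<lambda>h e. Y u (l + m - int i + j - int e) p
        (Y (Y a (int h) s v) (int e + (n + int i) - int h) (q + s) w)"
    have ev: "ev0 (\<lambda>h. ?G h e)" for e
      by (intro ev0_Y_right ev0_Y_left eva)
    have G: "?G h (h + r) = X h (i + r)" for h r
      by (simp add: X_def algebra_simps)
    have "fin2 (\<lambda>h r. ?G h (h + r))"
      unfolding G
    proof (rule fin2I_ev0[OF eva])
      show "ev0 (\<lambda>r. X h (i + r))" for h by (rule ev0_shift[OF evX])
    qed (simp add: X_def)
    from bsum_trinomial'[OF this ev]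
    have "bsum (-1) j (\<lambda>h. bsum (-1) (j - int h) (\<lambda>r. ?G h (h + r))) =
        bsum (-1) j (\<lambda>e. bsum 1 (int e) (\<lambda>h. ?G h e))" .
    moreover have "bsum 1 (int e) (\<lambda>h. ?G h e) = Y u (l + m - int i + j - int e) p
        (Y a (int e) s (Y v (n + int i) q w) - Y v (n + int i) q (Y a (int e) s w))" for e
      unfolding commutator_formulaD[OF C]
      by (rule Y_bsum_right[symmetric]) (intro ev0_Y_left eva)
    ultimately show ?thesis by (simp only: G)
  qed
  have fin: "fin2 (\<lambda>i h. bsum (-1) (j - int h) (\<lambda>r. X h (i + r)))"
  proof (subst fin2_flip[symmetric], rule fin2I_ev0[OF eva])
    show "ev0 (\<lambda>i. bsum (-1) (j - int h) (\<lambda>r. X h (i + r)))" for h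
    proof (rule ev0_bsum)
      obtain L where L: "\<And>e. L \<le> e \<Longrightarrow> X h e = 0" using evX[of h] unfolding ev0_def by blast
      then have "\<forall>i r. L \<le> i \<or> L \<le> r \<longrightarrow> X h (i + r) = 0" by simp
      then show "fin2 (\<lambda>i r. X h (i + r))" unfolding fin2_def by blast
    qed
  qed (simp add: X_def)
  have "?lhs = bsum (-1) j (\<lambda>h. bsum (-1) l (\<lambda>i. bsum (-1) (j - int h) (\<lambda>r. X h (i + r))))"
    unfolding inner by (rule bsum_swap[OF fin])
  also have "\<dots> = ?rhs"
    unfolding bsum_Vandermonde[OF evX] by (simp add: X_def algebra_simps)
  finally show ?thesis .
qed

text \<open>The same substitution when u is applied before the commutator: now (t - x)^j = ((t - y)
  + (y - x))^j, so the powers of t - y carry no sign and those of y - x account for the factors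
  \<open>eps\<close>.\<close>

lemma mode_commutator_outside:
  assumes C: "commutator_formula a v"
  shows "scale (eps (l + j)) (bsum (-1) l (\<lambda>i. bsum (-1) j (\<lambda>h.
      Y a (j - int h) s (Y v (n + l - int i) q (Y u (m + int i + int h) p w)) -
      Y v (n + l - int i) q (Y a (j - int h) s (Y u (m + int i + int h) p w))))) =
    bsum (-1) j (\<lambda>h. scale (eps (l + j - int h)) (bsum (-1) (l + j - int h)
      (\<lambda>i. Y (Y a (int h) s v) (n + (l + j - int h) - int i) (q + s) (Y u (m + int i) p w))))"
    (is "scale _ ?lhs = ?rhs")
proof -
  have eva: "ev0 (\<lambda>r. Y a (int r) s v)" using ev0_trunc[of a 0] by simp
  have finu: "fin2 (\<lambda>i h. Y u (m + int i + int h) p w)" by (rule fin2_trunc)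
  define X where "X = (\<lambda>h e. Y (Y a (int h) s v) (n + (l + j - int h) - int e) (q + s)
      (Y u (m + int e) p w))"
  have evX: "ev0 (X h)" for h unfolding X_def by (intro ev0_Y_right ev0_trunc)
  have finX: "fin2 (\<lambda>k h. X h (i + k))" for i
  proof (subst fin2_flip[symmetric], rule fin2I_ev0[OF eva])
    show "ev0 (\<lambda>r. X h (i + r))" for h by (rule ev0_shift[OF evX])
  qed (simp add: X_def)
  have inner: "bsum (-1) j (\<lambda>k.
      Y a (j - int k) s (Y v (n + l - int i) q (Y u (m + int i + int k) p w)) -
      Y v (n + l - int i) q (Y a (j - int k) s (Y u (m + int i + int k) p w))) =
      bsum 1 j (\<lambda>h. bsum (-1) (j - int h) (\<lambda>k. X h (i + k)))" for i
  proof -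
    have "Y a (j - int k) s (Y v (n + l - int i) q (Y u (m + int i + int k) p w)) -
        Y v (n + l - int i) q (Y a (j - int k) s (Y u (m + int i + int k) p w)) =
        bsum 1 (j - int k) (\<lambda>h. X h (i + k))" for k
      unfolding commutator_formulaD[OF C] by (simp add: X_def algebra_simps)
    then show ?thesis by (simp only: bsum_trinomial_swap[OF finX])
  qed
  have fin: "fin2 (\<lambda>i h. bsum (-1) (j - int h) (\<lambda>k. X h (i + k)))"
  proof (subst fin2_flip[symmetric], rule fin2I_ev0[OF eva])
    show "ev0 (\<lambda>i. bsum (-1) (j - int h) (\<lambda>r. X h (i + r)))" for h
    proof (rule ev0_bsum)
      obtain L where L: "\<And>e. L \<le> e \<Longrightarrow> X h e = 0" using evX[of h] unfolding ev0_def by blast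
      then have "\<forall>i r. L \<le> i \<or> L \<le> r \<longrightarrow> X h (i + r) = 0" by simp
      then show "fin2 (\<lambda>i r. X h (i + r))" unfolding fin2_def by blast
    qed
  qed (simp add: X_def)
  have "?lhs = bsum 1 j (\<lambda>h. bsum (-1) l (\<lambda>i. bsum (-1) (j - int h) (\<lambda>k. X h (i + k))))"
    unfolding inner by (rule bsum_swap[OF fin])
  also have "\<dots> = bsum 1 j (\<lambda>h. bsum (-1) (l + j - int h) (X h))"
    unfolding bsum_Vandermonde[OF evX] by (simp add: algebra_simps)
  finally have "scale (eps (l + j)) ?lhs = scale (eps l)
      (bsum (-1) j (\<lambda>h. scale (eps (j - int h)) (bsum (-1) (l + j - int h) (X h))))"
    by (simp add: eps_add bsum_eps[symmetric])
  also have "\<dots> = bsum (-1) j (\<lambda>h. scale (eps l)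
      (scale (eps (j - int h)) (bsum (-1) (l + j - int h) (X h))))"
  proof (rule bsum_scale[symmetric])
    show "ev0 (\<lambda>h. scale (eps (j - int h)) (bsum (-1) (l + j - int h) (X h)))"
      using eva unfolding ev0_def by (elim exE, rule_tac x = K in exI) (simp add: X_def)
  qed
  also have "\<dots> = ?rhs"
    by (simp add: X_def eps_add[symmetric] add_diff_eq)
  finally show ?thesis .
qed

text \<open>
  Closure of the Borcherds identity under the modes of \<open>a\<close>.  With \<open>F\<^sub>x\<^sub>y\<^sub>z\<close> for the residue of a
  rational function against \<open>x y z\<close>, expanded in the order of the factors, both sides equal
  \<open>F\<^sub>a\<^sub>u\<^sub>v - F\<^sub>u\<^sub>a\<^sub>v - F\<^sub>v\<^sub>a\<^sub>u + F\<^sub>v\<^sub>u\<^sub>a\<close>; no locality is needed.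
\<close>

theorem borcherds_mode:
  assumes I: "\<And>x. iterate_formula a x" and C: "commutator_formula a v"
    and Bav: "\<And>h. borcherds u (Y a h s v)" and Bv: "borcherds u v"
  shows "borcherds (Y a j s u) v"
  unfolding borcherds_def
proof (intro allI)
  fix p q l m n w
  \<comment> \<open>In each composite of the three fields \<open>a\<close> contributes the index s,
    which leaves p - s for \<open>u\<close> and q - s for \<open>u\<close> and \<open>v\<close>
    together.\<close>
  define p' where "p' = p - s"
  define q' where "q' = q - s"
  have pq: "q' - p' = q - p" "q - p' = q - p + s"
    by (simp_all add: p'_def q'_def)
  let ?a = "\<lambda>k. Y a k s" and ?u = "\<lambda>k. Y u k p'" and ?v = "\<lambda>k. Y v k (q - p)"
  \<comment> \<open>\<open>D\<close> stands for the factors (x - y)^l and (t - x)^j, up to sign,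
    with t the variable of \<open>a\<close>. The name of a family lists the fields from the
    outermost one to the one applied first.\<close>
  define D where "D = (\<lambda>g. bsum (-1) l (\<lambda>i. bsum (-1) j (g i)))"
  define auv where "auv = (\<lambda>i h. ?a (j - int h) (?u (l + m - int i + int h) (?v (n + int i) w)))"
  define avu where "avu = (\<lambda>i h. ?a (j - int h) (?v (n + l - int i) (?u (m + int i + int h) w)))"
  define vau where "vau = (\<lambda>i h. ?v (n + l - int i) (?a (j - int h) (?u (m + int i + int h) w)))"
  define uva where "uva = (\<lambda>i h. ?u (l + m - int i + j - int h) (?v (n + int i) (?a (int h) w)))"
  define vua where "vua = (\<lambda>i h. ?v (n + l - int i) (?u (m + int i + j - int h) (?a (int h) w)))"
  define uav where "uav = (\<lambda>i h. ?u (l + m - int i + j - int h) (?a (int h) (?v (n + int i) w)))"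
  have eva: "ev0 (\<lambda>r. Y a (int r) s x)" for x using ev0_trunc[of a 0] by simp
  have fin [simp]: "fin2 auv" "fin2 avu" "fin2 vau" "fin2 uva" "fin2 vua" "fin2 uav"
  proof -
    show "fin2 auv"
      unfolding auv_def
      by (rule fin2I_ev0[of "\<lambda>i. ?v (n + int i) w"]) (auto intro: ev0_trunc ev0_Y_right)
    show "fin2 avu" unfolding avu_def
      by (rule fin2_map[OF fin2_map[OF fin2_trunc]]) auto
    show "fin2 vau" unfolding vau_def
      by (rule fin2_map[OF fin2_map[OF fin2_trunc]]) auto
    show "fin2 uva" unfolding uva_def
      by (subst fin2_flip[symmetric], rule fin2I_ev0[OF eva[of w]])
        (auto intro: ev0_trunc ev0_Y_right)
    have shift: "m + int i + j - int h = m + j - int h + int i" for i h by simp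
    show "fin2 vua" unfolding vua_def shift
      by (subst fin2_flip[symmetric], rule fin2I_ev0[OF eva[of w]])
        (auto intro: ev0_trunc ev0_Y_right)
    show "fin2 uav" unfolding uav_def
      by (rule fin2I_ev0[of "\<lambda>i. ?v (n + int i) w"]) (auto intro: ev0_trunc ev0_Y_right eva)
  qed
  have ev_l: "ev0 (\<lambda>h. bsum (-1) l (\<lambda>i. g i h))" if "fin2 g" for g
    by (rule ev0_bsum[OF iffD2[OF fin2_flip that]])
  have D_row: "bsum (-1) l (\<lambda>i. bsum (-1) j (f i) - scale c (bsum (-1) j (g i))) =
      D f - scale c (D g)" if f: "fin2 f" and g: "fin2 g" for f g c
    unfolding D_def
    by (simp only: bsum_diff[OF ev0_bsum[OF f] ev0_scale[OF ev0_bsum[OF g]]]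
        bsum_scale[OF ev0_bsum[OF g]])
  have D_col: "bsum (-1) j (\<lambda>h. bsum (-1) l (\<lambda>i. f i h) - scale c (bsum (-1) l (\<lambda>i. g i h))) =
      D f - scale c (D g)" if f: "fin2 f" and g: "fin2 g" for f g c
    unfolding D_def
    by (simp only: bsum_diff[OF ev_l[OF f] ev0_scale[OF ev_l[OF g]]]
        bsum_scale[OF ev_l[OF g]] bsum_swap[OF f] bsum_swap[OF g])
  have D_diff: "D (\<lambda>i h. f i h - g i h) = D f - D g" if f: "fin2 f" and g: "fin2 g" for f g
    unfolding D_def
    by (simp only: bsum_diff[OF fin2_ev0[OF f] fin2_ev0[OF g]]
        bsum_diff[OF ev0_bsum[OF f] ev0_bsum[OF g]])

  have mode_u: "Y (Y a j s u) k p y =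
      bsum (-1) j (\<lambda>h. ?a (j - int h) (?u (k + int h) y)) -
      scale (eps j) (bsum (-1) j (\<lambda>h. ?u (k + j - int h) (?a (int h) y)))" for k y
    unfolding p'_def by (rule iterate_formulaD[OF I])

  have rhs: "commutator_side (Y a j s u) v p q l m n w =
      (D auv - scale (eps j) (D uav)) - scale (eps l) (D vau - scale (eps j) (D vua))"
  proof -
    have "Y (Y a j s u) (l + m - int i) p (?v (n + int i) w) =
        bsum (-1) j (auv i) - scale (eps j) (bsum (-1) j (uav i))" for i
      unfolding auv_def uav_def by (rule mode_u)
    then have 1: "bsum (-1) l (\<lambda>i. Y (Y a j s u) (l + m - int i) p (?v (n + int i) w)) =
        D auv - scale (eps j) (D uav)"
      by (simp only: D_row[OF fin(1) fin(6)])
    have "?v (n + l - int i) (Y (Y a j s u) (m + int i) p w) =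
        bsum (-1) j (vau i) - scale (eps j) (bsum (-1) j (vua i))" for i
    proof -
      have e1: "ev0 (\<lambda>h. ?a (j - int h) (?u (m + int i + int h) w))"
        by (intro ev0_Y_right ev0_trunc)
      have e2: "ev0 (\<lambda>h. ?u (m + int i + j - int h) (?a (int h) w))"
        by (intro ev0_Y_right eva)
      show ?thesis
        unfolding vau_def vua_def mode_u Y_diff_right Y_scale_right Y_bsum_right[OF e1]
          Y_bsum_right[OF e2] ..
    qed
    then have 2: "bsum (-1) l (\<lambda>i. ?v (n + l - int i) (Y (Y a j s u) (m + int i) p w)) =
        D vau - scale (eps j) (D vua)"
      by (simp only: D_row[OF fin(3) fin(5)])
    show ?thesis unfolding commutator_side_def 1 2 ..
  qed

  define P where "P = (\<lambda>i h. Y (?a (j - int h) (?u (l + int i + int h) v)) (m + n - int i) q w)"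
  define Q where "Q = (\<lambda>i h. Y (?u (l + int i + j - int h) (?a (int h) v)) (m + n - int i) q w)"
  have finP: "fin2 P" unfolding P_def by (rule fin2_map[OF fin2_map[OF fin2_trunc]]) auto
  have finQ: "fin2 Q"
  proof -
    have shift: "l + int i + j - int h = l + j - int h + int i" for i h by simp
    show ?thesis unfolding Q_def shift
      by (subst fin2_flip[symmetric], intro fin2I_ev0[OF eva[of v]])
        (auto intro: ev0_trunc ev0_Y_left)
  qed
  have "Y (Y (Y a j s u) (l + int i) p v) (m + n - int i) q w =
      bsum (-1) j (P i) - scale (eps j) (bsum (-1) j (Q i))" for i
  proof -
    have e1: "ev0 (\<lambda>h. ?a (j - int h) (?u (l + int i + int h) v))"
      by (intro ev0_Y_right ev0_trunc)
    have e2: "ev0 (\<lambda>h. ?u (l + int i + j - int h) (?a (int h) v))"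
      by (intro ev0_Y_right eva)
    show ?thesis
      unfolding P_def Q_def mode_u Y_diff_left Y_scale_left Y_bsum_left[OF e1] Y_bsum_left[OF e2] ..
  qed
  then have lhs: "iterate_side (Y a j s u) v p q l m n w =
      bsum 1 m (\<lambda>i. bsum (-1) j (P i)) - scale (eps j) (bsum 1 m (\<lambda>i. bsum (-1) j (Q i)))"
    unfolding iterate_side_def
    by (simp only: bsum_diff[OF ev0_bsum[OF finP] ev0_scale[OF ev0_bsum[OF finQ]]]
        bsum_scale[OF ev0_bsum[OF finQ]])

  \<comment> \<open>\<open>P\<close> collects the terms in which \<open>a\<close> acts on a product
    of \<open>u\<close> and \<open>v\<close>; after the regrouping, the identity for
    \<open>u\<close> and \<open>v\<close> applies under or next to the modes of
    \<open>a\<close>.\<close>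
  have P: "bsum 1 m (\<lambda>i. bsum (-1) j (P i)) =
      (D auv - scale (eps l) (D avu)) - scale (eps j) (D uva - scale (eps l) (D vua))"
  proof -
    define P1 where "P1 = (\<lambda>i h. bsum (-1) (j - int h) (\<lambda>r. ?a (j - int h - int r)
        (Y (?u (l + int i + int h) v) (m + n - int i + int r) q' w)))"
    define P2 where "P2 = (\<lambda>i h. scale (eps (j - int h)) (bsum (-1) (j - int h) (\<lambda>r.
        Y (?u (l + int i + int h) v) (m + n - int i + (j - int h) - int r) q' (?a (int r) w))))"
    have P12: "P i = (\<lambda>h. P1 i h - P2 i h)" for i
      unfolding P_def P1_def P2_def q'_def by (rule ext) (rule iterate_formulaD[OF I])
    have f1: "fin2 P1" unfolding P1_def by (rule fin2_map[OF fin2_trunc]) simp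
    have f2: "fin2 P2" unfolding P2_def by (rule fin2_map[OF fin2_trunc]) simp
    have "bsum 1 m (\<lambda>i. bsum (-1) j (P i)) =
        bsum 1 m (\<lambda>i. bsum (-1) j (P1 i)) - bsum 1 m (\<lambda>i. bsum (-1) j (P2 i))"
      unfolding P12
      by (simp only: bsum_diff[OF fin2_ev0[OF f1] fin2_ev0[OF f2]]
          bsum_diff[OF ev0_bsum[OF f1] ev0_bsum[OF f2]])
    also have "bsum 1 m (\<lambda>i. bsum (-1) j (P1 i)) =
        bsum (-1) j (\<lambda>k. ?a (j - int k) (commutator_side u v p' q' l (m + int k) n w))"
      unfolding P1_def mode_mode_iterate using Bv by (simp add: borcherds_def)
    also have "\<dots> = bsum (-1) j (\<lambda>h. bsum (-1) l (\<lambda>i. auv i h) -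
        scale (eps l) (bsum (-1) l (\<lambda>i. avu i h)))"
    proof -
      have "?a (j - int h) (commutator_side u v p' q' l (m + int h) n w) =
          bsum (-1) l (\<lambda>i. auv i h) - scale (eps l) (bsum (-1) l (\<lambda>i. avu i h))" for h
      proof -
        have e1: "ev0 (\<lambda>i. ?u (l + (m + int h) - int i) (?v (n + int i) w))"
          by (intro ev0_Y_right ev0_trunc)
        have e2: "ev0 (\<lambda>i. ?v (n + l - int i) (?u (m + int h + int i) w))"
          by (intro ev0_Y_right ev0_trunc)
        have r: "l + m - int i + int h = l + (m + int h) - int i"
          "m + int i + int h = m + int h + int i" for i by simp_all
        show ?thesis
          unfolding commutator_side_def pq Y_diff_right Y_scale_right Y_bsum_right[OF e1]
            Y_bsum_right[OF e2] auv_def avu_def r ..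
      qed
      then show ?thesis by simp
    qed
    also have "\<dots> = D auv - scale (eps l) (D avu)"
      by (rule D_col) simp_all
    also have "bsum 1 m (\<lambda>i. bsum (-1) j (P2 i)) = scale (eps j) (bsum (-1) j
        (\<lambda>k. commutator_side u v p' q' l (m + j - int k) n (?a (int k) w)))"
      unfolding P2_def mode_mode_iterate' using Bv by (simp add: borcherds_def)
    also have "bsum (-1) j
        (\<lambda>k. commutator_side u v p' q' l (m + j - int k) n (?a (int k) w)) =
        bsum (-1) j (\<lambda>h. bsum (-1) l (\<lambda>i. uva i h) -
          scale (eps l) (bsum (-1) l (\<lambda>i. vua i h)))"
    proof -
      have "commutator_side u v p' q' l (m + j - int h) n (?a (int h) w) =
          bsum (-1) l (\<lambda>i. uva i h) - scale (eps l) (bsum (-1) l (\<lambda>i. vua i h))" for h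
      proof -
        have r: "l + m - int i + j - int h = l + (m + j - int h) - int i"
          "m + int i + j - int h = m + j - int h + int i" for i by simp_all
        show ?thesis
          unfolding commutator_side_def pq uva_def vua_def r ..
      qed
      then show ?thesis by simp
    qed
    also have "\<dots> = D uva - scale (eps l) (D vua)"
      by (rule D_col) simp_all
    finally show ?thesis .
  qed

  \<comment> \<open>Here \<open>a\<close> acts on \<open>v\<close> before \<open>u\<close> does. The
    identity is used for \<open>u\<close> and the vectors \<open>Y a (int h) s v\<close>, and the
    commutator formula then resolves these vectors into \<open>a\<close> and
    \<open>v\<close>.\<close>
  have Q: "bsum 1 m (\<lambda>i. bsum (-1) j (Q i)) =
      (D uav - D uva) - scale (eps (l + j)) (D avu - D vau)"
  proof -
    define Q1 where "Q1 = (\<lambda>h. bsum (-1) (l + j - int h) (\<lambda>i. ?u (l + j - int h + m - int i)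
        (Y (?a (int h) v) (n + int i) (q - p + s) w)))"
    define Q2 where "Q2 = (\<lambda>h. scale (eps (l + j - int h)) (bsum (-1) (l + j - int h)
        (\<lambda>i. Y (?a (int h) v) (n + (l + j - int h) - int i) (q - p + s) (?u (m + int i) w))))"
    have Q12: "bsum 1 m (\<lambda>i. Q i h) = Q1 h - Q2 h" for h
    proof -
      have "bsum 1 m (\<lambda>i. Q i h) = iterate_side u (?a (int h) v) p' q (l + j - int h) m n w"
        by (simp add: Q_def iterate_side_def algebra_simps)
      also have "\<dots> = commutator_side u (?a (int h) v) p' q (l + j - int h) m n w"
        using Bav by (simp add: borcherds_def)
      also have "\<dots> = Q1 h - Q2 h"
        unfolding commutator_side_def Q1_def Q2_def pq ..
      finally show ?thesis .
    qed
    obtain K where K: "\<And>h. K \<le> h \<Longrightarrow> ?a (int h) v = 0" using eva[of v] unfolding ev0_def by blast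
    have e1: "ev0 Q1" unfolding ev0_def by (rule exI[of _ K]) (simp add: Q1_def K)
    have e2: "ev0 Q2" unfolding ev0_def by (rule exI[of _ K]) (simp add: Q2_def K)
    have "bsum 1 m (\<lambda>i. bsum (-1) j (Q i)) = bsum (-1) j Q1 - bsum (-1) j Q2"
      by (simp only: bsum_swap[OF finQ] Q12 bsum_diff[OF e1 e2])
    also have "bsum (-1) j Q1 = D (\<lambda>i h. uav i h - uva i h)"
      unfolding Q1_def D_def uav_def uva_def Y_diff_right[symmetric]
      by (rule mode_commutator_inside[OF C, symmetric])
    also have "bsum (-1) j Q2 = scale (eps (l + j)) (D (\<lambda>i h. avu i h - vau i h))"
      unfolding Q2_def D_def avu_def vau_def
      by (rule mode_commutator_outside[OF C, symmetric])
    finally show ?thesis by (simp add: D_diff)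
  qed

  \<comment> \<open>With this sign the contributions \<open>uva\<close> and \<open>avu\<close> of
    the two parts cancel.\<close>
  have e: "eps j * eps (l + j) = (eps l :: 'a)"
    by (simp add: eps_add mult.left_commute[of "eps j"])
  show "iterate_side (Y a j s u) v p q l m n w = commutator_side (Y a j s u) v p q l m n w"
    unfolding lhs rhs P Q
    by (simp add: scale_right_diff_distrib e mult.commute)
qed

text \<open>
  The commutator formula passes from \<open>v\<close> to \<open>y\<^sub>j v\<close>: \<open>[x\<^sub>m, y\<^sub>k]\<close> is a combination of modes of the
  vectors \<open>x\<^sub>i y\<close>, to which the Borcherds identity with \<open>v\<close> applies.
\<close>

lemma commutator_formula_mode:
  assumes Iy: "\<And>v. iterate_formula y v" and Cxy: "commutator_formula x y"
    and Cxv: "commutator_formula x v" and B: "\<And>i p. borcherds (Y x (int i) p y) v"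
  shows "commutator_formula x (Y y j s v)"
  unfolding commutator_formula_def
proof (intro allI)
  fix p q m n w
  let ?x = "\<lambda>k. Y x k p" and ?y = "\<lambda>k. Y y k s" and ?v = "\<lambda>k. Y v k (q - p - s)"
  have evx: "ev0 (\<lambda>i. ?x (int i) z)" for z using ev0_trunc[of x 0] by simp
  have evy: "ev0 (\<lambda>i. ?y (int i) z)" for z using ev0_trunc[of y 0] by simp
  define yv where "yv = (\<lambda>w h. ?y (j - int h) (?v (n + int h) w))"
  define vy where "vy = (\<lambda>w h. ?v (n + j - int h) (?y (int h) w))"
  have ev: "ev0 (yv w)" "ev0 (vy w)" for w
    unfolding yv_def vy_def by (intro ev0_Y_right ev0_trunc evy)+
  have mode: "Y (Y y j s v) n (q - p) w =
      bsum (-1) j (yv w) - scale (eps j) (bsum (-1) j (vy w))" for w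
    unfolding yv_def vy_def by (rule iterate_formulaD[OF Iy])
  \<comment> \<open>\<open>A\<close> and \<open>A'\<close> come from commuting \<open>x\<close> past
    \<open>y\<close>, \<open>C\<close> and \<open>C'\<close> from commuting it past
    \<open>v\<close>; the prime marks the second expansion in the iterate formula.\<close>
  define A where "A = (\<lambda>h i. Y (?x (int i) y) (m + (j - int h) - int i) (s + p) (?v (n + int h) w))"
  define A' where "A' = (\<lambda>h i. ?v (n + j - int h) (Y (?x (int i) y) (m + int h - int i) (s + p) w))"
  define C where "C = (\<lambda>h i. ?y (j - int h) (Y (?x (int i) v) (m + (n + int h) - int i) (q - s) w))"
  define C' where "C' = (\<lambda>h i. Y (?x (int i) v) (m + (n + j - int h) - int i) (q - s) (?y (int h) w))"
  have finA: "fin2 A"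
    unfolding A_def
  proof (rule fin2I_ev0[of "\<lambda>h. ?v (n + int h) w"])
    show "ev0 (\<lambda>i. Y (?x (int i) y) (m + (j - int h) - int i) (s + p) (?v (n + int h) w))" for h
      by (rule ev0_Y_left[OF evx])
  qed (auto intro: ev0_trunc)
  have finA': "fin2 A'"
  proof (rule iffD1[OF fin2_flip], rule fin2I_ev0[OF evx[of y]])
    have "A' h i = ?v (n + j - int h) (Y (?x (int i) y) (m - int i + int h) (s + p) w)" for h i
      by (simp add: A'_def algebra_simps)
    then show "ev0 (\<lambda>h. A' h i)" for i by (simp only:) (intro ev0_Y_right ev0_trunc)
  qed (simp add: A'_def)
  have finC: "fin2 C"
  proof (rule iffD1[OF fin2_flip], rule fin2I_ev0[OF evx[of v]])
    have "C h i = ?y (j - int h) (Y (?x (int i) v) (m + n - int i + int h) (q - s) w)" for h i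
      by (simp add: C_def algebra_simps)
    then show "ev0 (\<lambda>h. C h i)" for i by (simp only:) (intro ev0_Y_right ev0_trunc)
  qed (simp add: C_def)
  have finC': "fin2 C'"
    unfolding C'_def
  proof (rule fin2I_ev0[OF evy[of w]])
    show "ev0 (\<lambda>i. Y (?x (int i) v) (m + (n + j - int h) - int i) (q - s) (?y (int h) w))" for h
      by (rule ev0_Y_left[OF evx])
  qed auto
  have comm_y: "?x m (?y k z) - ?y k (?x m z) =
      bsum 1 m (\<lambda>i. Y (?x (int i) y) (m + k - int i) (s + p) z)" for k z
    by (rule commutator_formulaD[OF Cxy])
  have comm_v: "?x m (?v k z) - ?v k (?x m z) =
      bsum 1 m (\<lambda>i. Y (?x (int i) v) (m + k - int i) (q - s) z)" for k z
    using commutator_formulaD[OF Cxv, of m p k "q - p - s" z] by (simp add: algebra_simps)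
  have yv: "?x m (yv w h) - yv (?x m w) h = bsum 1 m (A h) + bsum 1 m (C h)" for h
  proof -
    have "?x m (yv w h) - yv (?x m w) h =
        (?x m (?y (j - int h) (?v (n + int h) w)) - ?y (j - int h) (?x m (?v (n + int h) w))) +
        ?y (j - int h) (?x m (?v (n + int h) w) - ?v (n + int h) (?x m w))"
      by (simp add: yv_def Y_diff_right)
    also have "\<dots> = bsum 1 m (A h) + bsum 1 m (C h)"
      unfolding comm_y comm_v A_def C_def
      by (simp add: Y_bsum_right ev0_Y_left evx)
    finally show ?thesis .
  qed
  have vy: "?x m (vy w h) - vy (?x m w) h = bsum 1 m (A' h) + bsum 1 m (C' h)" for h
  proof -
    have "?x m (vy w h) - vy (?x m w) h =
        (?x m (?v (n + j - int h) (?y (int h) w)) - ?v (n + j - int h) (?x m (?y (int h) w))) +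
        ?v (n + j - int h) (?x m (?y (int h) w) - ?y (int h) (?x m w))"
      by (simp add: vy_def Y_diff_right)
    also have "\<dots> = bsum 1 m (A' h) + bsum 1 m (C' h)"
      unfolding comm_y comm_v A'_def C'_def
      by (simp add: Y_bsum_right ev0_Y_left evx)
    finally show ?thesis .
  qed
  define T where "T = (\<lambda>(F :: nat \<Rightarrow> nat \<Rightarrow> 'v) i. bsum (-1) j (\<lambda>h. F h i))"
  have evT: "ev0 (T F)" if "fin2 F" for F
    unfolding T_def by (rule ev0_bsum[OF iffD2[OF fin2_flip that]])
  have sumT: "bsum (-1) j (\<lambda>h. bsum 1 m (F h) + bsum 1 m (G h)) =
      bsum 1 m (T F) + bsum 1 m (T G)" if F: "fin2 F" and G: "fin2 G" for F G
    unfolding T_def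
    by (simp only: bsum_add[OF ev0_bsum[OF F] ev0_bsum[OF G]] bsum_swap[OF F] bsum_swap[OF G])
  have "?x m (Y (Y y j s v) n (q - p) w) - Y (Y y j s v) n (q - p) (?x m w) =
      bsum (-1) j (\<lambda>h. ?x m (yv w h) - yv (?x m w) h) -
      scale (eps j) (bsum (-1) j (\<lambda>h. ?x m (vy w h) - vy (?x m w) h))"
    unfolding mode
    by (simp add: Y_diff_right Y_scale_right Y_bsum_right[OF ev(1)] Y_bsum_right[OF ev(2)]
        bsum_diff[OF ev0_Y_right[OF ev(1)] ev(1)] bsum_diff[OF ev0_Y_right[OF ev(2)] ev(2)]
        scale_right_diff_distrib)
  also have "\<dots> = (bsum 1 m (T A) - scale (eps j) (bsum 1 m (T A'))) +
      (bsum 1 m (T C) - scale (eps j) (bsum 1 m (T C')))"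
    unfolding yv vy sumT[OF finA finC] sumT[OF finA' finC']
    by (simp add: scale_right_distrib)
  also have "\<dots> = bsum 1 m (\<lambda>i. T A i - scale (eps j) (T A' i)) +
      bsum 1 m (\<lambda>i. T C i - scale (eps j) (T C' i))"
    by (simp only: bsum_diff[OF evT[OF finA] ev0_scale[OF evT[OF finA']]]
        bsum_diff[OF evT[OF finC] ev0_scale[OF evT[OF finC']]]
        bsum_scale[OF evT[OF finA']] bsum_scale[OF evT[OF finC']])
  also have "(\<lambda>i. T C i - scale (eps j) (T C' i)) =
      (\<lambda>i. Y (Y y j s (?x (int i) v)) (m + n - int i) q w)"
  proof
    fix i
    show "T C i - scale (eps j) (T C' i) = Y (Y y j s (?x (int i) v)) (m + n - int i) q w"
      unfolding iterate_formulaD[OF Iy] T_def C_def C'_def by (simp add: algebra_simps)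
  qed
  also have "(\<lambda>i. T A i - scale (eps j) (T A' i)) = (\<lambda>i. bsum 1 (m - int i)
      (\<lambda>e. Y (Y (?x (int i) y) (j + int e) (s + p) v) (m - int i + n - int e) q w))"
  proof
    fix i
    \<comment> \<open>For fixed i this is the commutator side for the vectors
      \<open>?x (int i) y\<close> and \<open>v\<close> at exponent m - i; assumption
      \<open>B\<close> turns it into iterates.\<close>
    have "T A i - scale (eps j) (T A' i) =
        commutator_side (?x (int i) y) v (s + p) q j (m - int i) n w"
      unfolding T_def A_def A'_def commutator_side_def by (simp add: algebra_simps)
    also have "\<dots> = iterate_side (?x (int i) y) v (s + p) q j (m - int i) n w"
      using B by (simp add: borcherds_def)
    finally show "T A i - scale (eps j) (T A' i) = bsum 1 (m - int i)
      (\<lambda>e. Y (Y (?x (int i) y) (j + int e) (s + p) v) (m - int i + n - int e) q w)"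
      by (simp add: iterate_side_def)
  qed
  also have "bsum 1 m (\<lambda>i. bsum 1 (m - int i)
      (\<lambda>e. Y (Y (?x (int i) y) (j + int e) (s + p) v) (m - int i + n - int e) q w)) =
      bsum 1 m (\<lambda>k. bsum 1 (int k)
        (\<lambda>i. Y (Y (?x (int i) y) (int k + j - int i) (s + p) v) (m + n - int k) q w))"
  proof -
    let ?G = "\<lambda>i k. Y (Y (?x (int i) y) (int k + j - int i) (s + p) v) (m + n - int k) q w"
    have G: "?G i (i + e) =
        Y (Y (?x (int i) y) (j + int e) (s + p) v) (m - int i + n - int e) q w" for i e
      by (simp add: algebra_simps)
    have "fin2 (\<lambda>i e. ?G i (i + e))"
      unfolding G
    proof (rule fin2I_ev0[OF evx[of y]])
      show "ev0 (\<lambda>e. Y (Y (?x (int i) y) (j + int e) (s + p) v) (m - int i + n - int e) q w)" for i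
        by (intro ev0_Y_left ev0_trunc)
    qed auto
    moreover have "ev0 (\<lambda>i. ?G i k)" for k
      by (intro ev0_Y_left evx)
    ultimately show ?thesis
      using bsum_trinomial'[of ?G 1 m] unfolding G by blast
  qed
  also have "\<dots> + bsum 1 m (\<lambda>i. Y (Y y j s (?x (int i) v)) (m + n - int i) q w) =
      iterate_side x (Y y j s v) p q 0 m n w"
  proof -
    let ?Z = "\<lambda>k. bsum 1 (int k) (\<lambda>i. Y (?x (int i) y) (int k + j - int i) (s + p) v)"
    \<comment> \<open>The commutator formula of \<open>x\<close> and \<open>y\<close>, applied to
      \<open>v\<close> as a vector, splits x_k (y_j v) into the two sums reached above.\<close>
    have comm: "?x (int k) (Y y j s v) = ?Z k + Y y j s (?x (int k) v)" for k
      using commutator_formulaD[OF Cxy, of "int k" p j s v] by (simp add: algebra_simps)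
    have e1: "ev0 ?Z"
    proof -
      have "ev0 (\<lambda>k. ?x (int k) (Y y j s v) - Y y j s (?x (int k) v))"
        by (intro ev0_diff ev0_Y_right evx)
      then show ?thesis by (simp add: comm)
    qed
    have "iterate_side x (Y y j s v) p q 0 m n w =
        bsum 1 m (\<lambda>k. Y (?Z k) (m + n - int k) q w +
          Y (Y y j s (?x (int k) v)) (m + n - int k) q w)"
      unfolding iterate_side_def by (simp add: comm Y_add_left)
    also have "\<dots> = bsum 1 m (\<lambda>k. Y (?Z k) (m + n - int k) q w) +
        bsum 1 m (\<lambda>k. Y (Y y j s (?x (int k) v)) (m + n - int k) q w)"
      by (rule bsum_add[OF ev0_Y_left[OF e1] ev0_Y_left[OF ev0_Y_right[OF evx]]])
    also have "(\<lambda>k. Y (?Z k) (m + n - int k) q w) = (\<lambda>k. bsum 1 (int k)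
        (\<lambda>i. Y (Y (?x (int i) y) (int k + j - int i) (s + p) v) (m + n - int k) q w))"
      by (rule ext) (rule Y_bsum_left[OF ev0_Y_left[OF evx]])
    finally show ?thesis by simp
  qed
  finally show "?x m (Y (Y y j s v) n (q - p) w) - Y (Y y j s v) n (q - p) (?x m w) =
      iterate_side x (Y y j s v) p q 0 m n w" .
qed

lemma commutator_formula_add:
  assumes "commutator_formula x u" "commutator_formula x v"
  shows "commutator_formula x (u + v)"
proof -
  have evx: "ev0 (\<lambda>i. Y x (int i) p z)" for p z using ev0_trunc[of x 0] by simp
  show ?thesis
    using assms unfolding commutator_formula_def iterate_side_def
    by (simp add: Y_add_left Y_add_right bsum_add ev0_Y_left evx algebra_simps)
qed

lemma commutator_formula_scale:
  assumes "commutator_formula x v"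
  shows "commutator_formula x (scale c v)"
proof -
  have evx: "ev0 (\<lambda>i. Y x (int i) p z)" for p z using ev0_trunc[of x 0] by simp
  show ?thesis
    using assms unfolding commutator_formula_def iterate_side_def
    by (simp add: Y_scale_left Y_scale_right bsum_scale ev0_Y_left evx scale_right_diff_distrib[symmetric])
qed

lemma borcherds_add_left:
  assumes "borcherds u v" "borcherds u' v"
  shows "borcherds (u + u') v"
  using assms unfolding borcherds_def iterate_side_def commutator_side_def
  by (simp add: Y_add_left Y_add_right bsum_add ev0_Y_left ev0_Y_right ev0_trunc
      scale_right_distrib algebra_simps)

lemma borcherds_scale_left:
  assumes "borcherds u v"
  shows "borcherds (scale c u) v"
proof -
  have "iterate_side (scale c u) v p q l m n w = scale c (iterate_side u v p q l m n w)"
    for p q l m n w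
    unfolding iterate_side_def
    by (simp add: Y_scale_left bsum_scale ev0_Y_left ev0_trunc)
  moreover have "commutator_side (scale c u) v p q l m n w = scale c (commutator_side u v p q l m n w)"
    for p q l m n w
    unfolding commutator_side_def
    by (simp add: Y_scale_left Y_scale_right bsum_scale ev0_Y_right ev0_trunc
        scale_right_diff_distrib mult.commute)
  ultimately show ?thesis using assms by (simp add: borcherds_def)
qed

section \<open>Propagation from generators to generated vectors\<close>

inductive_set generated :: "'v set \<Rightarrow> 'v set" for T where
  base: "x \<in> T \<Longrightarrow> x \<in> generated T"
| add: "u \<in> generated T \<Longrightarrow> v \<in> generated T \<Longrightarrow> u + v \<in> generated T"
| scale: "v \<in> generated T \<Longrightarrow> scale c v \<in> generated T"
| mode: "x \<in> T \<Longrightarrow> v \<in> generated T \<Longrightarrow> Y x j s v \<in> generated T"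

text \<open>The commutator formula of members of T with v is proved by induction on v; there the
  closure of T under nonnegative modes turns the induction hypothesis into the Borcherds identity
  for x_i y and v. The induction on u has to quantify over all v, because
  \<open>borcherds_mode\<close> for v refers to the vectors x_h v.\<close>

theorem borcherds_generated:
  assumes I: "\<And>x v. x \<in> T \<Longrightarrow> iterate_formula x v"
    and C: "\<And>x y. x \<in> T \<Longrightarrow> y \<in> T \<Longrightarrow> commutator_formula x y"
    and T: "\<And>x y i p. x \<in> T \<Longrightarrow> y \<in> T \<Longrightarrow> Y x (int i) p y \<in> T"
    and "u \<in> generated T" "v \<in> generated T"
  shows "borcherds u v"
proof -
  have CT: "\<forall>x\<in>T. commutator_formula x v" if "v \<in> generated T" for v
    using that
  proof induction
    case (mode y v j s)
    have "borcherds z v" if "z \<in> T" for z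
      using I mode.IH that by (simp add: borcherds_iff)
    then have B: "borcherds (Y x (int i) p y) v" if "x \<in> T" for x i p
      using T[OF that mode.hyps(1)] by blast
    show ?case
      using commutator_formula_mode[OF I C _ B] mode by blast
  next
    case (add u v)
    then show ?case using commutator_formula_add by blast
  next
    case (scale v c)
    then show ?case using commutator_formula_scale by blast
  qed (use C in blast)
  have BT: "borcherds x v" if "x \<in> T" "v \<in> generated T" for x v
    using that I CT by (simp add: borcherds_iff)
  from \<open>u \<in> generated T\<close> have "\<forall>v\<in>generated T. borcherds u v"
  proof induction
    case (mode x u j s)
    show ?case
    proof
      fix v assume v: "v \<in> generated T"
      show "borcherds (Y x j s u) v"
        using borcherds_mode[OF I, of x v u] mode CT[OF v] v generated.mode[OF mode.hyps(1) v]
        by blast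
    qed
  next
    case (add u u')
    then show ?case using borcherds_add_left by blast
  next
    case (scale u c)
    then show ?case using borcherds_scale_left by blast
  qed (use BT in blast)
  then show ?thesis using \<open>v \<in> generated T\<close> by blast
qed

text \<open>In the iterate formula for x_j v on the vacuum, each term has a nonnegative mode of v or
  of x acting on the vacuum.\<close>

lemma creation_generated:
  assumes I: "\<And>x v. x \<in> T \<Longrightarrow> iterate_formula x v"
    and T: "\<And>x i p. x \<in> T \<Longrightarrow> Y x (int i) p vac = 0"
    and "v \<in> generated T" "0 \<le> n"
  shows "Y v n q vac = 0"
proof -
  from \<open>v \<in> generated T\<close> have "\<forall>i q. Y v (int i) q vac = 0"
  proof induction
    case (mode x v j s)
    show ?case
    proof (intro allI)
      fix i q
      have "Y v (int i + int h) (q - s) vac = 0" for h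
        using mode.IH[rule_format, of "i + h"] by simp
      then show "Y (Y x j s v) (int i) q vac = 0"
        using mode.hyps T by (simp add: iterate_formulaD[OF I])
    qed
  qed (auto simp: T Y_add_left Y_scale_left)
  from this[rule_format, of "nat n" q] show ?thesis using \<open>0 \<le> n\<close> by simp
qed

end

section \<open>Free vector spaces and cosets\<close>

lemma poly_mapping_sum_single:
  fixes F :: "'k \<Rightarrow>\<^sub>0 'b :: comm_monoid_add"
  shows "F = (\<Sum>k\<in>Poly_Mapping.keys F. Poly_Mapping.single k (Poly_Mapping.lookup F k))"
  by (rule poly_mapping_eqI)
    (simp add: lookup_sum lookup_single when_def sum.delta in_keys_iff)

lemma poly_mapping_induct_single:
  fixes F :: "'k \<Rightarrow>\<^sub>0 'b :: comm_monoid_add"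
  assumes "Poly_Mapping.keys F \<subseteq> S" and "P 0" and "\<And>f g. P f \<Longrightarrow> P g \<Longrightarrow> P (f + g)"
    and "\<And>k c. k \<in> S \<Longrightarrow> P (Poly_Mapping.single k c)"
  shows "P F"
proof -
  have "P (\<Sum>k\<in>K. Poly_Mapping.single k (Poly_Mapping.lookup F k))" if "finite K" "K \<subseteq> S" for K
    using that by (induction K rule: finite_induct) (use assms(2-4) in auto)
  then show ?thesis using assms(1) by (subst poly_mapping_sum_single) auto
qed

lemma lookup_free_scale [simp]:
  "Poly_Mapping.lookup (free_scale c F) k = c * Poly_Mapping.lookup F k"
  by (simp add: free_scale_def Poly_Mapping.map.rep_eq when_def)

lemma free_scale_single [simp]: "free_scale c (Poly_Mapping.single k d) = Poly_Mapping.single k (c * d)"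
  by (rule poly_mapping_eqI) (simp add: lookup_single when_def)

lemma vector_space_free_scale: "vector_space free_scale"
  by unfold_locales (auto intro!: poly_mapping_eqI simp: lookup_add algebra_simps)

interpretation free: vector_space "free_scale :: complex \<Rightarrow> ('s \<Rightarrow>\<^sub>0 complex) \<Rightarrow> _"
  by (rule vector_space_free_scale)

lemma keys_free_scale: "Poly_Mapping.keys (free_scale c F) \<subseteq> Poly_Mapping.keys F"
  by (auto simp: in_keys_iff)

lemma free_scalar_mult: "free_scalar c * f = free_scale c f"
  by (simp add: free_scalar_def free_scale_def mult_map_scale_conv_mult)

lemma subspace_keys: "free.subspace {F. Poly_Mapping.keys F \<subseteq> S}"
  unfolding free.subspace_def
proof (intro conjI ballI allI)
  fix f g :: "'a \<Rightarrow>\<^sub>0 complex" and c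
  assume f: "f \<in> {F. Poly_Mapping.keys F \<subseteq> S}"
  show "free_scale c f \<in> {F. Poly_Mapping.keys F \<subseteq> S}"
    using f keys_free_scale[of c f] by auto
  assume g: "g \<in> {F. Poly_Mapping.keys F \<subseteq> S}"
  show "f + g \<in> {F. Poly_Mapping.keys F \<subseteq> S}"
    using f g Poly_Mapping.keys_add[of f g] by auto
qed auto

definition lext :: "(complex \<Rightarrow> 'm \<Rightarrow> 'm) \<Rightarrow> ('k \<Rightarrow> 'm) \<Rightarrow> ('k \<Rightarrow>\<^sub>0 complex) \<Rightarrow> 'm :: ab_group_add" where
  "lext sm g F = (\<Sum>k\<in>Poly_Mapping.keys F. sm (Poly_Mapping.lookup F k) (g k))"

locale complex_vector_space = vector_space sm
  for sm :: "complex \<Rightarrow> 'm :: ab_group_add \<Rightarrow> 'm"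
begin

lemma lext_zero [simp]: "lext sm g 0 = 0"
  by (simp add: lext_def)

lemma lext_single [simp]: "lext sm g (Poly_Mapping.single k c) = sm c (g k)"
  by (simp add: lext_def)

lemma lext_add: "lext sm g (F + G) = lext sm g F + lext sm g G"
  unfolding lext_def
  by (rule setsum_keys_plus_distrib) (auto simp: scale_left_distrib)

lemma lext_scale: "lext sm g (free_scale c F) = sm c (lext sm g F)"
proof -
  have "lext sm g (free_scale c F) = (\<Sum>k\<in>Poly_Mapping.keys F. sm (c * Poly_Mapping.lookup F k) (g k))"
    unfolding lext_def
    by (rule sum.mono_neutral_cong_left) (auto simp: in_keys_iff)
  then show ?thesis by (simp add: lext_def scale_sum_right)
qed

lemma lext_diff: "lext sm g (F - G) = lext sm g F - lext sm g G"
  using lext_add[of g "F - G" G] by (simp add: algebra_simps)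

lemma lext_mem:
  "subspace E \<Longrightarrow> (\<And>k. k \<in> Poly_Mapping.keys F \<Longrightarrow> g k \<in> E) \<Longrightarrow> lext sm g F \<in> E"
  unfolding lext_def by (intro subspace_sum subspace_scale) auto

end

definition add_subgroup :: "'f :: ab_group_add set \<Rightarrow> bool" where
  "add_subgroup N \<longleftrightarrow> 0 \<in> N \<and> (\<forall>x\<in>N. \<forall>y\<in>N. x - y \<in> N)"

definition coset :: "'f :: ab_group_add set \<Rightarrow> 'f \<Rightarrow> 'f set" where
  "coset N f = {g. g - f \<in> N}"

text \<open>The records used here carry the addition of their type, so one notion of coset serves
  the enveloping algebra and the induced module.\<close>

lemma a_r_coset_eq_coset: "add M = (+) \<Longrightarrow> N +>\<^bsub>M\<^esub> f = coset N f"
proof -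
  assume M: "add M = (+)"
  have "x \<in> N +>\<^bsub>M\<^esub> f \<longleftrightarrow> x - f \<in> N" for x
  proof
    assume "x \<in> N +>\<^bsub>M\<^esub> f"
    then show "x - f \<in> N" by (auto simp: a_r_coset_def' M)
  next
    assume "x - f \<in> N"
    then show "x \<in> N +>\<^bsub>M\<^esub> f" by (auto simp: a_r_coset_def' M intro!: bexI[of _ "x - f"])
  qed
  then show ?thesis by (auto simp: coset_def)
qed

lemma add_subgroup_add: "add_subgroup N \<Longrightarrow> x \<in> N \<Longrightarrow> y \<in> N \<Longrightarrow> x + y \<in> N"
  unfolding add_subgroup_def
proof (elim conjE)
  assume "x \<in> N" "y \<in> N" "0 \<in> N" and *: "\<forall>x\<in>N. \<forall>y\<in>N. x - y \<in> N"
  then have "x - (0 - y) \<in> N" by blast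
  then show "x + y \<in> N" by simp
qed

lemma coset_self: "add_subgroup N \<Longrightarrow> f \<in> coset N f"
  by (simp add: coset_def add_subgroup_def)

lemma coset_eq_iff:
  assumes "add_subgroup N"
  shows "coset N f = coset N g \<longleftrightarrow> f - g \<in> N"
proof
  assume "coset N f = coset N g"
  then show "f - g \<in> N" using coset_self[OF assms, of f] by (simp add: coset_def)
next
  assume *: "f - g \<in> N"
  have "x - f \<in> N \<longleftrightarrow> x - g \<in> N" for x
  proof
    assume "x - f \<in> N"
    from add_subgroup_add[OF assms this *] show "x - g \<in> N" by simp
  next
    assume "x - g \<in> N"
    then have "(x - g) - (f - g) \<in> N" using assms * unfolding add_subgroup_def by blast
    then show "x - f \<in> N" by simp
  qed
  then show "coset N f = coset N g" by (simp add: coset_def)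
qed

lemma coset_zero: "coset N 0 = N"
  by (simp add: coset_def)

lemma coset_set_add:
  assumes "add_subgroup N" "add M = (+)"
  shows "set_add M (coset N f) (coset N g) = coset N (f + g)"
proof -
  have "x \<in> set_add M (coset N f) (coset N g) \<longleftrightarrow> x \<in> coset N (f + g)" for x
  proof
    assume "x \<in> set_add M (coset N f) (coset N g)"
    then obtain a b where "a - f \<in> N" "b - g \<in> N" "x = a + b"
      using assms(2) by (auto simp: set_add_def' coset_def)
    then show "x \<in> coset N (f + g)"
      using add_subgroup_add[OF assms(1), of "a - f" "b - g"] by (simp add: coset_def algebra_simps)
  next
    assume "x \<in> coset N (f + g)"
    then have "x - g \<in> coset N f" by (simp add: coset_def algebra_simps)
    moreover have "g \<in> coset N g" by (rule coset_self[OF assms(1)])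
    ultimately show "x \<in> set_add M (coset N f) (coset N g)"
      unfolding set_add_def' assms(2) by (intro UN_I[of "x - g"] UN_I[of g]) simp_all
  qed
  then show ?thesis by blast
qed

lemma free_subspace_add_subgroup: "free.subspace N \<Longrightarrow> add_subgroup N"
  by (simp add: add_subgroup_def free.subspace_0 free.subspace_diff)

section \<open>Universal enveloping algebras\<close>

lemma free_algebra_simps [simp]:
  "monoid.mult (free_algebra A) = (*)" "one (free_algebra A) = 1" "zero (free_algebra A) = 0"
  "add (free_algebra A) = (+)"
  by (simp_all add: free_algebra_def)

lemma mem_free_algebra:
  "f \<in> carrier (free_algebra A) \<longleftrightarrow> Poly_Mapping.keys f \<subseteq> {w. set (letters w) \<subseteq> A}"
  by (auto simp: free_algebra_def)

lemma letters_zero [simp]: "letters 0 = []"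
  by (simp add: zero_word_def)

lemma letters_plus [simp]: "letters (u + v) = letters u @ letters v"
  by (simp add: plus_word_def)

lemma free_algebra_closed:
  shows "f \<in> carrier (free_algebra A) \<Longrightarrow> g \<in> carrier (free_algebra A) \<Longrightarrow> f + g \<in> carrier (free_algebra A)"
    and "f \<in> carrier (free_algebra A) \<Longrightarrow> g \<in> carrier (free_algebra A) \<Longrightarrow> f - g \<in> carrier (free_algebra A)"
    and "f \<in> carrier (free_algebra A) \<Longrightarrow> g \<in> carrier (free_algebra A) \<Longrightarrow> f * g \<in> carrier (free_algebra A)"
    and "f \<in> carrier (free_algebra A) \<Longrightarrow> - f \<in> carrier (free_algebra A)"
    and "1 \<in> carrier (free_algebra A)" and "0 \<in> carrier (free_algebra A)"
    and "f \<in> carrier (free_algebra A) \<Longrightarrow> free_scale c f \<in> carrier (free_algebra A)"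
    and "x \<in> A \<Longrightarrow> letter x \<in> carrier (free_algebra A)"
proof -
  show "f + g \<in> carrier (free_algebra A)"
    if "f \<in> carrier (free_algebra A)" "g \<in> carrier (free_algebra A)"
    using that keys_add[of f g] by (auto simp: mem_free_algebra)
  show "f - g \<in> carrier (free_algebra A)"
    if "f \<in> carrier (free_algebra A)" "g \<in> carrier (free_algebra A)"
    using that keys_diff[of f g] by (auto simp: mem_free_algebra)
  show "f * g \<in> carrier (free_algebra A)"
    if "f \<in> carrier (free_algebra A)" "g \<in> carrier (free_algebra A)"
  proof -
    have "set (letters w) \<subseteq> A" if w: "w \<in> Poly_Mapping.keys (f * g)" for w
    proof -
      obtain u v where "w = u + v" "u \<in> Poly_Mapping.keys f" "v \<in> Poly_Mapping.keys g"
        using keys_mult[of f g] w by blast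
      then show ?thesis
        using \<open>f \<in> _\<close> \<open>g \<in> _\<close> by (auto simp: mem_free_algebra)
    qed
    then show ?thesis by (auto simp: mem_free_algebra)
  qed
  show "free_scale c f \<in> carrier (free_algebra A)" if "f \<in> carrier (free_algebra A)"
    using that keys_free_scale[of c f] by (auto simp: mem_free_algebra)
  show "letter x \<in> carrier (free_algebra A)" if "x \<in> A"
    using that by (simp add: mem_free_algebra letter_def)
  show "- f \<in> carrier (free_algebra A)" if "f \<in> carrier (free_algebra A)"
    using that by (simp add: mem_free_algebra)
qed (simp_all add: mem_free_algebra)

lemma ring_free_algebra: "ring (free_algebra A)"
proof (rule ringI)
  show "abelian_group (free_algebra A)"
  proof (rule abelian_groupI)
    fix f assume "f \<in> carrier (free_algebra A)"
    then show "\<exists>g\<in>carrier (free_algebra A). g \<oplus>\<^bsub>free_algebra A\<^esub> f = \<zero>\<^bsub>free_algebra A\<^esub>"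
      by (intro bexI[of _ "- f"]) (simp_all add: free_algebra_closed)
  qed (simp_all add: free_algebra_closed ac_simps)
  show "Group.monoid (free_algebra A)"
    by (rule monoidI) (simp_all add: free_algebra_closed ac_simps)
qed (simp_all add: free_algebra_closed algebra_simps)

locale enveloping = vector_space sc
  for sc :: "complex \<Rightarrow> 'a :: ab_group_add \<Rightarrow> 'a" +
  fixes br :: "'a \<Rightarrow> 'a \<Rightarrow> 'a" and A :: "'a set"
  assumes A_add: "x \<in> A \<Longrightarrow> y \<in> A \<Longrightarrow> x + y \<in> A"
    and A_scale: "x \<in> A \<Longrightarrow> sc c x \<in> A"
    and A_bracket: "x \<in> A \<Longrightarrow> y \<in> A \<Longrightarrow> br x y \<in> A"
begin

abbreviation "FA \<equiv> carrier (free_algebra A)"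
abbreviation "I \<equiv> uea_ideal sc br A"
abbreviation "U \<equiv> uea sc br A"
abbreviation "cls \<equiv> uea_class sc br A"

definition relators where
  "relators = {letter (x + y) - letter x - letter y |x y. x \<in> A \<and> y \<in> A} \<union>
      {letter (sc c x) - free_scalar c * letter x |c x. x \<in> A} \<union>
      {letter x * letter y - letter y * letter x - letter (br x y) |x y. x \<in> A \<and> y \<in> A}"

lemma relators_subset: "relators \<subseteq> FA"
  unfolding relators_def
  by (auto simp: free_scalar_mult intro!: free_algebra_closed A_add A_scale A_bracket)

lemma I_eq: "I = genideal (free_algebra A) relators"
  by (simp add: uea_ideal_def relators_def)

lemma ideal_I: "ideal I (free_algebra A)"
  unfolding I_eq by (rule ring.genideal_ideal[OF ring_free_algebra relators_subset])

lemma relators_I: "relators \<subseteq> I"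
  unfolding I_eq by (rule ring.genideal_self[OF ring_free_algebra relators_subset])

lemma I_subset: "I \<subseteq> FA"
  using additive_subgroup.a_subset[OF ideal.axioms(1)[OF ideal_I]] .

lemma add_subgroup_I: "add_subgroup I"
proof -
  interpret ideal I "free_algebra A" by (rule ideal_I)
  have "0 \<in> I" using additive_subgroup.zero_closed[OF is_additive_subgroup] by simp
  moreover have "x - y \<in> I" if "x \<in> I" "y \<in> I" for x y
  proof -
    have "y \<in> FA" using that I_subset by blast
    then have "\<ominus>\<^bsub>free_algebra A\<^esub> y = - y"
      by (intro minus_equality) (auto simp: free_algebra_closed)
    moreover have "\<ominus>\<^bsub>free_algebra A\<^esub> y \<in> I"
      using that(2) by (rule additive_subgroup.a_inv_closed[OF is_additive_subgroup])
    ultimately show ?thesis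
      using additive_subgroup.a_closed[OF is_additive_subgroup that(1), of "- y"] by simp
  qed
  ultimately show ?thesis by (simp add: add_subgroup_def)
qed

lemma I_minimal:
  assumes "add_subgroup J" "J \<subseteq> FA" "relators \<subseteq> J"
    and "\<And>f g. f \<in> FA \<Longrightarrow> g \<in> J \<Longrightarrow> f * g \<in> J" and "\<And>f g. f \<in> FA \<Longrightarrow> g \<in> J \<Longrightarrow> g * f \<in> J"
  shows "I \<subseteq> J"
  unfolding I_eq
proof (rule ring.genideal_minimal[OF ring_free_algebra])
  interpret R: ring "free_algebra A" by (rule ring_free_algebra)
  have minus: "\<ominus>\<^bsub>free_algebra A\<^esub> y = - y" if "y \<in> FA" for y
    using that by (intro R.minus_equality) (auto simp: free_algebra_closed)
  show "ideal J (free_algebra A)"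
  proof (rule idealI[OF ring_free_algebra])
    show "subgroup J (add_monoid (free_algebra A))"
    proof (rule subgroup.intro)
      show "inv\<^bsub>add_monoid (free_algebra A)\<^esub> x \<in> J" if "x \<in> J" for x
      proof -
        have "inv\<^bsub>add_monoid (free_algebra A)\<^esub> x = - x"
          using minus[of x] assms(2) that by (auto simp: a_inv_def)
        moreover have "0 - x \<in> J" using assms(1) that unfolding add_subgroup_def by blast
        ultimately show ?thesis by simp
      qed
    qed (use assms(1,2) in \<open>auto simp: add_subgroup_add add_subgroup_def\<close>)
  qed (simp_all add: assms(4,5))
qed (rule assms(3))

lemma cls_eq_coset: "cls f = coset I f"
  by (simp add: uea_class_def a_r_coset_eq_coset)

lemma cls_eq_iff: "cls f = cls g \<longleftrightarrow> f - g \<in> I"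
  unfolding cls_eq_coset by (rule coset_eq_iff[OF add_subgroup_I])

lemma carrier_U: "carrier U = cls ` FA"
  by (auto simp: uea_def Let_def FactRing_def A_RCOSETS_def' uea_class_def)

lemma cls_closed [simp]: "f \<in> FA \<Longrightarrow> cls f \<in> carrier U"
  by (simp add: carrier_U)

lemma U_add: "cls f \<oplus>\<^bsub>U\<^esub> cls g = cls (f + g)"
  by (simp add: uea_def Let_def FactRing_def cls_eq_coset coset_set_add add_subgroup_I)

lemma U_mult: "f \<in> FA \<Longrightarrow> g \<in> FA \<Longrightarrow> cls f \<otimes>\<^bsub>U\<^esub> cls g = cls (f * g)"
  using ideal.rcoset_mult_add[OF ideal_I, of f g]
  by (simp add: uea_def Let_def FactRing_def uea_class_def)

lemma U_one: "\<one>\<^bsub>U\<^esub> = cls 1"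
  by (simp add: uea_def Let_def FactRing_def uea_class_def)

lemma U_smult: "f \<in> FA \<Longrightarrow> c \<odot>\<^bsub>U\<^esub> cls f = cls (free_scale c f)"
proof -
  assume f: "f \<in> FA"
  have "free_scalar c \<in> FA" by (simp add: free_scalar_def mem_free_algebra)
  from U_mult[OF this f] show ?thesis
    by (simp add: uea_def Let_def free_scalar_mult)
qed

lemma cls_letter_add:
  assumes "x \<in> A" "y \<in> A"
  shows "cls (letter (x + y)) = cls (letter x + letter y)"
proof -
  have "letter (x + y) - letter x - letter y \<in> relators"
    using assms unfolding relators_def by blast
  then show ?thesis
    using relators_I unfolding cls_eq_iff diff_diff_eq[symmetric] by blast
qed

lemma cls_letter_scale:
  assumes "x \<in> A"
  shows "cls (letter (sc c x)) = cls (free_scale c (letter x))"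
proof -
  have "letter (sc c x) - free_scalar c * letter x \<in> relators"
    using assms unfolding relators_def by blast
  then show ?thesis
    using relators_I unfolding cls_eq_iff free_scalar_mult by blast
qed

lemma cls_letter_bracket:
  assumes "x \<in> A" "y \<in> A"
  shows "cls (letter (br x y)) = cls (letter x * letter y - letter y * letter x)"
proof -
  have "letter x * letter y - letter y * letter x - letter (br x y) \<in> relators"
    using assms unfolding relators_def by blast
  then have "cls (letter x * letter y - letter y * letter x) = cls (letter (br x y))"
    using relators_I unfolding cls_eq_iff by blast
  then show ?thesis ..
qed

end

text \<open>The module is a subspace \<open>E\<close> of a type, because the main instance consists
  of the truncated series inside a function type.\<close>

locale lie_representation = enveloping sc br A + M: complex_vector_space sm
  for sc :: "complex \<Rightarrow> 'a :: ab_group_add \<Rightarrow> 'a" and br A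
    and sm :: "complex \<Rightarrow> 'm :: ab_group_add \<Rightarrow> 'm" +
  fixes act :: "'a \<Rightarrow> 'm \<Rightarrow> 'm" and E :: "'m set"
  assumes subspace_E: "M.subspace E"
    and act_closed: "x \<in> A \<Longrightarrow> e \<in> E \<Longrightarrow> act x e \<in> E"
    and act_add_right: "x \<in> A \<Longrightarrow> e \<in> E \<Longrightarrow> e' \<in> E \<Longrightarrow> act x (e + e') = act x e + act x e'"
    and act_scale_right: "x \<in> A \<Longrightarrow> e \<in> E \<Longrightarrow> act x (sm c e) = sm c (act x e)"
    and act_add: "x \<in> A \<Longrightarrow> y \<in> A \<Longrightarrow> e \<in> E \<Longrightarrow> act (x + y) e = act x e + act y e"
    and act_scale: "x \<in> A \<Longrightarrow> e \<in> E \<Longrightarrow> act (sc c x) e = sm c (act x e)"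
    and act_bracket: "x \<in> A \<Longrightarrow> y \<in> A \<Longrightarrow> e \<in> E \<Longrightarrow>
      act (br x y) e = act x (act y e) - act y (act x e)"
begin

abbreviation "free_act \<equiv> free_algebra_act sm act"

lemma free_act_lext: "free_act f e = lext sm (\<lambda>w. foldr act (letters w) e) f"
  by (simp add: free_algebra_act_def lext_def)

lemma foldr_closed: "set xs \<subseteq> A \<Longrightarrow> e \<in> E \<Longrightarrow> foldr act xs e \<in> E"
  by (induction xs) (auto intro: act_closed)

lemma foldr_add:
  "set xs \<subseteq> A \<Longrightarrow> e \<in> E \<Longrightarrow> e' \<in> E \<Longrightarrow> foldr act xs (e + e') = foldr act xs e + foldr act xs e'"
  by (induction xs) (auto simp: act_add_right foldr_closed)

lemma foldr_scale:
  "set xs \<subseteq> A \<Longrightarrow> e \<in> E \<Longrightarrow> foldr act xs (sm c e) = sm c (foldr act xs e)"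
  by (induction xs) (auto simp: act_scale_right foldr_closed)

lemma free_act_closed: "f \<in> FA \<Longrightarrow> e \<in> E \<Longrightarrow> free_act f e \<in> E"
  unfolding free_act_lext mem_free_algebra
  by (intro M.lext_mem[OF subspace_E] foldr_closed) auto

lemma free_act_add_right: "f \<in> FA \<Longrightarrow> e \<in> E \<Longrightarrow> e' \<in> E \<Longrightarrow> free_act f (e + e') = free_act f e + free_act f e'"
  unfolding free_act_lext lext_def sum.distrib[symmetric] mem_free_algebra
  by (intro sum.cong refl) (auto simp: foldr_add M.scale_right_distrib)

lemma free_act_scale_right: "f \<in> FA \<Longrightarrow> e \<in> E \<Longrightarrow> free_act f (sm c e) = sm c (free_act f e)"
  unfolding free_act_lext lext_def M.scale_sum_right mem_free_algebra
  by (intro sum.cong refl) (auto simp: foldr_scale mult.commute)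

lemma free_act_letter: "free_act (letter x) e = act x e"
  by (simp add: free_act_lext letter_def)

lemma free_act_one: "free_act 1 e = e"
  by (simp add: free_act_lext flip: single_one)

lemma free_act_mult:
  assumes "f \<in> FA" "g \<in> FA" "e \<in> E"
  shows "free_act (f * g) e = free_act f (free_act g e)"
proof -
  let ?W = "{w. set (letters w) \<subseteq> A}"
  have single: "Poly_Mapping.single u c \<in> FA" if "u \<in> ?W" for u and c :: complex
    using that by (simp add: mem_free_algebra)
  have 1: "free_act (Poly_Mapping.single u c * g) e = free_act (Poly_Mapping.single u c) (free_act g e)"
    if u: "u \<in> ?W" for u c
  proof -
    let ?P = "\<lambda>g. g \<in> FA \<and>
        free_act (Poly_Mapping.single u c * g) e = free_act (Poly_Mapping.single u c) (free_act g e)"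
    have zero: "free_act (Poly_Mapping.single u c) 0 = 0"
      using free_act_scale_right[OF single[OF u] \<open>e \<in> E\<close>, of c 0] by simp
    have "?P g"
    proof (rule poly_mapping_induct_single[of g ?W])
      show "Poly_Mapping.keys g \<subseteq> ?W" using assms(2) by (simp add: mem_free_algebra)
      show "?P 0" using zero by (simp add: free_act_lext free_algebra_closed)
      show "?P (f + g)" if "?P f" "?P g" for f g
      proof
        show "f + g \<in> FA" using that by (blast intro: free_algebra_closed)
        have "free_act (f + g) e = free_act f e + free_act g e" by (simp add: free_act_lext M.lext_add)
        then show "free_act (Poly_Mapping.single u c * (f + g)) e =
            free_act (Poly_Mapping.single u c) (free_act (f + g) e)"
          using that free_act_add_right[OF single[OF u], of "free_act f e" "free_act g e"] \<open>e \<in> E\<close>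
          by (simp add: free_act_closed distrib_left) (simp add: free_act_lext M.lext_add)
      qed
      show "?P (Poly_Mapping.single v d)" if "v \<in> ?W" for v d
        using u that assms(3) single
        by (simp add: free_act_lext mult_single foldr_scale foldr_closed)
    qed
    then show ?thesis by blast
  qed
  show ?thesis
  proof (rule poly_mapping_induct_single[of f ?W])
    show "Poly_Mapping.keys f \<subseteq> ?W" using assms(1) by (simp add: mem_free_algebra)
  qed (use 1 in \<open>simp_all add: free_act_lext M.lext_add distrib_right\<close>)
qed

lemma free_act_add: "free_act (f + g) e = free_act f e + free_act g e"
  by (simp add: free_act_lext M.lext_add)

lemma free_act_diff: "free_act (f - g) e = free_act f e - free_act g e"
  by (simp add: free_act_lext M.lext_diff)

lemma free_act_scale: "free_act (free_scale c f) e = sm c (free_act f e)"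
  by (simp add: free_act_lext M.lext_scale)

lemma free_act_zero_right: "f \<in> FA \<Longrightarrow> free_act f 0 = 0"
  using free_act_scale_right[of f 0 0] M.subspace_0[OF subspace_E] by simp

text \<open>The annihilator of \<open>E\<close> in the free algebra is a two-sided ideal that
  contains the relators.\<close>

lemma free_act_ideal:
  assumes "f \<in> I" "e \<in> E"
  shows "free_act f e = 0"
proof -
  let ?J = "{f \<in> FA. \<forall>e\<in>E. free_act f e = 0}"
  have "I \<subseteq> ?J"
  proof (rule I_minimal)
    show "add_subgroup ?J"
      by (auto simp: add_subgroup_def free_algebra_closed free_act_diff) (simp add: free_act_lext)
    show "relators \<subseteq> ?J"
    proof
      fix f assume f: "f \<in> relators"
      then have "f \<in> FA" using relators_subset by blast
      moreover have "free_act f e = 0" if e: "e \<in> E" for e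
        using f unfolding relators_def
        by (auto simp: free_act_diff free_act_letter free_scalar_mult free_act_scale free_act_mult e
            free_algebra_closed act_add act_scale act_bracket)
      ultimately show "f \<in> ?J" by blast
    qed
  qed (auto simp: free_algebra_closed free_act_mult free_act_closed free_act_zero_right)
  then show ?thesis using assms by blast
qed

lemma uea_act_cls:
  assumes "f \<in> FA" "e \<in> E"
  shows "uea_act sm act (cls f) e = free_act f e"
proof -
  have "(\<lambda>g. free_act g e) ` cls f = {free_act f e}"
  proof -
    have "free_act g e = free_act f e" if "g \<in> cls f" for g
      using free_act_ideal[of "g - f" e] that assms by (simp add: cls_eq_coset coset_def free_act_diff)
    then have "(\<lambda>g. free_act g e) ` cls f = (\<lambda>g. free_act f e) ` cls f"
      by (intro image_cong) simp_all
    also have "\<dots> = {free_act f e}"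
      by (rule image_constant[of f]) (simp add: cls_eq_coset coset_self add_subgroup_I)
    finally show ?thesis .
  qed
  then show ?thesis by (simp add: uea_act_def)
qed

end

section \<open>Induced modules\<close>

interpretation free: complex_vector_space "free_scale :: complex \<Rightarrow> ('s \<Rightarrow>\<^sub>0 complex) \<Rightarrow> _"
  by unfold_locales

lemma free_scale_mult:
  fixes f g :: "'a word \<Rightarrow>\<^sub>0 complex"
  shows "free_scale c f * g = free_scale c (f * g)"
  by (simp flip: free_scalar_mult add: mult.assoc)

lemma mult_free_scale:
  fixes f g :: "'a word \<Rightarrow>\<^sub>0 complex"
  shows "f * free_scale c g = free_scale c (f * g)"
proof -
  have "f * free_scalar c = free_scalar c * f"
    by (rule poly_mapping_induct_single[of f UNIV])
      (simp_all add: distrib_left distrib_right free_scalar_def mult_single mult.commute)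
  then show ?thesis by (simp flip: free_scalar_mult add: mult.assoc[symmetric])
qed

text \<open>Take x - g x for a linear retraction g onto R: it kills R and changes x only by an
  element of R.\<close>

lemma (in vector_space) subspace_complement_projection:
  assumes "subspace R"
  shows "\<exists>\<pi>. Vector_Spaces.linear scale scale \<pi> \<and> (\<forall>x\<in>R. \<pi> x = 0) \<and> (\<forall>x. \<pi> x - x \<in> R)"
proof -
  interpret vector_space_pair scale scale by unfold_locales
  obtain g where g: "range g \<subseteq> R" "Vector_Spaces.linear scale scale g" "\<forall>v\<in>R. g (id v) = v"
    using linear_exists_left_inverse_on[OF linear_id assms] by auto
  have "Vector_Spaces.linear scale scale (\<lambda>x. x - g x)"
    by (intro linear_compose_sub g(2)) (use linear_id in \<open>simp add: id_def\<close>)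
  moreover have "\<forall>x\<in>R. x - g x = 0" using g(3) by simp
  moreover have "\<forall>x. x - g x - x \<in> R"
    using subspace_neg[OF assms] g(1) by auto
  ultimately show ?thesis by (intro exI conjI)
qed

lemma quotient_free_space:
  fixes S :: "'s set"
  assumes "free.subspace N"
  defines "V \<equiv> quotient_module (free_space S) N"
  shows quotient_free_space_carrier: "carrier V = coset N ` {F. Poly_Mapping.keys F \<subseteq> S}"
    and quotient_free_space_zero: "\<zero>\<^bsub>V\<^esub> = coset N 0"
    and quotient_free_space_add: "coset N F \<oplus>\<^bsub>V\<^esub> coset N G = coset N (F + G)"
    and quotient_free_space_smult: "c \<odot>\<^bsub>V\<^esub> coset N F = coset N (free_scale c F)"
proof -
  have add: "add (free_space S) = (+)" by (simp add: free_space_def)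
  note N = free_subspace_add_subgroup[OF assms(1)]
  show "carrier V = coset N ` {F. Poly_Mapping.keys F \<subseteq> S}"
    by (auto simp: V_def quotient_module_def A_RCOSETS_def' a_r_coset_eq_coset add)
      (auto simp: free_space_def)
  show "\<zero>\<^bsub>V\<^esub> = coset N 0"
    by (simp add: V_def quotient_module_def coset_zero)
  show "coset N F \<oplus>\<^bsub>V\<^esub> coset N G = coset N (F + G)"
    by (simp add: V_def quotient_module_def coset_set_add[OF N add])
  have "coset N (free_scale c G) = coset N (free_scale c F)" if "G \<in> coset N F" for G
    using that free.subspace_scale[OF assms(1), of "G - F" c]
    by (simp add: coset_eq_iff[OF N]) (simp add: coset_def free.scale_right_diff_distrib)
  then have "(\<Union>G\<in>coset N F. coset N (free_scale c G)) = coset N (free_scale c F)"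
    using coset_self[OF N, of F] by blast
  then show "c \<odot>\<^bsub>V\<^esub> coset N F = coset N (free_scale c F)"
    by (simp add: V_def quotient_module_def a_r_coset_eq_coset add)
      (simp add: free_space_def)
qed

lemma complex_ring_simps [simp]:
  "carrier complex_ring = UNIV" "monoid.mult complex_ring = (*)" "one complex_ring = 1"
  "zero complex_ring = 0" "add complex_ring = (+)"
  by (simp_all add: complex_ring_def)

lemma cring_complex_ring: "cring complex_ring"
proof (rule cringI)
  show "abelian_group complex_ring"
    by (rule abelian_groupI) (auto intro: exI[of _ "- _"] simp: add_eq_0_iff)
  show "comm_monoid complex_ring"
    by (rule comm_monoidI) auto
qed (auto simp: algebra_simps)

lemma module_quotient_free_space:
  assumes "free.subspace N"
  shows "Module.module complex_ring (quotient_module (free_space S) N)"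
proof -
  note q = quotient_free_space[OF assms, of S]
  have cl: "Poly_Mapping.keys (F + G) \<subseteq> S" if "Poly_Mapping.keys F \<subseteq> S" "Poly_Mapping.keys G \<subseteq> S"
    for F G :: "'a \<Rightarrow>\<^sub>0 complex"
    using that Poly_Mapping.keys_add[of F G] by auto
  show ?thesis
  proof (rule moduleI[OF cring_complex_ring])
    show "abelian_group (quotient_module (free_space S) N)"
    proof (rule abelian_groupI)
      fix x assume "x \<in> carrier (quotient_module (free_space S) N)"
      then obtain F where F: "x = coset N F" "Poly_Mapping.keys F \<subseteq> S" by (auto simp: q)
      then show "\<exists>y\<in>carrier (quotient_module (free_space S) N).
          y \<oplus>\<^bsub>quotient_module (free_space S) N\<^esub> x = \<zero>\<^bsub>quotient_module (free_space S) N\<^esub>"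
        by (intro bexI[of _ "coset N (- F)"]) (auto simp: q)
    qed (auto simp: q cl ac_simps intro: imageI)
  next
    fix c x assume "x \<in> carrier (quotient_module (free_space S) N)"
    then obtain F where F: "x = coset N F" "Poly_Mapping.keys F \<subseteq> S" by (auto simp: q)
    then show "c \<odot>\<^bsub>quotient_module (free_space S) N\<^esub> x \<in> carrier (quotient_module (free_space S) N)"
      using keys_free_scale[of c F] by (auto simp: q)
  qed (auto simp: q free.scale_left_distrib free.scale_right_distrib)
qed

context enveloping
begin

lemma U_cases:
  assumes "u \<in> carrier U"
  obtains f where "f \<in> FA" "u = cls f"
  using assms by (auto simp: carrier_U)

lemma U_add_closed: "u \<in> carrier U \<Longrightarrow> v \<in> carrier U \<Longrightarrow> u \<oplus>\<^bsub>U\<^esub> v \<in> carrier U"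
  by (elim U_cases) (simp add: U_add free_algebra_closed)

lemma U_mult_closed: "u \<in> carrier U \<Longrightarrow> v \<in> carrier U \<Longrightarrow> u \<otimes>\<^bsub>U\<^esub> v \<in> carrier U"
  by (elim U_cases) (simp add: U_mult free_algebra_closed)

lemma U_smult_closed: "u \<in> carrier U \<Longrightarrow> c \<odot>\<^bsub>U\<^esub> u \<in> carrier U"
  by (elim U_cases) (simp add: U_smult free_algebra_closed)

lemma U_one_closed: "\<one>\<^bsub>U\<^esub> \<in> carrier U"
  by (simp add: U_one free_algebra_closed)

lemma cls_letter_closed: "x \<in> A \<Longrightarrow> cls (letter x) \<in> carrier U"
  by (simp add: free_algebra_closed)

lemma U_distrib_left:
  "u \<in> carrier U \<Longrightarrow> v \<in> carrier U \<Longrightarrow> w \<in> carrier U \<Longrightarrow>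
    u \<otimes>\<^bsub>U\<^esub> (v \<oplus>\<^bsub>U\<^esub> w) = u \<otimes>\<^bsub>U\<^esub> v \<oplus>\<^bsub>U\<^esub> u \<otimes>\<^bsub>U\<^esub> w"
  by (elim U_cases) (simp add: U_mult U_add free_algebra_closed distrib_left)

lemma U_distrib_right:
  "u \<in> carrier U \<Longrightarrow> v \<in> carrier U \<Longrightarrow> w \<in> carrier U \<Longrightarrow>
    (v \<oplus>\<^bsub>U\<^esub> w) \<otimes>\<^bsub>U\<^esub> u = v \<otimes>\<^bsub>U\<^esub> u \<oplus>\<^bsub>U\<^esub> w \<otimes>\<^bsub>U\<^esub> u"
  by (elim U_cases) (simp add: U_mult U_add free_algebra_closed distrib_right)

lemma U_assoc:
  "u \<in> carrier U \<Longrightarrow> v \<in> carrier U \<Longrightarrow> w \<in> carrier U \<Longrightarrow>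
    u \<otimes>\<^bsub>U\<^esub> (v \<otimes>\<^bsub>U\<^esub> w) = (u \<otimes>\<^bsub>U\<^esub> v) \<otimes>\<^bsub>U\<^esub> w"
  by (elim U_cases) (simp add: U_mult free_algebra_closed mult.assoc)

lemma U_mult_smult:
  "u \<in> carrier U \<Longrightarrow> v \<in> carrier U \<Longrightarrow> u \<otimes>\<^bsub>U\<^esub> (c \<odot>\<^bsub>U\<^esub> v) = c \<odot>\<^bsub>U\<^esub> (u \<otimes>\<^bsub>U\<^esub> v)"
  by (elim U_cases) (simp add: U_mult U_smult free_algebra_closed mult_free_scale)

lemma U_smult_mult:
  "u \<in> carrier U \<Longrightarrow> v \<in> carrier U \<Longrightarrow> (c \<odot>\<^bsub>U\<^esub> u) \<otimes>\<^bsub>U\<^esub> v = c \<odot>\<^bsub>U\<^esub> (u \<otimes>\<^bsub>U\<^esub> v)"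
  by (elim U_cases)
    (simp add: U_mult U_smult free_algebra_closed free_scale_mult)

end

section \<open>The relations of the tensor product and the action on it\<close>

locale induced = A: enveloping sc br A + B: lie_representation sc br B sm act UNIV
  for sc :: "complex \<Rightarrow> 'a :: ab_group_add \<Rightarrow> 'a" and br A B
    and sm :: "complex \<Rightarrow> 'm :: ab_group_add \<Rightarrow> 'm" and act +
  assumes B_subset: "B \<subseteq> A"
begin

abbreviation "R \<equiv> induced_relations sc br A B sm act"
abbreviation "S \<equiv> carrier (uea sc br A) \<times> (UNIV :: 'm set)"
abbreviation tens :: "('a word \<Rightarrow>\<^sub>0 complex) set \<Rightarrow> 'm \<Rightarrow> (('a word \<Rightarrow>\<^sub>0 complex) set \<times> 'm \<Rightarrow>\<^sub>0 complex)" where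
  "tens u m \<equiv> Poly_Mapping.single (u, m) 1"

text \<open>This makes the map of enveloping algebras well defined on cosets. The ideal of
  \<open>A\<close> cuts out of the smaller free algebra an ideal that contains the relators of
  \<open>B\<close>.\<close>

lemma I_mono: "B.I \<subseteq> A.I"
proof -
  have sub: "f \<in> A.FA" if "f \<in> B.FA" for f
    using that B_subset by (auto simp: mem_free_algebra)
  interpret ideal A.I "free_algebra A" by (rule A.ideal_I)
  have "B.I \<subseteq> A.I \<inter> B.FA"
  proof (rule B.I_minimal)
    show "add_subgroup (A.I \<inter> B.FA)"
      using A.add_subgroup_I by (auto simp: add_subgroup_def free_algebra_closed)
    have "B.relators \<subseteq> A.relators"
      using B_subset unfolding A.relators_def B.relators_def by blast
    then show "B.relators \<subseteq> A.I \<inter> B.FA"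
      using A.relators_I B.relators_subset by blast
    show "f * g \<in> A.I \<inter> B.FA" if "f \<in> B.FA" "g \<in> A.I \<inter> B.FA" for f g
      using I_l_closed[of g f] that sub by (auto simp: free_algebra_closed)
    show "g * f \<in> A.I \<inter> B.FA" if "f \<in> B.FA" "g \<in> A.I \<inter> B.FA" for f g
      using I_r_closed[of g f] that sub by (auto simp: free_algebra_closed)
  qed auto
  then show ?thesis by blast
qed

lemma FA_mono: "B.FA \<subseteq> A.FA"
proof
  fix f assume "f \<in> B.FA"
  then show "f \<in> A.FA" using B_subset by (auto simp: mem_free_algebra)
qed

lemma uea_incl_cls: "uea_incl sc br A (B.cls g) = A.cls g"
proof -
  have "A.cls f = A.cls g" if "f \<in> B.cls g" for f
    using that I_mono by (auto simp: A.cls_eq_iff B.cls_eq_coset coset_def)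
  moreover have "g \<in> B.cls g"
    by (simp add: B.cls_eq_coset coset_self B.add_subgroup_I)
  ultimately show ?thesis unfolding uea_incl_def by blast
qed

definition generators where
  "generators =
      {tens (x \<oplus>\<^bsub>A.U\<^esub> y) m - tens x m - tens y m |x y m. x \<in> carrier A.U \<and> y \<in> carrier A.U} \<union>
      {tens x (m + n) - tens x m - tens x n |x m n. x \<in> carrier A.U} \<union>
      {tens (c \<odot>\<^bsub>A.U\<^esub> x) m - free_scale c (tens x m) |c x m. x \<in> carrier A.U} \<union>
      {tens x (sm c m) - free_scale c (tens x m) |c x m. x \<in> carrier A.U} \<union>
      {tens (x \<otimes>\<^bsub>A.U\<^esub> uea_incl sc br A h) m - tens x (uea_act sm act h m) |x h m.
        x \<in> carrier A.U \<and> h \<in> carrier B.U}"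

lemma R_eq: "R = free.span generators"
  by (simp add: induced_relations_def tensor_relations_def generators_def Let_def)

lemma subspace_R: "free.subspace R"
  by (simp add: R_eq)

lemma generators_R: "generators \<subseteq> R"
  by (simp add: R_eq free.span_superset)

lemma R_induct:
  assumes "F \<in> R" and sub: "free.subspace P"
    and "\<And>x y m. x \<in> carrier A.U \<Longrightarrow> y \<in> carrier A.U \<Longrightarrow> tens (x \<oplus>\<^bsub>A.U\<^esub> y) m - tens x m - tens y m \<in> P"
    and "\<And>x m n. x \<in> carrier A.U \<Longrightarrow> tens x (m + n) - tens x m - tens x n \<in> P"
    and "\<And>c x m. x \<in> carrier A.U \<Longrightarrow> tens (c \<odot>\<^bsub>A.U\<^esub> x) m - free_scale c (tens x m) \<in> P"
    and "\<And>c x m. x \<in> carrier A.U \<Longrightarrow> tens x (sm c m) - free_scale c (tens x m) \<in> P"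
    and "\<And>x g m. x \<in> carrier A.U \<Longrightarrow> g \<in> B.FA \<Longrightarrow>
      tens (x \<otimes>\<^bsub>A.U\<^esub> A.cls g) m - tens x (B.free_act g m) \<in> P"
  shows "F \<in> P"
proof -
  have "generators \<subseteq> P"
    unfolding generators_def
  proof (intro Un_least subsetI; clarify)
    fix x h m assume "x \<in> carrier A.U" "h \<in> carrier B.U"
    then show "tens (x \<otimes>\<^bsub>A.U\<^esub> uea_incl sc br A h) m - tens x (uea_act sm act h m) \<in> P"
      using assms(7) by (auto simp: B.carrier_U uea_incl_cls B.uea_act_cls)
  qed (use assms in blast)+
  then have "free.span generators \<subseteq> P"
    by (intro free.span_minimal sub)
  then show ?thesis using assms(1) by (auto simp: R_eq)
qed

lemma R_relations:
  shows R_add: "x \<in> carrier A.U \<Longrightarrow> y \<in> carrier A.U \<Longrightarrow> tens (x \<oplus>\<^bsub>A.U\<^esub> y) m - tens x m - tens y m \<in> R"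
    and R_add_right: "x \<in> carrier A.U \<Longrightarrow> tens x (m + n) - tens x m - tens x n \<in> R"
    and R_smult: "x \<in> carrier A.U \<Longrightarrow> tens (c \<odot>\<^bsub>A.U\<^esub> x) m - free_scale c (tens x m) \<in> R"
    and R_scale_right: "x \<in> carrier A.U \<Longrightarrow> tens x (sm c m) - free_scale c (tens x m) \<in> R"
    and R_balance: "x \<in> carrier A.U \<Longrightarrow> g \<in> B.FA \<Longrightarrow>
      tens (x \<otimes>\<^bsub>A.U\<^esub> A.cls g) m - tens x (B.free_act g m) \<in> R"
proof -
  show "tens (x \<oplus>\<^bsub>A.U\<^esub> y) m - tens x m - tens y m \<in> R" if "x \<in> carrier A.U" "y \<in> carrier A.U"
    by (rule subsetD[OF generators_R]) (use that in \<open>unfold generators_def, blast\<close>)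
  show "tens x (m + n) - tens x m - tens x n \<in> R" if "x \<in> carrier A.U"
    by (rule subsetD[OF generators_R]) (use that in \<open>unfold generators_def, blast\<close>)
  show "tens (c \<odot>\<^bsub>A.U\<^esub> x) m - free_scale c (tens x m) \<in> R" if "x \<in> carrier A.U"
    by (rule subsetD[OF generators_R]) (use that in \<open>unfold generators_def, blast\<close>)
  show "tens x (sm c m) - free_scale c (tens x m) \<in> R" if "x \<in> carrier A.U"
    by (rule subsetD[OF generators_R]) (use that in \<open>unfold generators_def, blast\<close>)
  show "tens (x \<otimes>\<^bsub>A.U\<^esub> A.cls g) m - tens x (B.free_act g m) \<in> R" if "x \<in> carrier A.U" "g \<in> B.FA"
  proof -
    have "tens (x \<otimes>\<^bsub>A.U\<^esub> uea_incl sc br A (B.cls g)) m - tens x (uea_act sm act (B.cls g) m) \<in> R"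
      by (rule subsetD[OF generators_R])
        (use that B.cls_closed[of g] in \<open>unfold generators_def, blast\<close>)
    then show ?thesis using that by (simp add: uea_incl_cls B.uea_act_cls)
  qed
qed

lemma R_subset: "R \<subseteq> {F. Poly_Mapping.keys F \<subseteq> S}"
proof
  fix F assume "F \<in> R"
  then show "F \<in> {F. Poly_Mapping.keys F \<subseteq> S}"
  proof (rule R_induct[OF _ subspace_keys])
    have t: "tens u m \<in> {F. Poly_Mapping.keys F \<subseteq> S}" if "u \<in> carrier A.U" for u m
      using that by simp
    note sub = free.subspace_diff[OF subspace_keys] free.subspace_scale[OF subspace_keys]
    show "tens (x \<oplus>\<^bsub>A.U\<^esub> y) m - tens x m - tens y m \<in> {F. Poly_Mapping.keys F \<subseteq> S}"
      if "x \<in> carrier A.U" "y \<in> carrier A.U" for x y m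
      by (intro sub t A.U_add_closed that)
    show "tens x (m + n) - tens x m - tens x n \<in> {F. Poly_Mapping.keys F \<subseteq> S}"
      if "x \<in> carrier A.U" for x m n
      by (intro sub t that)
    show "tens (c \<odot>\<^bsub>A.U\<^esub> x) m - free_scale c (tens x m) \<in> {F. Poly_Mapping.keys F \<subseteq> S}"
      if "x \<in> carrier A.U" for c x m
      by (intro sub t A.U_smult_closed that)
    show "tens x (sm c m) - free_scale c (tens x m) \<in> {F. Poly_Mapping.keys F \<subseteq> S}"
      if "x \<in> carrier A.U" for c x m
      by (intro sub t that)
    show "tens (x \<otimes>\<^bsub>A.U\<^esub> A.cls g) m - tens x (B.free_act g m) \<in> {F. Poly_Mapping.keys F \<subseteq> S}"
      if "x \<in> carrier A.U" "g \<in> B.FA" for x g m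
      using that FA_mono by (intro sub t A.U_mult_closed A.cls_closed) auto
  qed
qed

text \<open>The action of an element on the free space, before passing to the quotient. It respects
  sums, scalars and brackets of that element only modulo \<open>R\<close>.\<close>

definition T :: "'a \<Rightarrow> (('a word \<Rightarrow>\<^sub>0 complex) set \<times> 'm \<Rightarrow>\<^sub>0 complex) \<Rightarrow> _" where
  "T x = lext free_scale (\<lambda>(u, m). tens (A.cls (letter x) \<otimes>\<^bsub>A.U\<^esub> u) m)"

lemma T_tens [simp]: "T x (tens u m) = tens (A.cls (letter x) \<otimes>\<^bsub>A.U\<^esub> u) m"
  by (simp add: T_def)

lemma T_linear [simp]:
  "T x 0 = 0" "T x (F + G) = T x F + T x G" "T x (F - G) = T x F - T x G"
  "T x (free_scale c F) = free_scale c (T x F)"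
  by (simp_all add: T_def free.lext_add free.lext_diff free.lext_scale)

lemma T_closed:
  assumes "x \<in> A" "Poly_Mapping.keys F \<subseteq> S"
  shows "Poly_Mapping.keys (T x F) \<subseteq> S"
proof -
  have "T x F \<in> {F. Poly_Mapping.keys F \<subseteq> S}"
    unfolding T_def
    by (intro free.lext_mem[OF subspace_keys])
      (use assms in \<open>auto intro!: A.U_mult_closed A.cls_letter_closed\<close>)
  then show ?thesis by blast
qed

lemma T_R:
  assumes x: "x \<in> A" and "F \<in> R"
  shows "T x F \<in> R"
proof -
  have "F \<in> {F. T x F \<in> R}"
    using \<open>F \<in> R\<close>
  proof (rule R_induct)
    show "free.subspace {F. T x F \<in> R}"
      using subspace_R by (auto simp: free.subspace_def)
  qed (use A.cls_letter_closed[OF x] FA_mono in \<open>auto simp del: free_scale_single simp: A.U_distrib_left A.U_mult_smult A.U_assoc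
      subset_eq intro!: R_add R_add_right R_smult R_scale_right R_balance A.U_mult_closed\<close>)
  then show ?thesis by simp
qed

lemma R_of_tens:
  assumes "Poly_Mapping.keys F \<subseteq> S"
    and L: "\<And>F G. L (F + G) = L F + L G" "\<And>c F. L (free_scale c F) = free_scale c (L F)"
    and "\<And>u m. u \<in> carrier A.U \<Longrightarrow> L (tens u m) \<in> R"
  shows "L F \<in> R"
proof (rule poly_mapping_induct_single[OF assms(1)])
  show "L 0 \<in> R" using L(2)[of 0 0] free.subspace_0[OF subspace_R] by simp
  fix k c assume "k \<in> S"
  then have "free_scale c (L (tens (fst k) (snd k))) \<in> R"
    using assms(4) free.subspace_scale[OF subspace_R] by auto
  then show "L (Poly_Mapping.single k c) \<in> R"
    by (simp flip: L(2))
qed (simp add: L(1) free.subspace_add[OF subspace_R])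

lemma T_add:
  assumes "x \<in> A" "y \<in> A" "Poly_Mapping.keys F \<subseteq> S"
  shows "T (x + y) F - T x F - T y F \<in> R"
proof (rule R_of_tens[OF assms(3)])
  fix u m assume u: "u \<in> carrier A.U"
  have "A.cls (letter (x + y)) \<otimes>\<^bsub>A.U\<^esub> u =
      A.cls (letter x) \<otimes>\<^bsub>A.U\<^esub> u \<oplus>\<^bsub>A.U\<^esub> A.cls (letter y) \<otimes>\<^bsub>A.U\<^esub> u"
    unfolding A.cls_letter_add[OF assms(1,2)] A.U_add[symmetric]
    by (rule A.U_distrib_right) (use u assms in \<open>auto intro: A.cls_letter_closed\<close>)
  then show "T (x + y) (tens u m) - T x (tens u m) - T y (tens u m) \<in> R"
    using u assms(1,2) by (simp add: R_add A.U_mult_closed A.cls_letter_closed)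
qed (simp_all add: free.scale_right_diff_distrib)

lemma T_scale:
  assumes "x \<in> A" "Poly_Mapping.keys F \<subseteq> S"
  shows "T (sc c x) F - free_scale c (T x F) \<in> R"
proof (rule R_of_tens[OF assms(2)])
  fix u m assume u: "u \<in> carrier A.U"
  have "A.cls (letter (sc c x)) \<otimes>\<^bsub>A.U\<^esub> u = c \<odot>\<^bsub>A.U\<^esub> (A.cls (letter x) \<otimes>\<^bsub>A.U\<^esub> u)"
    using u assms(1) free_algebra_closed(8)[OF assms(1)] A.cls_letter_closed[OF assms(1)]
    by (simp add: A.cls_letter_scale A.U_smult[symmetric] A.U_smult_mult)
  then show "T (sc c x) (tens u m) - free_scale c (T x (tens u m)) \<in> R"
    using R_smult[of "A.cls (letter x) \<otimes>\<^bsub>A.U\<^esub> u" c m] u assms(1)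
    by (simp add: A.U_mult_closed A.cls_letter_closed)
qed (simp_all add: free.scale_right_distrib free.scale_right_diff_distrib mult.commute)

lemma T_bracket:
  assumes "x \<in> A" "y \<in> A" "Poly_Mapping.keys F \<subseteq> S"
  shows "T (br x y) F - (T x (T y F) - T y (T x F)) \<in> R"
proof (rule R_of_tens[OF assms(3)])
  fix u m assume "u \<in> carrier A.U"
  then obtain f where f: "f \<in> A.FA" "u = A.cls f" by (rule A.U_cases)
  note l = free_algebra_closed(8)[OF assms(1)] free_algebra_closed(8)[OF assms(2)]
  let ?xy = "letter x * letter y * f" and ?yx = "letter y * letter x * f"
  have cl: "?xy \<in> A.FA" "?yx \<in> A.FA" "?xy - ?yx \<in> A.FA"
    "letter x * letter y - letter y * letter x \<in> A.FA"
    "letter x * f \<in> A.FA" "letter y * f \<in> A.FA"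
    using f l by (auto intro!: free_algebra_closed)
  \<comment> \<open>The relations only treat sums, so the difference enters through
    \<open>?xy\<close> = (\<open>?xy\<close> - \<open>?yx\<close>) + \<open>?yx\<close>.\<close>
  have "tens (A.cls (?xy - ?yx) \<oplus>\<^bsub>A.U\<^esub> A.cls ?yx) m -
      tens (A.cls (?xy - ?yx)) m - tens (A.cls ?yx) m \<in> R"
    by (intro R_add A.cls_closed cl)
  then have "- (tens (A.cls ?xy) m - tens (A.cls (?xy - ?yx)) m - tens (A.cls ?yx) m) \<in> R"
    by (intro free.subspace_neg[OF subspace_R]) (simp add: A.U_add)
  moreover have "A.cls (letter (br x y)) \<otimes>\<^bsub>A.U\<^esub> u = A.cls (?xy - ?yx)"
    using f cl by (simp add: A.cls_letter_bracket assms(1,2) A.U_mult left_diff_distrib)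
  moreover have "T x (T y (tens u m)) = tens (A.cls ?xy) m" "T y (T x (tens u m)) = tens (A.cls ?yx) m"
    using f l cl by (simp_all add: A.U_mult mult.assoc)
  ultimately show "T (br x y) (tens u m) - (T x (T y (tens u m)) - T y (T x (tens u m))) \<in> R"
    by (simp add: algebra_simps)
qed (simp_all add: free.scale_right_diff_distrib)

lemma T_unit:
  assumes "x \<in> B"
  shows "T x (tens \<one>\<^bsub>A.U\<^esub> m) - tens \<one>\<^bsub>A.U\<^esub> (act x m) \<in> R"
proof -
  have x: "x \<in> A" "letter x \<in> A.FA" "letter x \<in> B.FA"
    using assms B_subset by (auto intro: free_algebra_closed)
  have "A.cls (letter x) \<otimes>\<^bsub>A.U\<^esub> \<one>\<^bsub>A.U\<^esub> = \<one>\<^bsub>A.U\<^esub> \<otimes>\<^bsub>A.U\<^esub> A.cls (letter x)"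
    using x by (simp add: A.U_one A.U_mult free_algebra_closed)
  then show ?thesis
    using R_balance[OF A.U_one_closed x(3), of m] by (simp add: B.free_act_letter)
qed

text \<open>Induction on words: a letter in front of a word is one application of \<open>T\<close>.
  Linear combinations inside the enveloping algebra are resolved modulo \<open>R\<close>.\<close>

lemma generation:
  assumes F: "Poly_Mapping.keys F \<subseteq> S" and sub: "free.subspace P" and "R \<subseteq> P"
    and unit: "\<And>m. tens \<one>\<^bsub>A.U\<^esub> m \<in> P" and T: "\<And>x F. x \<in> A \<Longrightarrow> F \<in> P \<Longrightarrow> T x F \<in> P"
  shows "F \<in> P"
proof -
  have mod: "G \<in> P" if "G - H \<in> R" "H \<in> P" for G H
    using free.subspace_add[OF sub, of "G - H" H] that \<open>R \<subseteq> P\<close> by auto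
  have word: "tens (A.cls (Poly_Mapping.single (Word xs) 1)) m \<in> P" if "set xs \<subseteq> A" for xs m
    using that
  proof (induction xs)
    case Nil
    then show ?case using unit[of m] by (simp add: A.U_one flip: single_one zero_word_def)
  next
    case (Cons x xs)
    have "T x (tens (A.cls (Poly_Mapping.single (Word xs) 1)) m) \<in> P"
      using Cons by (intro T) auto
    moreover have "A.cls (letter x) \<otimes>\<^bsub>A.U\<^esub> A.cls (Poly_Mapping.single (Word xs) 1) =
        A.cls (Poly_Mapping.single (Word (x # xs)) 1)"
      using Cons.prems
      by (subst A.U_mult) (auto simp: letter_def mem_free_algebra mult_single plus_word_def)
    ultimately show ?case by simp
  qed
  have tens: "tens (A.cls f) m \<in> P" if f: "f \<in> A.FA" for f m
  proof -
    have "f \<in> A.FA \<and> tens (A.cls f) m \<in> P"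
    proof (rule poly_mapping_induct_single[of f "{w. set (letters w) \<subseteq> A}"])
      show "Poly_Mapping.keys f \<subseteq> {w. set (letters w) \<subseteq> A}"
        using f by (simp add: mem_free_algebra)
    next
      \<comment> \<open>\<open>tens (A.cls 0) m\<close> is a nonzero vector of the free space; it
        lies in \<open>R\<close> by the scalar relation with coefficient 0.\<close>
      have "tens (A.cls (free_scale 0 1)) m - free_scale 0 (tens (A.cls 1) m) \<in> R"
        using R_smult[of "A.cls 1" 0 m] by (simp add: A.U_smult free_algebra_closed)
      then show "0 \<in> A.FA \<and> tens (A.cls 0) m \<in> P"
        using \<open>R \<subseteq> P\<close> by (auto simp: free_algebra_closed)
    next
      fix f g assume fg: "f \<in> A.FA \<and> tens (A.cls f) m \<in> P" "g \<in> A.FA \<and> tens (A.cls g) m \<in> P"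
      then have "tens (A.cls (f + g)) m - (tens (A.cls f) m + tens (A.cls g) m) \<in> R"
        using R_add[of "A.cls f" "A.cls g" m] by (simp add: A.U_add diff_diff_eq)
      then show "f + g \<in> A.FA \<and> tens (A.cls (f + g)) m \<in> P"
        using fg by (blast intro: mod free.subspace_add[OF sub] free_algebra_closed)
    next
      fix w and c :: complex assume w: "w \<in> {w. set (letters w) \<subseteq> A}"
      then have s: "Poly_Mapping.single w 1 \<in> A.FA" "Poly_Mapping.single w c \<in> A.FA"
        by (auto simp: mem_free_algebra)
      have "tens (A.cls (Poly_Mapping.single w c)) m -
          free_scale c (tens (A.cls (Poly_Mapping.single w 1)) m) \<in> R"
        using R_smult[OF A.cls_closed[OF s(1)], of c m] s by (simp add: A.U_smult)
      moreover have "tens (A.cls (Poly_Mapping.single w 1)) m \<in> P"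
        using word[of "letters w"] w by simp
      ultimately show "Poly_Mapping.single w c \<in> A.FA \<and> tens (A.cls (Poly_Mapping.single w c)) m \<in> P"
        using s by (blast intro: mod free.subspace_scale[OF sub])
    qed
    then show ?thesis by blast
  qed
  show ?thesis
  proof (rule poly_mapping_induct_single[OF F])
    fix k c assume "k \<in> S"
    then have "tens (fst k) (snd k) \<in> P"
      using tens by (auto simp: A.carrier_U)
    from free.subspace_scale[OF sub this, of c] show "Poly_Mapping.single k c \<in> P" by simp
  qed (simp_all add: free.subspace_0[OF sub] free.subspace_add[OF sub])
qed

abbreviation "V \<equiv> induced_module sc br A B sm act"

lemma V_carrier: "carrier V = coset R ` {F. Poly_Mapping.keys F \<subseteq> S}"
  and V_zero: "\<zero>\<^bsub>V\<^esub> = coset R 0"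
  and V_add: "coset R F \<oplus>\<^bsub>V\<^esub> coset R G = coset R (F + G)"
  and V_smult: "c \<odot>\<^bsub>V\<^esub> coset R F = coset R (free_scale c F)"
  and module_V: "Module.module complex_ring V"
  unfolding induced_module_def
  by (rule quotient_free_space[OF subspace_R] module_quotient_free_space[OF subspace_R])+

lemma induced_class_eq: "induced_class sc br A B sm act F = coset R F"
  unfolding induced_class_def by (rule a_r_coset_eq_coset) (simp add: free_space_def)

lemma induced_unit_eq: "induced_unit sc br A B sm act m = coset R (tens \<one>\<^bsub>A.U\<^esub> m)"
  by (simp add: induced_unit_def induced_class_eq)

lemma coset_R_eq_iff: "coset R F = coset R G \<longleftrightarrow> F - G \<in> R"
  by (rule coset_eq_iff[OF free_subspace_add_subgroup[OF subspace_R]])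

lemma induced_act_coset:
  assumes x: "x \<in> A"
  shows "induced_act sc br A B sm act x (coset R F) = coset R (T x F)"
proof -
  have T: "(\<Sum>(u, m)\<in>Poly_Mapping.keys G.
      Poly_Mapping.single (A.cls (letter x) \<otimes>\<^bsub>A.U\<^esub> u, m) (Poly_Mapping.lookup G (u, m))) = T x G" for G
    by (simp add: T_def lext_def case_prod_unfold)
  have "coset R (T x G) = coset R (T x F)" if "G \<in> coset R F" for G
  proof -
    have "G - F \<in> R" using that by (simp add: coset_def)
    then show ?thesis using T_R[OF x, of "G - F"] by (simp add: coset_R_eq_iff)
  qed
  moreover have "F \<in> coset R F"
    by (rule coset_self[OF free_subspace_add_subgroup[OF subspace_R]])
  ultimately show ?thesis
    unfolding induced_act_def T induced_class_eq by blast
qed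

end

section \<open>Universal property of the induced module\<close>

locale induced_hom = induced sc br A B sm act + E: lie_representation sc br A sm' act' E
  for sc :: "complex \<Rightarrow> 'a :: ab_group_add \<Rightarrow> 'a" and br A B
    and sm :: "complex \<Rightarrow> 'm :: ab_group_add \<Rightarrow> 'm" and act
    and sm' :: "complex \<Rightarrow> 'e :: ab_group_add \<Rightarrow> 'e" and act' E +
  fixes \<psi> :: "'m \<Rightarrow> 'e"
  assumes \<psi>_closed: "\<psi> m \<in> E" and \<psi>_add: "\<psi> (m + n) = \<psi> m + \<psi> n"
    and \<psi>_scale: "\<psi> (sm c m) = sm' c (\<psi> m)"
    and \<psi>_act: "x \<in> B \<Longrightarrow> \<psi> (act x m) = act' x (\<psi> m)"
begin

definition extension where
  "extension = lext sm' (\<lambda>(u, m). uea_act sm' act' u (\<psi> m))"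

lemma extension_linear [simp]:
  "extension 0 = 0" "extension (F + G) = extension F + extension G"
  "extension (F - G) = extension F - extension G"
  "extension (free_scale c F) = sm' c (extension F)"
  by (simp_all add: extension_def E.M.lext_add E.M.lext_diff E.M.lext_scale)

lemma extension_tens [simp]: "extension (tens u m) = uea_act sm' act' u (\<psi> m)"
  by (simp add: extension_def)

lemma extension_closed:
  assumes "Poly_Mapping.keys F \<subseteq> S"
  shows "extension F \<in> E"
  unfolding extension_def
proof (rule E.M.lext_mem[OF E.subspace_E])
  fix k assume "k \<in> Poly_Mapping.keys F"
  then have "fst k \<in> carrier A.U" using assms by auto
  then obtain f where "f \<in> A.FA" "fst k = A.cls f" by (rule A.U_cases)
  then show "(case k of (u, m) \<Rightarrow> uea_act sm' act' u (\<psi> m)) \<in> E"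
    by (simp add: case_prod_unfold E.uea_act_cls \<psi>_closed E.free_act_closed)
qed

lemma \<psi>_free_act:
  assumes "g \<in> B.FA"
  shows "\<psi> (B.free_act g m) = E.free_act g (\<psi> m)"
proof -
  have foldr: "\<psi> (foldr act xs m) = foldr act' xs (\<psi> m)" if "set xs \<subseteq> B" for xs
    using that by (induction xs) (auto simp: \<psi>_act)
  have zero: "\<psi> 0 = 0" using \<psi>_add[of 0 0] by simp
  have "\<psi> (B.free_act f m) = E.free_act f (\<psi> m)"
    if "Poly_Mapping.keys f \<subseteq> {w. set (letters w) \<subseteq> B}" for f
    by (rule poly_mapping_induct_single[OF that])
      (auto simp: B.free_act_lext E.free_act_lext B.M.lext_add E.M.lext_add zero \<psi>_add \<psi>_scale foldr)
  then show ?thesis using assms by (simp add: mem_free_algebra)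
qed

lemma extension_R:
  assumes "F \<in> R"
  shows "extension F = 0"
proof -
  have "F \<in> {F. extension F = 0}"
    using assms
  proof (rule R_induct)
    show "free.subspace {F. extension F = 0}" by (simp add: free.subspace_def)
  next
    fix x y m assume "x \<in> carrier A.U" "y \<in> carrier A.U"
    then show "tens (x \<oplus>\<^bsub>A.U\<^esub> y) m - tens x m - tens y m \<in> {F. extension F = 0}"
      by (elim A.U_cases)
        (simp add: A.U_add E.uea_act_cls free_algebra_closed \<psi>_closed E.free_act_add)
  next
    fix x m n assume "x \<in> carrier A.U"
    then show "tens x (m + n) - tens x m - tens x n \<in> {F. extension F = 0}"
      by (elim A.U_cases)
        (simp add: E.uea_act_cls \<psi>_closed \<psi>_add E.free_act_add_right E.M.subspace_add[OF E.subspace_E])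
  next
    fix c x m assume "x \<in> carrier A.U"
    then show "tens (c \<odot>\<^bsub>A.U\<^esub> x) m - free_scale c (tens x m) \<in> {F. extension F = 0}"
      by (elim A.U_cases)
        (simp del: free_scale_single
          add: A.U_smult E.uea_act_cls \<psi>_closed E.free_act_scale free_algebra_closed)
  next
    fix c x m assume "x \<in> carrier A.U"
    then show "tens x (sm c m) - free_scale c (tens x m) \<in> {F. extension F = 0}"
      by (elim A.U_cases)
        (simp del: free_scale_single
          add: E.uea_act_cls \<psi>_closed \<psi>_scale E.free_act_scale_right E.M.subspace_scale[OF E.subspace_E])
  next
    fix x g m assume x: "x \<in> carrier A.U" and g: "g \<in> B.FA"
    then have "g \<in> A.FA" using FA_mono by blast
    then show "tens (x \<otimes>\<^bsub>A.U\<^esub> A.cls g) m - tens x (B.free_act g m) \<in> {F. extension F = 0}"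
      using x by (elim A.U_cases)
        (simp add: A.U_mult E.uea_act_cls free_algebra_closed \<psi>_closed \<psi>_free_act[OF g]
          E.free_act_closed E.free_act_mult)
  qed
  then show ?thesis by simp
qed

lemma extension_unit: "extension (tens \<one>\<^bsub>A.U\<^esub> m) = \<psi> m"
  by (simp add: A.U_one E.uea_act_cls free_algebra_closed \<psi>_closed E.free_act_one)

lemma extension_T:
  assumes x: "x \<in> A" and F: "Poly_Mapping.keys F \<subseteq> S"
  shows "extension (T x F) = act' x (extension F)"
proof -
  have 0: "act' x 0 = 0"
    using E.act_scale_right[OF x E.M.subspace_0[OF E.subspace_E], of 0] by simp
  have "extension F \<in> E \<and> extension (T x F) = act' x (extension F)"
  proof (rule poly_mapping_induct_single[OF F])
    fix k c assume "k \<in> S"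
    then obtain f m where k: "k = (A.cls f, m)" "f \<in> A.FA" by (auto simp: A.carrier_U)
    have e: "extension (tens (A.cls f) m) \<in> E"
      using k by (intro extension_closed) simp
    have "Poly_Mapping.single k c = free_scale c (tens (A.cls f) m)" using k by simp
    then show "extension (Poly_Mapping.single k c) \<in> E \<and>
        extension (T x (Poly_Mapping.single k c)) = act' x (extension (Poly_Mapping.single k c))"
      using e x k(2) free_algebra_closed(8)[OF x]
      by (simp del: free_scale_single add: E.act_scale_right E.M.subspace_scale[OF E.subspace_E]
          A.U_mult E.uea_act_cls free_algebra_closed \<psi>_closed E.free_act_mult E.free_act_letter)
  qed (simp_all add: 0 E.act_add_right[OF x] E.M.subspace_0[OF E.subspace_E]
      E.M.subspace_add[OF E.subspace_E])
  then show ?thesis by blast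
qed

end

section \<open>The Killing form\<close>

context vector_space
begin

text \<open>The basis chosen in \<open>endo_trace\<close> is the same for all maps, so identities
  between traces can be checked in it.\<close>

lemma endo_trace_basis:
  assumes "\<exists>B. finite B \<and> span B = UNIV"
  obtains B where "finite B" "independent B" "span B = UNIV"
    "\<And>f. endo_trace f = (\<Sum>b\<in>B. representation B (f b) b)"
proof -
  obtain T where T: "finite T" "span T = UNIV" using assms by blast
  obtain C where "independent C" "UNIV \<subseteq> span C"
    using maximal_independent_subset[of UNIV] by blast
  then have "\<exists>B. independent B \<and> span B = UNIV" by blast
  from someI_ex[OF this] have B: "independent (SOME B. independent B \<and> span B = UNIV)"
    "span (SOME B. independent B \<and> span B = UNIV) = UNIV"
    by blast+
  moreover have "finite (SOME B. independent B \<and> span B = UNIV)"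
    using independent_span_bound[OF T(1) B(1)] T(2) by simp
  ultimately show ?thesis
    by (intro that) (auto simp: endo_trace_def Let_def)
qed

lemma endo_trace_commute:
  assumes fd: "\<exists>B. finite B \<and> span B = UNIV"
    and f: "Vector_Spaces.linear scale scale f" and g: "Vector_Spaces.linear scale scale g"
  shows "endo_trace (\<lambda>x. f (g x)) = endo_trace (\<lambda>x. g (f x))"
proof -
  obtain B where B: "finite B" "independent B" "span B = UNIV"
    and tr: "\<And>f. endo_trace f = (\<Sum>b\<in>B. representation B (f b) b)"
    by (rule endo_trace_basis[OF fd]) blast
  have expand: "representation B (f (g b)) b =
      (\<Sum>c\<in>B. representation B (g b) c * representation B (f c) b)"
    if f: "Vector_Spaces.linear scale scale f" for f g b
  proof -
    interpret f: Vector_Spaces.linear scale scale f by (rule f)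
    have "f (g b) = f (\<Sum>c\<in>B. scale (representation B (g b) c) c)"
      using sum_representation_eq[OF B(2), of "g b" B] B by simp
    also have "\<dots> = (\<Sum>c\<in>B. scale (representation B (g b) c) (f c))"
      by (simp add: f.sum f.scale)
    finally show ?thesis
      using B by (simp add: representation_sum representation_scale)
  qed
  show ?thesis
    unfolding tr expand[OF f, of g] expand[OF g, of f]
    by (subst sum.swap) (simp add: mult.commute)
qed

lemma endo_trace_add:
  assumes fd: "\<exists>B. finite B \<and> span B = UNIV"
  shows "endo_trace (\<lambda>x. f x + g x) = endo_trace f + endo_trace g"
    and "endo_trace (\<lambda>x. f x - g x) = endo_trace f - endo_trace g"
    and "endo_trace (\<lambda>x. scale c (f x)) = c * endo_trace f"
proof -
  obtain B where B: "finite B" "independent B" "span B = UNIV"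
    and tr: "\<And>f. endo_trace f = (\<Sum>b\<in>B. representation B (f b) b)"
    by (rule endo_trace_basis[OF fd]) blast
  show "endo_trace (\<lambda>x. f x + g x) = endo_trace f + endo_trace g"
    "endo_trace (\<lambda>x. f x - g x) = endo_trace f - endo_trace g"
    "endo_trace (\<lambda>x. scale c (f x)) = c * endo_trace f"
    using B by (simp_all add: tr representation_add representation_diff representation_scale
        sum.distrib sum_subtractf sum_distrib_left)
qed

end

context lie_algebra
begin

lemma bracket_simps:
  "bracket (x + y) z = bracket x z + bracket y z" "bracket x (y + z) = bracket x y + bracket x z"
  "bracket (x - y) z = bracket x z - bracket y z" "bracket x (y - z) = bracket x y - bracket x z"
  "bracket (scale c x) y = scale c (bracket x y)" "bracket x (scale c y) = scale c (bracket x y)"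
  "bracket 0 y = 0" "bracket x 0 = 0" "bracket x (- y) = - bracket x y"
proof -
  interpret l: Vector_Spaces.linear scale scale "\<lambda>x. bracket x u" for u by (rule bracket_linear_left)
  interpret r: Vector_Spaces.linear scale scale "bracket u" for u by (rule bracket_linear_right)
  show "bracket (x + y) z = bracket x z + bracket y z" "bracket (x - y) z = bracket x z - bracket y z"
    "bracket (scale c x) y = scale c (bracket x y)" "bracket 0 y = 0"
    by (rule l.add l.diff l.scale l.zero)+
  show "bracket x (y + z) = bracket x y + bracket x z" "bracket x (y - z) = bracket x y - bracket x z"
    "bracket x (scale c y) = scale c (bracket x y)" "bracket x 0 = 0" "bracket x (- y) = - bracket x y"
    by (rule r.add r.diff r.scale r.zero r.neg)+
qed

lemma bracket_commute: "bracket y x = - bracket x y"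
proof -
  have "bracket y x + bracket x y = 0"
    using bracket_self[of "x + y"] unfolding bracket_simps
    by (simp add: bracket_self add.commute)
  then show ?thesis by (simp only: eq_neg_iff_add_eq_0)
qed

lemma bracket_bracket: "bracket (bracket x y) z = bracket x (bracket y z) - bracket y (bracket x z)"
proof -
  have "bracket (bracket x y) z = - bracket z (bracket x y)" by (rule bracket_commute)
  also have "\<dots> = bracket x (bracket y z) + bracket y (bracket z x)"
    by (rule minus_unique) (use bracket_jacobi[of x y z] in \<open>simp add: add.commute\<close>)
  also have "bracket z x = - bracket x z" by (rule bracket_commute)
  finally show ?thesis by (simp add: bracket_simps)
qed

end

context simple_lie_algebra
begin

lemma linear_bracket_bracket: "Vector_Spaces.linear scale scale (\<lambda>z. bracket x (bracket y z))"
  by unfold_locales (simp_all add: bracket_simps)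

lemma killing_form_simps:
  "killing_form (x + y) z = killing_form x z + killing_form y z"
  "killing_form x (y + z) = killing_form x y + killing_form x z"
  "killing_form (scale c x) y = c * killing_form x y"
  "killing_form x (scale c y) = c * killing_form x y"
  by (simp_all add: killing_form_def bracket_simps endo_trace_add[OF finite_dimensional])

text \<open>ad [x, y] is a commutator and the trace is cyclic, here for ad y and (ad x)(ad
  z).\<close>

lemma killing_form_invariant: "killing_form (bracket x y) z = killing_form x (bracket y z)"
proof -
  have "endo_trace (\<lambda>w. bracket y (bracket x (bracket z w))) =
      endo_trace (\<lambda>w. bracket x (bracket z (bracket y w)))"
    by (rule endo_trace_commute[OF finite_dimensional bracket_linear_right linear_bracket_bracket])
  then show ?thesis
    by (simp add: killing_form_def bracket_bracket bracket_simps endo_trace_add[OF finite_dimensional])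
qed

text \<open>ad (f x) is the conjugate of ad x by f, and the trace is invariant under
  conjugation.\<close>

lemma killing_form_automorphism:
  assumes "lie_automorphism f"
  shows "killing_form (f x) (f y) = killing_form x y"
proof -
  have f: "Vector_Spaces.linear scale scale f" "bij f" "\<And>x y. f (bracket x y) = bracket (f x) (f y)"
    using assms by (auto simp: lie_automorphism_def)
  interpret f: Vector_Spaces.linear scale scale f by (rule f)
  have inv: "f (inv_into UNIV f z) = z" "inv_into UNIV f (f z) = z" for z
    using f(2) by (auto simp: bij_is_surj surj_f_inv_f bij_is_inj)
  have linv: "Vector_Spaces.linear scale scale (inv_into UNIV f)"
  proof unfold_locales
    show "inv_into UNIV f (a + b) = inv_into UNIV f a + inv_into UNIV f b" for a b
      by (rule injD[OF bij_is_inj[OF f(2)]]) (simp add: inv f.add)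
    show "inv_into UNIV f (scale c a) = scale c (inv_into UNIV f a)" for c a
      by (rule injD[OF bij_is_inj[OF f(2)]]) (simp add: inv f.scale)
  qed
  have lin: "Vector_Spaces.linear scale scale (\<lambda>z. bracket x (bracket y (inv_into UNIV f z)))"
  proof -
    interpret g: Vector_Spaces.linear scale scale "inv_into UNIV f" by (rule linv)
    show ?thesis by unfold_locales (simp_all add: bracket_simps g.add g.scale)
  qed
  have "killing_form (f x) (f y) = endo_trace (\<lambda>z. f (bracket x (bracket y (inv_into UNIV f z))))"
    by (simp add: killing_form_def f(3) inv)
  also have "\<dots> = endo_trace (\<lambda>z. bracket x (bracket y (inv_into UNIV f (f z))))"
    by (rule endo_trace_commute[OF finite_dimensional f(1) lin])
  finally show ?thesis by (simp add: killing_form_def inv)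
qed

end

section \<open>Simultaneous eigenspaces of commuting automorphisms of finite order\<close>

definition zeta :: "nat \<Rightarrow> complex" where
  "zeta n = exp (2 * of_real pi * \<i> / of_nat n)"

lemma zeta_nonzero [simp]: "zeta n \<noteq> 0"
  by (simp add: zeta_def)

lemma zeta_powi_eq_1:
  assumes "0 < n"
  shows "zeta n powi d = 1 \<longleftrightarrow> int n dvd d"
proof -
  have "zeta n powi d = exp (of_int d * (2 * of_real pi * \<i> / of_nat n))"
    unfolding zeta_def by (rule exp_power_int[symmetric, symmetric])
  also have "\<dots> = 1 \<longleftrightarrow> (\<exists>k::int. of_int d * (2 * pi / of_nat n) = of_int (2 * k) * pi)"
    by (simp add: exp_eq_1)
  also have "\<dots> \<longleftrightarrow> (\<exists>k. d = int n * k)"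
  proof -
    have "of_int d * (2 * pi / of_nat n) = of_int (2 * k) * pi \<longleftrightarrow> d = int n * k" for k
    proof -
      have "of_int d * (2 * pi / of_nat n) = of_int (2 * k) * pi \<longleftrightarrow>
          real_of_int d = real_of_int (int n * k)"
        using assms by (simp add: field_simps)
      then show ?thesis by linarith
    qed
    then show ?thesis by simp
  qed
  finally show ?thesis by (simp add: dvd_def)
qed

lemma zeta_geometric_sum:
  assumes "0 < n"
  shows "(\<Sum>s<n. zeta n powi (d * int s)) = (if int n dvd d then of_nat n else 0)"
proof -
  let ?z = "zeta n powi d"
  have pow: "zeta n powi (d * int s) = ?z ^ s" for s
    by (simp add: power_int_mult)
  show ?thesis
  proof (cases "int n dvd d")
    case True
    then have "?z = 1" using assms by (simp add: zeta_powi_eq_1)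
    then show ?thesis using True by (simp add: pow)
  next
    case False
    have "?z ^ n = 1" using zeta_powi_eq_1[OF assms, of "d * int n"] by (simp add: pow[symmetric])
    then show ?thesis
      using False assms by (simp add: pow zeta_powi_eq_1 geometric_sum)
  qed
qed

context complex_vector_space
begin

text \<open>\<open>P j\<close> averages zeta^(-j s) \<tau>^s over s: the projection to the
  eigenspace of zeta^j. Since it commutes with everything that commutes with \<tau>, the projections
  of several automorphisms can be composed.\<close>

lemma cyclic_projection:
  assumes \<tau>: "Vector_Spaces.linear sm sm \<tau>" and n: "\<tau> ^^ n = id" "0 < n"
  obtains P :: "int \<Rightarrow> 'm \<Rightarrow> 'm" where
    "\<And>j. Vector_Spaces.linear sm sm (P j)"
    "\<And>j a. \<tau> (P j a) = sm (zeta n powi j) (P j a)"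
    "\<And>j k a. \<tau> a = sm (zeta n powi k) a \<Longrightarrow> P j a = (if int n dvd k - j then a else 0)"
    "\<And>j \<rho> a. Vector_Spaces.linear sm sm \<rho> \<Longrightarrow> (\<And>x. \<rho> (\<tau> x) = \<tau> (\<rho> x)) \<Longrightarrow> \<rho> (P j a) = P j (\<rho> a)"
    "\<And>a. (\<Sum>j<n. P (int j) a) = a"
proof -
  interpret \<tau>: Vector_Spaces.linear sm sm \<tau> by (rule \<tau>)
  define g where "g = (\<lambda>j a s. sm (zeta n powi (- (j * int s))) ((\<tau> ^^ s) a))"
  define P where "P = (\<lambda>j a. sm (1 / of_nat n) (\<Sum>s<n. g j a s))"
  have pow_add: "(\<tau> ^^ s) (a + b) = (\<tau> ^^ s) a + (\<tau> ^^ s) b" for s a b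
    by (induction s) (simp_all add: \<tau>.add)
  have pow_scale: "(\<tau> ^^ s) (sm c a) = sm c ((\<tau> ^^ s) a)" for s a c
    by (induction s) (simp_all add: \<tau>.scale)
  show ?thesis
  proof
    show "Vector_Spaces.linear sm sm (P j)" for j
      by unfold_locales (simp_all add: P_def g_def pow_add pow_scale scale_right_distrib sum.distrib
          scale_sum_right mult.commute)
    show "\<tau> (P j a) = sm (zeta n powi j) (P j a)" for j a
    proof -
      have "\<tau> (g j a s) = sm (zeta n powi j) (g j a (Suc s))" for s
        by (simp add: g_def \<tau>.scale power_int_add[symmetric] algebra_simps)
      then have "\<tau> (P j a) = sm (1 / of_nat n) (sm (zeta n powi j) (\<Sum>s<n. g j a (Suc s)))"
        by (simp add: P_def \<tau>.scale \<tau>.sum scale_sum_right)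
      also have "(\<Sum>s<n. g j a (Suc s)) = (\<Sum>s<n. g j a s)"
      proof -
        \<comment> \<open>The summand has period n in s, so shifting s by one does not change the
          sum.\<close>
        have "zeta n powi (- (j * int n)) = 1" using zeta_powi_eq_1[OF n(2)] by simp
        then have "g j a n = g j a 0" by (simp add: g_def n(1))
        moreover have "g j a 0 + (\<Sum>s<n. g j a (Suc s)) = (\<Sum>s<n. g j a s) + g j a n"
          using sum.lessThan_Suc[of "g j a" n] sum.lessThan_Suc_shift[of "g j a" n] by simp
        ultimately show ?thesis by simp
      qed
      finally show ?thesis by (simp add: P_def mult.commute)
    qed
    show "P j a = (if int n dvd k - j then a else 0)" if a: "\<tau> a = sm (zeta n powi k) a" for j k a
    proof -
      have "(\<tau> ^^ s) a = sm (zeta n powi (k * int s)) a" for s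
        by (induction s) (simp_all add: a \<tau>.scale power_int_add[symmetric] algebra_simps)
      then have "g j a s = sm (zeta n powi ((k - j) * int s)) a" for s
        by (simp add: g_def power_int_add[symmetric] algebra_simps)
      then have "P j a = sm (1 / of_nat n * (\<Sum>s<n. zeta n powi ((k - j) * int s))) a"
        by (simp add: P_def scale_sum_left[symmetric])
      then show ?thesis using n(2) by (simp add: zeta_geometric_sum)
    qed
    show "\<rho> (P j a) = P j (\<rho> a)"
      if \<rho>: "Vector_Spaces.linear sm sm \<rho>" and c: "\<And>x. \<rho> (\<tau> x) = \<tau> (\<rho> x)" for j \<rho> a
    proof -
      interpret \<rho>: Vector_Spaces.linear sm sm \<rho> by (rule \<rho>)
      have "\<rho> ((\<tau> ^^ s) a) = (\<tau> ^^ s) (\<rho> a)" for s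
        by (induction s) (simp_all add: c)
      then show ?thesis by (simp add: P_def g_def \<rho>.scale \<rho>.sum)
    qed
    show "(\<Sum>j<n. P (int j) a) = a" for a
    proof -
      have "(\<Sum>j<n. P (int j) a) = sm (1 / of_nat n) (\<Sum>s<n. \<Sum>j<n. g (int j) a s)"
        unfolding P_def scale_sum_right[symmetric] by (subst sum.swap) simp
      also have "(\<Sum>s<n. \<Sum>j<n. g (int j) a s) = (\<Sum>s<n. if s = 0 then sm (of_nat n) a else 0)"
      proof (rule sum.cong)
        fix s assume s: "s \<in> {..<n}"
        have "(\<Sum>j<n. g (int j) a s) = sm (\<Sum>j<n. zeta n powi ((- int s) * int j)) ((\<tau> ^^ s) a)"
          unfolding scale_sum_left by (simp add: g_def mult.commute)
        moreover have "int n dvd - int s \<longleftrightarrow> s = 0"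
          using s by (auto dest: zdvd_imp_le)
        then have "(\<Sum>j<n. zeta n powi ((- int s) * int j)) = (if s = 0 then of_nat n else 0)"
          unfolding zeta_geometric_sum[OF n(2)] by simp
        ultimately show "(\<Sum>j<n. g (int j) a s) = (if s = 0 then sm (of_nat n) a else 0)"
          by simp
      qed simp
      also have "\<dots> = sm (of_nat n) a" using n(2) by (simp add: sum.delta)
      finally show ?thesis using n(2) by simp
    qed
  qed
qed

text \<open>One automorphism is added at a time. Its eigenprojections commute with the other
  automorphisms, hence preserve their eigenvectors; and each vector is the sum of its
  eigencomponents, which gives the span clause.\<close>

lemma joint_projection:
  fixes \<sigma> :: "'r \<Rightarrow> 'm \<Rightarrow> 'm"
  assumes "finite I"
    and lin: "\<And>i. Vector_Spaces.linear sm sm (\<sigma> i)" and ord: "\<And>i. \<sigma> i ^^ N i = id" "\<And>i. 0 < N i"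
    and comm: "\<And>i j x. \<sigma> i (\<sigma> j x) = \<sigma> j (\<sigma> i x)"
  shows "\<exists>\<pi> :: ('r \<Rightarrow> int) \<Rightarrow> 'm \<Rightarrow> 'm.
    (\<forall>m. Vector_Spaces.linear sm sm (\<pi> m)) \<and>
    (\<forall>m a. \<forall>i\<in>I. \<sigma> i (\<pi> m a) = sm (zeta (N i) powi m i) (\<pi> m a)) \<and>
    (\<forall>k m a. (\<forall>i\<in>I. \<sigma> i a = sm (zeta (N i) powi k i) a) \<longrightarrow>
      \<pi> m a = (if \<forall>i\<in>I. int (N i) dvd k i - m i then a else 0)) \<and>
    (\<forall>m \<rho> a. Vector_Spaces.linear sm sm \<rho> \<longrightarrow> (\<forall>i x. \<rho> (\<sigma> i x) = \<sigma> i (\<rho> x)) \<longrightarrow>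
      \<rho> (\<pi> m a) = \<pi> m (\<rho> a)) \<and>
    (\<forall>a. a \<in> span {b. \<exists>k. \<forall>i\<in>I. \<sigma> i b = sm (zeta (N i) powi k i) b})"
  using \<open>finite I\<close>
proof induction
  case empty
  have "Vector_Spaces.linear sm sm (\<lambda>x. x)" by unfold_locales auto
  then show ?case by (intro exI[of _ "\<lambda>m a. a"]) simp
next
  case (insert i I)
  obtain \<pi> where \<pi>: "\<And>m. Vector_Spaces.linear sm sm (\<pi> m)"
    "\<And>m a j. j \<in> I \<Longrightarrow> \<sigma> j (\<pi> m a) = sm (zeta (N j) powi m j) (\<pi> m a)"
    "\<And>k m a. (\<And>j. j \<in> I \<Longrightarrow> \<sigma> j a = sm (zeta (N j) powi k j) a) \<Longrightarrow>
      \<pi> m a = (if \<forall>j\<in>I. int (N j) dvd k j - m j then a else 0)"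
    "\<And>m \<rho> a. Vector_Spaces.linear sm sm \<rho> \<Longrightarrow> (\<And>j x. \<rho> (\<sigma> j x) = \<sigma> j (\<rho> x)) \<Longrightarrow> \<rho> (\<pi> m a) = \<pi> m (\<rho> a)"
    "\<And>a. a \<in> span {b. \<exists>k. \<forall>j\<in>I. \<sigma> j b = sm (zeta (N j) powi k j) b}"
    using insert.IH by (elim exE conjE) blast
  obtain P :: "int \<Rightarrow> 'm \<Rightarrow> 'm" where P: "\<And>j. Vector_Spaces.linear sm sm (P j)"
    "\<And>j a. \<sigma> i (P j a) = sm (zeta (N i) powi j) (P j a)"
    "\<And>j k a. \<sigma> i a = sm (zeta (N i) powi k) a \<Longrightarrow> P j a = (if int (N i) dvd k - j then a else 0)"
    "\<And>j \<rho> a. Vector_Spaces.linear sm sm \<rho> \<Longrightarrow> (\<And>x. \<rho> (\<sigma> i x) = \<sigma> i (\<rho> x)) \<Longrightarrow> \<rho> (P j a) = P j (\<rho> a)"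
    "\<And>a. (\<Sum>j<N i. P (int j) a) = a"
    by (rule cyclic_projection[OF lin[of i] ord(1)[of i] ord(2)[of i]]) blast
  have P\<sigma>: "\<sigma> j (P l a) = P l (\<sigma> j a)" for j l a
    using P(4)[OF lin[of j]] comm by blast
  show ?case
  proof (intro exI[of _ "\<lambda>m a. P (m i) (\<pi> m a)"] conjI allI ballI impI)
    fix m
    interpret P: Vector_Spaces.linear sm sm "P l" for l by (rule P(1))
    interpret \<pi>: Vector_Spaces.linear sm sm "\<pi> m" by (rule \<pi>(1))
    show "Vector_Spaces.linear sm sm (\<lambda>a. P (m i) (\<pi> m a))"
      by unfold_locales (simp_all add: P.add P.scale \<pi>.add \<pi>.scale)
    show "\<sigma> j (P (m i) (\<pi> m a)) = sm (zeta (N j) powi m j) (P (m i) (\<pi> m a))"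
      if "j \<in> insert i I" for j a
    proof (cases "j = i")
      case False
      then show ?thesis using that by (simp add: P\<sigma> \<pi>(2) P.scale)
    qed (simp add: P(2))
    show "P (m i) (\<pi> m a) = (if \<forall>j\<in>insert i I. int (N j) dvd k j - m j then a else 0)"
      if a: "\<forall>j\<in>insert i I. \<sigma> j a = sm (zeta (N j) powi k j) a" for k a
      using \<pi>(3)[of a k m] P(3)[of a "k i" "m i"] a by (simp add: P.zero)
  next
    fix m \<rho> a
    assume \<rho>: "Vector_Spaces.linear sm sm \<rho>" "\<forall>i x. \<rho> (\<sigma> i x) = \<sigma> i (\<rho> x)"
    then show "\<rho> (P (m i) (\<pi> m a)) = P (m i) (\<pi> m (\<rho> a))"
      using P(4)[OF \<rho>(1)] \<pi>(4)[OF \<rho>(1)] by simp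
  next
    fix a
    let ?H = "{b. \<exists>k. \<forall>j\<in>insert i I. \<sigma> j b = sm (zeta (N j) powi k j) b}"
    have "{b. \<exists>k. \<forall>j\<in>I. \<sigma> j b = sm (zeta (N j) powi k j) b} \<subseteq> span ?H"
    proof
      fix b assume "b \<in> {b. \<exists>k. \<forall>j\<in>I. \<sigma> j b = sm (zeta (N j) powi k j) b}"
      then obtain k where k: "\<And>j. j \<in> I \<Longrightarrow> \<sigma> j b = sm (zeta (N j) powi k j) b" by blast
      have "P l b \<in> ?H" for l
      proof -
        interpret P: Vector_Spaces.linear sm sm "P l" by (rule P(1))
        have "\<forall>j\<in>insert i I. \<sigma> j (P l b) = sm (zeta (N j) powi (k(i := l)) j) (P l b)"
        proof
          fix j assume j: "j \<in> insert i I"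
          show "\<sigma> j (P l b) = sm (zeta (N j) powi (k(i := l)) j) (P l b)"
          proof (cases "j = i")
            case False
            then show ?thesis using j k by (simp add: P\<sigma> P.scale)
          qed (simp add: P(2))
        qed
        then show ?thesis by blast
      qed
      then have "(\<Sum>j<N i. P (int j) b) \<in> span ?H"
        by (intro span_sum span_base)
      then show "b \<in> span ?H" by (simp add: P(5))
    qed
    then have "span {b. \<exists>k. \<forall>j\<in>I. \<sigma> j b = sm (zeta (N j) powi k j) b} \<subseteq> span ?H"
      by (intro span_minimal subspace_span)
    then show "a \<in> span ?H" using \<pi>(5)[of a] by blast
  qed
qed

end

section \<open>The toroidal Lie algebra\<close>

lemma lattice_coset_iff:
  fixes N :: "'r :: finite \<Rightarrow> nat"
  assumes "\<And>i. 0 < N i"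
  shows "m \<in> lattice_coset N k \<longleftrightarrow> (\<forall>i. int (N i) dvd k $ i - m $ i)"
proof
  assume "m \<in> lattice_coset N k"
  then obtain l where "\<And>i. m $ i = k $ i + l $ i * int (N i)" unfolding lattice_coset_def by blast
  then show "\<forall>i. int (N i) dvd k $ i - m $ i" by simp
next
  assume *: "\<forall>i. int (N i) dvd k $ i - m $ i"
  have "m $ i = k $ i + (\<chi> i. (m $ i - k $ i) div int (N i)) $ i * int (N i)" for i
    using * by (simp add: dvd_diff_commute)
  then show "m \<in> lattice_coset N k" unfolding lattice_coset_def by blast
qed

locale toroidal_setting = simple_lie_algebra scl bracket
  for scl :: "complex \<Rightarrow> 'g :: ab_group_add \<Rightarrow> 'g" and bracket +
  fixes \<kappa> :: "'g \<Rightarrow> 'g \<Rightarrow> complex" and \<sigma> :: "'r :: finite \<Rightarrow> 'g \<Rightarrow> 'g" and N :: "'r \<Rightarrow> nat"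
    and lvl :: complex
  assumes kappa: "\<exists>c. \<kappa> = (\<lambda>x y. c * killing_form x y)"
    and aut: "\<And>i. lie_automorphism (\<sigma> i)" and order: "\<And>i. has_order (\<sigma> i) (N i)"
    and commute: "\<And>i j. \<sigma> i \<circ> \<sigma> j = \<sigma> j \<circ> \<sigma> i"
begin

sublocale complex_vector_space scl
  by unfold_locales

abbreviation "gr \<equiv> grading_space scl \<sigma> N"

lemma kappa_simps:
  "\<kappa> (x + y) z = \<kappa> x z + \<kappa> y z" "\<kappa> x (y + z) = \<kappa> x y + \<kappa> x z"
  "\<kappa> (scl c x) y = c * \<kappa> x y" "\<kappa> x (scl c y) = c * \<kappa> x y" "\<kappa> 0 y = 0" "\<kappa> x 0 = 0"
proof -
  obtain d where d: "\<kappa> = (\<lambda>x y. d * killing_form x y)" using kappa by blast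
  show "\<kappa> (x + y) z = \<kappa> x z + \<kappa> y z" "\<kappa> x (y + z) = \<kappa> x y + \<kappa> x z"
    "\<kappa> (scl c x) y = c * \<kappa> x y" "\<kappa> x (scl c y) = c * \<kappa> x y"
    by (simp_all add: d killing_form_simps algebra_simps)
  show "\<kappa> 0 y = 0" "\<kappa> x 0 = 0"
    using killing_form_simps(3)[of 0 0 y] killing_form_simps(4)[of x 0 0] by (simp_all add: d)
qed

lemma kappa_invariant: "\<kappa> (bracket x y) z = \<kappa> x (bracket y z)"
  using kappa killing_form_invariant by force

lemma kappa_sigma: "\<kappa> (\<sigma> i x) (\<sigma> i y) = \<kappa> x y"
  using kappa killing_form_automorphism[OF aut] by force

lemma sigma_linear: "Vector_Spaces.linear scl scl (\<sigma> i)"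
  using aut[of i] by (simp add: lie_automorphism_def)

lemma sigma_bracket: "\<sigma> i (bracket x y) = bracket (\<sigma> i x) (\<sigma> i y)"
  using aut[of i] by (simp add: lie_automorphism_def)

lemma N_pos: "0 < N i"
  using order[of i] by (simp add: has_order_def)

lemma mem_gr: "a \<in> gr m \<longleftrightarrow> (\<forall>i. \<sigma> i a = scl (zeta (N i) powi (m $ i)) a)"
  by (simp add: grading_space_def zeta_def)

lemma subspace_gr: "subspace (gr m)"
  unfolding subspace_def
proof (intro conjI ballI allI)
  interpret \<sigma>: Vector_Spaces.linear scl scl "\<sigma> i" for i by (rule sigma_linear)
  show "0 \<in> gr m" by (simp add: mem_gr \<sigma>.zero)
  show "x + y \<in> gr m" if "x \<in> gr m" "y \<in> gr m" for x y
    using that by (simp add: mem_gr \<sigma>.add scale_right_distrib)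
  show "scl c x \<in> gr m" if "x \<in> gr m" for c x
    using that by (simp add: mem_gr \<sigma>.scale mult.commute)
qed

lemma bracket_gr: "a \<in> gr p \<Longrightarrow> b \<in> gr q \<Longrightarrow> bracket a b \<in> gr (p + q)"
  by (simp add: mem_gr sigma_bracket bracket_simps power_int_add mult.commute)

lemma projections:
  "\<exists>\<pi> :: int ^ 'r \<Rightarrow> 'g \<Rightarrow> 'g. (\<forall>m. Vector_Spaces.linear scl scl (\<pi> m)) \<and> (\<forall>m a. \<pi> m a \<in> gr m) \<and>
    (\<forall>k m. \<forall>a\<in>gr k. \<pi> m a = (if m \<in> lattice_coset N k then a else 0)) \<and> span (\<Union>k. gr k) = UNIV"
proof -
  have comm: "\<sigma> i (\<sigma> j x) = \<sigma> j (\<sigma> i x)" for i j x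
    using fun_cong[OF commute[of i j], of x] by simp
  have ord: "\<sigma> i ^^ N i = id" for i
    using order[of i] by (simp add: has_order_def)
  obtain \<pi> :: "('r \<Rightarrow> int) \<Rightarrow> 'g \<Rightarrow> 'g" where \<pi>: "\<And>m. Vector_Spaces.linear scl scl (\<pi> m)"
    "\<And>m a i. \<sigma> i (\<pi> m a) = scl (zeta (N i) powi m i) (\<pi> m a)"
    "\<And>k m a. (\<And>i. \<sigma> i a = scl (zeta (N i) powi k i) a) \<Longrightarrow>
      \<pi> m a = (if \<forall>i. int (N i) dvd k i - m i then a else 0)"
    "\<And>a. a \<in> span {b. \<exists>k. \<forall>i. \<sigma> i b = scl (zeta (N i) powi k i) b}"
    using joint_projection[of UNIV \<sigma> N, OF finite[of UNIV] sigma_linear ord N_pos comm, unfolded ball_UNIV]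
    by (elim exE conjE) (rule that, blast+)
  have "{b. \<exists>k. \<forall>i. \<sigma> i b = scl (zeta (N i) powi k i) b} \<subseteq> (\<Union>k. gr k)"
  proof
    fix b assume "b \<in> {b. \<exists>k. \<forall>i. \<sigma> i b = scl (zeta (N i) powi k i) b}"
    then obtain k where "\<forall>i. \<sigma> i b = scl (zeta (N i) powi k i) b" by blast
    then have "b \<in> gr (\<chi> i. k i)" by (simp add: mem_gr)
    then show "b \<in> (\<Union>k. gr k)" by blast
  qed
  then have "span (\<Union>k. gr k) = UNIV" using \<pi>(4) span_mono by blast
  moreover have "\<pi> (($) m) a = (if m \<in> lattice_coset N k then a else 0)" if "a \<in> gr k" for k m a
    using \<pi>(3)[of a "($) k" "($) m"] that by (simp add: mem_gr lattice_coset_iff[OF N_pos])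
  ultimately show ?thesis
    using \<pi>(1,2) by (intro exI[of _ "\<lambda>m. \<pi> (($) m)"]) (simp add: mem_gr)
qed

text \<open>The component of degree m in the grading of g by residues modulo N. By
  \<open>a_L_eq\<close> it is the vector that the current of a carries at index m.\<close>

definition proj :: "int ^ 'r \<Rightarrow> 'g \<Rightarrow> 'g" where
  "proj = (SOME \<pi>. (\<forall>m. Vector_Spaces.linear scl scl (\<pi> m)) \<and> (\<forall>m a. \<pi> m a \<in> gr m) \<and>
    (\<forall>k m. \<forall>a\<in>gr k. \<pi> m a = (if m \<in> lattice_coset N k then a else 0)) \<and> span (\<Union>k. gr k) = UNIV)"

lemma proj_linear: "Vector_Spaces.linear scl scl (proj m)"
  and proj_mem: "proj m a \<in> gr m"
  and proj_gr: "a \<in> gr k \<Longrightarrow> proj m a = (if m \<in> lattice_coset N k then a else 0)"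
  and span_gr: "span (\<Union>k. gr k) = UNIV"
  using someI_ex[OF projections] unfolding proj_def[symmetric] by blast+

lemma proj_simps:
  "proj m (a + b) = proj m a + proj m b" "proj m (scl c a) = scl c (proj m a)" "proj m 0 = 0"
proof -
  interpret Vector_Spaces.linear scl scl "proj m" by (rule proj_linear)
  show "proj m (a + b) = proj m a + proj m b" "proj m (scl c a) = scl c (proj m a)" "proj m 0 = 0"
    by (rule add scale zero)+
qed

lemma proj_gr_same: "a \<in> gr m \<Longrightarrow> proj m a = a"
  using proj_gr[of a m m] by (simp add: lattice_coset_iff[OF N_pos])

lemma homogeneous_induct:
  assumes "subspace {a. P a}" "\<And>k a. a \<in> gr k \<Longrightarrow> P a"
  shows "P a"
proof -
  have "a \<in> span (\<Union>k. gr k)" by (simp add: span_gr)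
  then show ?thesis
    by (induction rule: span_induct) (use assms in auto)
qed

lemma proj_bracket:
  assumes a: "a \<in> gr p"
  shows "proj (p + q) (bracket a b) = bracket a (proj q b)"
proof (rule homogeneous_induct[where P = "\<lambda>b. proj (p + q) (bracket a b) = bracket a (proj q b)"])
  show "subspace {b. proj (p + q) (bracket a b) = bracket a (proj q b)}"
    by (simp add: subspace_def proj_simps bracket_simps)
  show "proj (p + q) (bracket a b) = bracket a (proj q b)" if b: "b \<in> gr k" for k b
    using proj_gr[OF b, of q] proj_gr[OF bracket_gr[OF a b], of "p + q"]
    by (simp add: lattice_coset_iff[OF N_pos] bracket_simps)
qed

text \<open>Invariance under a suitable \<open>\<sigma> i\<close> multiplies the value of the form
  by a root of unity different from 1.\<close>

lemma kappa_gr_zero: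
  assumes a: "a \<in> gr p" and b: "b \<in> gr k" and "- p \<notin> lattice_coset N k"
  shows "\<kappa> a b = 0"
proof -
  obtain i where i: "\<not> int (N i) dvd k $ i + p $ i"
    using assms(3) by (auto simp: lattice_coset_iff[OF N_pos])
  have "\<kappa> a b = \<kappa> (\<sigma> i a) (\<sigma> i b)" by (rule kappa_sigma[symmetric])
  also have "\<dots> = zeta (N i) powi (k $ i + p $ i) * \<kappa> a b"
    using a b by (simp add: mem_gr kappa_simps power_int_add)
  finally show ?thesis using i zeta_powi_eq_1[OF N_pos] by auto
qed

text \<open>Only the component of \<open>b\<close> of degree -p pairs with \<open>a\<close>. Hence
  the central term of a commutator of modes can be written with \<open>b\<close> itself.\<close>

lemma kappa_proj:
  assumes a: "a \<in> gr p"
  shows "\<kappa> a (proj (- p) b) = \<kappa> a b"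
proof (rule homogeneous_induct[where P = "\<lambda>b. \<kappa> a (proj (- p) b) = \<kappa> a b"])
  show "subspace {b. \<kappa> a (proj (- p) b) = \<kappa> a b}"
    by (simp add: subspace_def proj_simps kappa_simps)
  show "\<kappa> a (proj (- p) b) = \<kappa> a b" if b: "b \<in> gr k" for k b
    using proj_gr[OF b, of "- p"] kappa_gr_zero[OF a b] by (auto simp: kappa_simps)
qed

lemma lookup_map_scl: "Poly_Mapping.lookup (Poly_Mapping.map (scl c) f) k = scl c (Poly_Mapping.lookup f k)"
  by (simp add: Poly_Mapping.map.rep_eq when_def)

lemma vector_space_tor: "vector_space (tor_scale scl :: complex \<Rightarrow> ('g, 'r) toroidal \<Rightarrow> _)"
  by unfold_locales
    (auto simp: tor_scale_def prod_eq_iff lookup_map_scl lookup_add algebra_simps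
      intro!: poly_mapping_eqI)

abbreviation "tor_sc \<equiv> (tor_scale scl :: complex \<Rightarrow> ('g, 'r) toroidal \<Rightarrow> _)"
abbreviation "tor_br \<equiv> (tor_bracket bracket \<kappa> :: ('g, 'r) toroidal \<Rightarrow> _)"

lemma tor_elem_simps:
  "tor_elem (a + b) m0 m = tor_elem a m0 m + tor_elem b m0 m"
  "tor_elem (scl c a) m0 m = tor_sc c (tor_elem a m0 m)"
  "tor_elem 0 m0 m = 0"
  by (simp_all add: tor_elem_def tor_scale_def single_add zero_prod_def)

text \<open>The conditions in \<open>a_L\<close> determine the function because homogeneous vectors
  span g, and the projections provide a function that satisfies them.\<close>

lemma a_L_eq: "a_L scl \<sigma> N a m0 m = tor_elem (proj m a) m0 m"
proof -
  interpret tor: vector_space tor_sc by (rule vector_space_tor)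
  have "a_L scl \<sigma> N = (\<lambda>a m0 m. tor_elem (proj m a) m0 m)"
    unfolding a_L_def
  proof (rule the_equality)
    show "(\<forall>m0 m. Vector_Spaces.linear scl tor_sc (\<lambda>a. tor_elem (proj m a) m0 m)) \<and>
        (\<forall>k. \<forall>a\<in>gr k. \<forall>m0 m. tor_elem (proj m a) m0 m =
          (if m \<in> lattice_coset N k then tor_elem a m0 m else 0))"
    proof (intro conjI allI ballI)
      show "Vector_Spaces.linear scl tor_sc (\<lambda>a. tor_elem (proj m a) m0 m)" for m0 m
        by unfold_locales (simp_all add: proj_simps tor_elem_simps)
    qed (auto simp: proj_gr tor_elem_simps)
  next
    fix F :: "'g \<Rightarrow> int \<Rightarrow> int ^ 'r \<Rightarrow> ('g, 'r) toroidal"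
    assume F: "(\<forall>m0 m. Vector_Spaces.linear scl tor_sc (\<lambda>a. F a m0 m)) \<and>
        (\<forall>k. \<forall>a\<in>gr k. \<forall>m0 m. F a m0 m = (if m \<in> lattice_coset N k then tor_elem a m0 m else 0))"
    have "F a m0 m = tor_elem (proj m a) m0 m" for a m0 m
    proof (rule homogeneous_induct[where P = "\<lambda>a. F a m0 m = tor_elem (proj m a) m0 m"])
      interpret F: Vector_Spaces.linear scl tor_sc "\<lambda>a. F a m0 m" using F by blast
      show "subspace {a. F a m0 m = tor_elem (proj m a) m0 m}"
        by (simp add: subspace_def F.zero F.add F.scale proj_simps tor_elem_simps)
      show "F a m0 m = tor_elem (proj m a) m0 m" if "a \<in> gr k" for k a
        using F that by (simp add: proj_gr tor_elem_simps)
    qed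
    then show "F = (\<lambda>a m0 m. tor_elem (proj m a) m0 m)" by blast
  qed
  then show ?thesis by simp
qed

text \<open>The modules g + C and the space of series are both given by operators
  \<open>A p a\<close> for a in degree p, with the central element acting as
  \<open>lvl\<close>.\<close>

definition tor_act ::
  "(complex \<Rightarrow> 'm \<Rightarrow> 'm) \<Rightarrow> (int \<times> (int ^ 'r) \<Rightarrow> 'g \<Rightarrow> 'm \<Rightarrow> 'm) \<Rightarrow> ('g, 'r) toroidal \<Rightarrow> 'm \<Rightarrow> 'm :: ab_group_add"
  where "tor_act sm A x e =
    (\<Sum>p\<in>Poly_Mapping.keys (fst x). A p (Poly_Mapping.lookup (fst x) p) e) + sm (snd x * lvl) e"

text \<open>\<open>L_alg\<close> and \<open>L_nonneg\<close> are both of this form, for two choices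
  of the spaces \<open>X p\<close>.\<close>

definition tor_part :: "(int \<times> (int ^ 'r) \<Rightarrow> 'g set) \<Rightarrow> ('g, 'r) toroidal set" where
  "tor_part X = {x. \<forall>p. Poly_Mapping.lookup (fst x) p \<in> X p}"

lemma tor_br_eq: "tor_br x y =
    (\<Sum>p\<in>Poly_Mapping.keys (fst x). \<Sum>q\<in>Poly_Mapping.keys (fst y).
      (Poly_Mapping.single (p + q) (bracket (Poly_Mapping.lookup (fst x) p) (Poly_Mapping.lookup (fst y) q)),
       if p + q = 0 then of_int (fst p) * \<kappa> (Poly_Mapping.lookup (fst x) p) (Poly_Mapping.lookup (fst y) q) else 0))"
  by (simp add: tor_bracket_def Let_def)

lemma single_tor_part:
  assumes "\<And>p. subspace (X p)" "a \<in> X p"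
  shows "(Poly_Mapping.single p a, c) \<in> tor_part X"
  using assms subspace_0 by (auto simp: tor_part_def lookup_single when_def)

lemma lookup_tor_part: "x \<in> tor_part X \<Longrightarrow> Poly_Mapping.lookup (fst x) p \<in> X p"
  unfolding tor_part_def by blast

lemma add_tor_part:
  assumes "\<And>p. subspace (X p)" "x \<in> tor_part X" "y \<in> tor_part X"
  shows "x + y \<in> tor_part X"
  using assms subspace_add by (auto simp: tor_part_def lookup_add)

lemma sum_tor_part:
  assumes "\<And>p. subspace (X p)" "\<And>k. k \<in> K \<Longrightarrow> f k \<in> tor_part X"
  shows "sum f K \<in> tor_part X"
  using assms(2)
proof (induction K rule: infinite_finite_induct)
  case (insert k K)
  then show ?case using add_tor_part[OF assms(1)] by auto
qed (use assms(1) subspace_0 in \<open>auto simp: tor_part_def\<close>)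

lemma enveloping_tor_part:
  assumes X: "\<And>p. subspace (X p)"
    and br: "\<And>p q a b. a \<in> X p \<Longrightarrow> b \<in> X q \<Longrightarrow> bracket a b \<in> X (p + q)"
  shows "enveloping tor_sc tor_br (tor_part X)"
proof -
  interpret tor: vector_space tor_sc by (rule vector_space_tor)
  show ?thesis
  proof unfold_locales
    fix x y assume x: "x \<in> tor_part X" and y: "y \<in> tor_part X"
    then show "tor_br x y \<in> tor_part X"
      unfolding tor_br_eq
      by (intro sum_tor_part single_tor_part X br lookup_tor_part)
  next
    fix x y assume "x \<in> tor_part X" "y \<in> tor_part X"
    then show "x + y \<in> tor_part X" by (rule add_tor_part[OF X])
  next
    fix x c assume "x \<in> tor_part X"
    then show "tor_sc c x \<in> tor_part X"
      using subspace_scale[OF X] by (simp add: tor_part_def tor_scale_def lookup_map_scl)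
  qed
qed

text \<open>The bracket has to be checked on homogeneous elements only: both sides are sums over the
  supports, and the cocycle sits in the central coordinate.\<close>

lemma lie_representation_tor:
  fixes sm :: "complex \<Rightarrow> 'm :: ab_group_add \<Rightarrow> 'm"
  assumes X: "\<And>p. subspace (X p)"
    and br: "\<And>p q a b. a \<in> X p \<Longrightarrow> b \<in> X q \<Longrightarrow> bracket a b \<in> X (p + q)"
    and sm: "complex_vector_space sm" and E: "Modules.module.subspace sm E"
    and A_closed: "\<And>p a e. a \<in> X p \<Longrightarrow> e \<in> E \<Longrightarrow> A p a e \<in> E"
    and A_add_right: "\<And>p a e e'. a \<in> X p \<Longrightarrow> e \<in> E \<Longrightarrow> e' \<in> E \<Longrightarrow> A p a (e + e') = A p a e + A p a e'"
    and A_scale_right: "\<And>p a c e. a \<in> X p \<Longrightarrow> e \<in> E \<Longrightarrow> A p a (sm c e) = sm c (A p a e)"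
    and A_add: "\<And>p a b e. a \<in> X p \<Longrightarrow> b \<in> X p \<Longrightarrow> e \<in> E \<Longrightarrow> A p (a + b) e = A p a e + A p b e"
    and A_scale: "\<And>p a c e. a \<in> X p \<Longrightarrow> e \<in> E \<Longrightarrow> A p (scl c a) e = sm c (A p a e)"
    and A_bracket: "\<And>p q a b e. a \<in> X p \<Longrightarrow> b \<in> X q \<Longrightarrow> e \<in> E \<Longrightarrow>
      A (p + q) (bracket a b) e + sm ((if p + q = 0 then of_int (fst p) * \<kappa> a b else 0) * lvl) e =
      A p a (A q b e) - A q b (A p a e)"
  shows "lie_representation tor_sc tor_br (tor_part X) sm (tor_act sm A) E"
proof -
  interpret tor: vector_space tor_sc by (rule vector_space_tor)
  interpret M: complex_vector_space sm by (rule sm)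
  interpret env: enveloping tor_sc tor_br "tor_part X" by (rule enveloping_tor_part[of X, OF X br])
  have A0: "A p 0 e = 0" if "e \<in> E" for p e
    using A_scale[of 0 p e 0] subspace_0[OF X] that by simp
  let ?lk = "\<lambda>x. Poly_Mapping.lookup (fst x)" and ?ks = "\<lambda>x. Poly_Mapping.keys (fst x)"
  have lk: "?lk x p \<in> X p" if "x \<in> tor_part X" for x p
    using that by (rule lookup_tor_part)
  have act_add: "tor_act sm A (x + y) e = tor_act sm A x e + tor_act sm A y e"
    if x: "x \<in> tor_part X" and y: "y \<in> tor_part X" and e: "e \<in> E" for x y e
  proof -
    have "(\<Sum>p\<in>?ks (x + y). A p (?lk (x + y) p) e) =
        (\<Sum>p\<in>?ks x. A p (?lk x p) e) + (\<Sum>p\<in>?ks y. A p (?lk y p) e)"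
      unfolding fst_add
      by (rule setsum_keys_plus_distrib) (simp_all add: A0 e A_add lk x y)
    then show ?thesis by (simp add: tor_act_def algebra_simps)
  qed
  have act_0: "tor_act sm A 0 e = 0" if "e \<in> E" for e
    by (simp add: tor_act_def)
  have act_sum: "tor_act sm A (sum f K) e = (\<Sum>k\<in>K. tor_act sm A (f k) e)"
    if "\<And>k. k \<in> K \<Longrightarrow> f k \<in> tor_part X" "e \<in> E" for f :: "'k \<Rightarrow> _" and K e
    using that
    by (induction K rule: infinite_finite_induct) (auto simp: act_0 act_add sum_tor_part[OF X])
  have act_single: "tor_act sm A (Poly_Mapping.single p a, c) e = A p a e + sm (c * lvl) e"
    if "e \<in> E" for p a c e
    using that by (simp add: tor_act_def A0)
  have A_sum: "A p a (sum f K) = (\<Sum>k\<in>K. A p a (f k))"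
    if a: "a \<in> X p" and "\<And>k. k \<in> K \<Longrightarrow> f k \<in> E" for p a and f :: "'k \<Rightarrow> 'm" and K
    using that(2)
  proof (induction K rule: infinite_finite_induct)
    case (insert k K)
    then show ?case using M.subspace_sum[OF E, of K f] by (simp add: A_add_right[OF a])
  qed (use A_scale_right[OF a M.subspace_0[OF E], of 0] in auto)
  show ?thesis
  proof unfold_locales
    show "M.subspace E" by (rule E)
  next
    fix x e assume x: "x \<in> tor_part X" and e: "e \<in> E"
    show "tor_act sm A x e \<in> E"
      unfolding tor_act_def
      by (intro M.subspace_add M.subspace_sum M.subspace_scale E A_closed lk x e)
  next
    fix x e e' assume x: "x \<in> tor_part X" and e: "e \<in> E" "e' \<in> E"
    show "tor_act sm A x (e + e') = tor_act sm A x e + tor_act sm A x e'"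
      by (simp add: tor_act_def A_add_right lk x e sum.distrib M.scale_right_distrib)
  next
    fix x e c assume x: "x \<in> tor_part X" and e: "e \<in> E"
    show "tor_act sm A x (sm c e) = sm c (tor_act sm A x e)"
      by (simp add: tor_act_def A_scale_right lk x e M.scale_sum_right M.scale_right_distrib mult.commute)
  next
    fix x y e assume "x \<in> tor_part X" "y \<in> tor_part X" "e \<in> E"
    then show "tor_act sm A (x + y) e = tor_act sm A x e + tor_act sm A y e" by (rule act_add)
  next
    fix x e c assume x: "x \<in> tor_part X" and e: "e \<in> E"
    have "(\<Sum>p\<in>?ks (tor_sc c x). A p (?lk (tor_sc c x) p) e) = (\<Sum>p\<in>?ks x. A p (scl c (?lk x p)) e)"
      by (rule sum.mono_neutral_cong_left)
        (auto simp: tor_scale_def lookup_map_scl in_keys_iff A0 e)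
    then show "tor_act sm A (tor_sc c x) e = sm c (tor_act sm A x e)"
      by (simp add: tor_act_def A_scale lk x e M.scale_sum_right M.scale_right_distrib)
        (simp add: tor_scale_def mult.assoc)
  next
    fix x y e assume x: "x \<in> tor_part X" and y: "y \<in> tor_part X" and e: "e \<in> E"
    let ?a = "?lk x" and ?b = "?lk y"
    have "tor_act sm A (tor_br x y) e = (\<Sum>p\<in>?ks x. \<Sum>q\<in>?ks y. A (p + q) (bracket (?a p) (?b q)) e +
        sm ((if p + q = 0 then of_int (fst p) * \<kappa> (?a p) (?b q) else 0) * lvl) e)"
      unfolding tor_br_eq
      by (simp add: act_sum act_single e sum_tor_part[OF X] single_tor_part[OF X] br lk x y)
    also have "\<dots> = (\<Sum>p\<in>?ks x. \<Sum>q\<in>?ks y. A p (?a p) (A q (?b q) e)) -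
        (\<Sum>p\<in>?ks x. \<Sum>q\<in>?ks y. A q (?b q) (A p (?a p) e))"
      by (simp add: A_bracket lk x y e sum_subtractf)
    also have "(\<Sum>p\<in>?ks x. \<Sum>q\<in>?ks y. A q (?b q) (A p (?a p) e)) =
        (\<Sum>q\<in>?ks y. \<Sum>p\<in>?ks x. A q (?b q) (A p (?a p) e))"
      by (rule sum.swap)
    finally have lhs: "tor_act sm A (tor_br x y) e =
        (\<Sum>p\<in>?ks x. \<Sum>q\<in>?ks y. A p (?a p) (A q (?b q) e)) -
        (\<Sum>q\<in>?ks y. \<Sum>p\<in>?ks x. A q (?b q) (A p (?a p) e))" .
    \<comment> \<open>The terms with a central factor are symmetric in the two arguments and cancel
      in the commutator.\<close>
    have comp: "tor_act sm A u (tor_act sm A v e) =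
        (\<Sum>p\<in>?ks u. \<Sum>q\<in>?ks v. A p (?lk u p) (A q (?lk v q) e)) +
        sm (snd v * lvl) (\<Sum>p\<in>?ks u. A p (?lk u p) e) +
        sm (snd u * lvl) (\<Sum>q\<in>?ks v. A q (?lk v q) e) + sm (snd u * lvl * (snd v * lvl)) e"
      if u: "u \<in> tor_part X" and v: "v \<in> tor_part X" for u v
    proof -
      have "(\<Sum>q\<in>?ks v. A q (?lk v q) e) \<in> E"
        by (intro M.subspace_sum E A_closed lk v e)
      then show ?thesis
        unfolding tor_act_def[of sm A v]
        by (simp add: tor_act_def A_add_right A_scale_right A_sum A_closed lk u v e
            M.subspace_scale[OF E] sum.distrib M.scale_sum_right M.scale_right_distrib algebra_simps)
    qed
    show "tor_act sm A (tor_br x y) e =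
        tor_act sm A x (tor_act sm A y e) - tor_act sm A y (tor_act sm A x e)"
      unfolding lhs comp[OF x y] comp[OF y x] by (simp add: mult.commute)
  qed
qed

end

section \<open>The module of formal series of operators\<close>

context char_0_vector_space
begin

lemma bsum_nat:
  assumes "ev0 g"
  shows "bsum c (int k) g = (\<Sum>i\<le>k. scale (bcoef c (int k) i) (g i))"
proof -
  obtain K where K: "\<And>i. K \<le> i \<Longrightarrow> g i = 0" using assms unfolding ev0_def by blast
  have "bsum c (int k) g = (\<Sum>i<K + Suc k. scale (bcoef c (int k) i) (g i))"
    using K by (intro bsum_eq) auto
  also have "\<dots> = (\<Sum>i\<le>k. scale (bcoef c (int k) i) (g i))"
    by (intro sum.mono_neutral_right) (auto simp: bcoef_eq_0)
  finally show ?thesis .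
qed

text \<open>(j - i) times the binomial coefficient of j over i is j times that of j - 1 over i: the
  derivative of (x + c y)^j in x. It deals with the mode index in front of the central term.\<close>

lemma bsum_absorb:
  assumes "ev0 g"
  shows "bsum c j (\<lambda>i. scale (of_int (j - int i)) (g i)) = scale (of_int j) (bsum c (j - 1) g)"
proof -
  obtain K where K: "\<And>i. K \<le> i \<Longrightarrow> g i = 0" using assms unfolding ev0_def by blast
  have "bcoef c j i * of_int (j - int i) = of_int j * bcoef c (j - 1) i" for i
    using gbinomial_absorb_comp[of "of_int j :: 'a" i] by (simp add: bcoef_def algebra_simps)
  then show ?thesis
    using K by (simp add: bsum_eq[of K] scale_sum_right)
qed

end

lemma bcoef_reverse:
  assumes "i \<le> k"
  shows "bcoef (-1) (int k) (k - i) = (eps (int k) * bcoef (-1) (int k) i :: 'a :: field_char_0)"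
proof -
  have "of_int (int k) gchoose (k - i) = (of_int (int k) gchoose i :: 'a)"
    using gbinomial_of_nat_symmetric[OF assms, where 'a='a] by simp
  moreover have "(-1) ^ (k - i) = ((-1) ^ k * (-1) ^ i :: 'a)"
  proof -
    have "(-1) ^ k = ((-1) ^ (k - i) * (-1) ^ i :: 'a)"
      using assms by (simp add: power_add[symmetric])
    moreover have "(-1) ^ i * (-1) ^ i = (1 :: 'a)"
      by (simp flip: power_mult_distrib)
    ultimately show ?thesis by (simp add: mult.assoc)
  qed
  ultimately show ?thesis by (simp add: bcoef_def eps_of_nat)
qed

lemma bcoef_alternating_sum: "(\<Sum>i\<le>k. bcoef (-1) (int k) i) = (if k = 0 then 1 else 0 :: 'a :: field_char_0)"
  using choose_alternating_sum[of k, where 'a='a]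
  by (auto simp: bcoef_def simp flip: binomial_gbinomial)

text \<open>A k-th difference kills constants for k > 0 and linear functions for k > 1. For k = 0
  the only term is the value of k - i at i = 0, which is 0.\<close>

lemma bcoef_alternating_linear_sum:
  "(\<Sum>i\<le>k. bcoef (-1) (int k) i * of_int (int k - int i)) = (if k = 1 then 1 else 0 :: 'a :: field_char_0)"
proof (cases "k = 1")
  case False
  have "(\<Sum>i\<le>k. bcoef (-1) (int k) i * of_int (int k - int i)) =
      of_nat k * (\<Sum>i\<le>k. bcoef (-1) (int k) i) -
      (\<Sum>i\<le>k. (-1) ^ i * of_nat i * (of_nat (k choose i) :: 'a))"
    by (simp add: bcoef_def sum_distrib_left sum_subtractf[symmetric] algebra_simps
        flip: binomial_gbinomial)
  then show ?thesis
    using False choose_alternating_linear_sum[OF False, where 'a='a]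
    by (auto simp: bcoef_alternating_sum)
qed (simp add: bcoef_def)

text \<open>Modes of currents on the range of \<open>pr\<close>, with \<open>pr\<close> in place of
  the identity in the central term. The commutator is required for homogeneous \<open>a\<close> but
  arbitrary \<open>b\<close>, so that \<open>b\<close> may be a general vector of g.\<close>

locale current_modes = char_0_vector_space scale
  for scale :: "complex \<Rightarrow> 'v :: ab_group_add \<Rightarrow> 'v" +
  fixes Aop :: "'g :: ab_group_add \<Rightarrow> int \<Rightarrow> 'i :: ab_group_add \<Rightarrow> 'v \<Rightarrow> 'v"
    and pr :: "'v \<Rightarrow> 'v" and br :: "'g \<Rightarrow> 'g \<Rightarrow> 'g" and \<kappa> :: "'g \<Rightarrow> 'g \<Rightarrow> complex"
    and lvl :: complex and X :: "'i \<Rightarrow> 'g set"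
  assumes Aop_add_right: "Aop a m p (v + w) = Aop a m p v + Aop a m p w"
    and Aop_scale_right: "Aop a m p (scale c w) = scale c (Aop a m p w)"
    and Aop_add_left: "Aop (a + b) m p w = Aop a m p w + Aop b m p w"
    and Aop_trunc: "\<exists>n. \<forall>m\<ge>n. \<forall>p. Aop a m p w = 0"
    and pr_Aop: "pr (Aop a m p w) = Aop a m p w" and Aop_pr: "Aop a m p (pr w) = Aop a m p w"
    and pr_add: "pr (v + w) = pr v + pr w" and pr_scale: "pr (scale c w) = scale c (pr w)"
    and pr_pr: "pr (pr w) = pr w"
    and Aop_commutator: "a \<in> X p \<Longrightarrow> Aop a m p (Aop b n q w) - Aop b n q (Aop a m p w) =
      Aop (br a b) (m + n) (p + q) w +
      scale (if m + n = 0 \<and> p + q = 0 then of_int m * \<kappa> a b * lvl else 0) (pr w)"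
begin

lemma Aop_0_right [simp]: "Aop a m p 0 = 0"
  using Aop_add_right[of a m p 0 0] by simp

lemma Aop_diff_right: "Aop a m p (v - w) = Aop a m p v - Aop a m p w"
  using Aop_add_right[of a m p "v - w" w] by (simp add: algebra_simps)

lemma ev0_Aop: "ev0 (\<lambda>i. Aop a (m + int i) p w)"
proof -
  obtain n where n: "\<And>m. n \<le> m \<Longrightarrow> Aop a m p w = 0" using Aop_trunc by blast
  have "Aop a (m + int i) p w = 0" if "nat (n - m) \<le> i" for i
    using that by (intro n) linarith
  then show ?thesis unfolding ev0_def by blast
qed

lemma ev0_Aop_nat: "ev0 (\<lambda>i. Aop a (int i) p w)"
  using ev0_Aop[of a 0] by simp

lemma Aop_bsum: "ev0 g \<Longrightarrow> Aop a m p (bsum c z g) = bsum c z (\<lambda>i. Aop a m p (g i))"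
  by (rule bsum_hom) (auto simp: Aop_add_right Aop_scale_right)

lemma pr_bsum: "ev0 g \<Longrightarrow> pr (bsum c z g) = bsum c z (\<lambda>i. pr (g i))"
  by (rule bsum_hom) (auto simp: pr_add pr_scale)

lemma pr_0 [simp]: "pr 0 = 0"
  using pr_add[of 0 0] by simp

lemma pr_diff: "pr (v - w) = pr v - pr w"
  using pr_add[of "v - w" w] by (simp add: algebra_simps)

text \<open>This is the space E(V, r) for the range V of \<open>pr\<close>, with truncation uniform
  in the multi-index q.\<close>

definition series :: "(int \<Rightarrow> 'i \<Rightarrow> 'v \<Rightarrow> 'v) set" where
  "series = {\<phi>. (\<forall>n q v w. \<phi> n q (v + w) = \<phi> n q v + \<phi> n q w) \<and>
    (\<forall>n q c w. \<phi> n q (scale c w) = scale c (\<phi> n q w)) \<and>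
    (\<forall>w. \<exists>k. \<forall>n\<ge>k. \<forall>q. \<phi> n q w = 0) \<and>
    (\<forall>n q w. pr (\<phi> n q w) = \<phi> n q w) \<and> (\<forall>n q w. \<phi> n q (pr w) = \<phi> n q w)}"

lemma seriesD:
  assumes "\<phi> \<in> series"
  shows series_add: "\<phi> n q (v + w) = \<phi> n q v + \<phi> n q w"
    and series_scale: "\<phi> n q (scale c w) = scale c (\<phi> n q w)"
    and series_trunc: "\<exists>k. \<forall>n\<ge>k. \<forall>q. \<phi> n q w = 0"
    and pr_series: "pr (\<phi> n q w) = \<phi> n q w" and series_pr: "\<phi> n q (pr w) = \<phi> n q w"
    and series_0: "\<phi> n q 0 = 0" and series_diff: "\<phi> n q (v - w) = \<phi> n q v - \<phi> n q w"
proof -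
  show add: "\<phi> n q (v + w) = \<phi> n q v + \<phi> n q w" for v w
    using assms unfolding series_def by blast
  show "\<phi> n q (scale c w) = scale c (\<phi> n q w)" "\<exists>k. \<forall>n\<ge>k. \<forall>q. \<phi> n q w = 0"
    "pr (\<phi> n q w) = \<phi> n q w" "\<phi> n q (pr w) = \<phi> n q w"
    using assms unfolding series_def by blast+
  show "\<phi> n q 0 = 0" using add[of 0 0] by simp
  show "\<phi> n q (v - w) = \<phi> n q v - \<phi> n q w" using add[of "v - w" w] by (simp add: algebra_simps)
qed

lemma ev0_series:
  assumes "\<phi> \<in> series"
  shows "ev0 (\<lambda>i. \<phi> (n + int i) q w)"
proof -
  obtain k where k: "\<And>n. k \<le> n \<Longrightarrow> \<phi> n q w = 0" using series_trunc[OF assms] by blast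
  have "\<phi> (n + int i) q w = 0" if "nat (k - n) \<le> i" for i
    using that by (intro k) linarith
  then show ?thesis unfolding ev0_def by blast
qed

lemma fin2_series:
  assumes "\<phi> \<in> series"
  shows "fin2 (\<lambda>i h. \<phi> (n + int i + int h) q w)"
proof -
  obtain k where k: "\<And>n. k \<le> n \<Longrightarrow> \<phi> n q w = 0" using series_trunc[OF assms] by blast
  have "\<phi> (n + int i + int h) q w = 0" if "nat (k - n) \<le> i \<or> nat (k - n) \<le> h" for i h
    using that by (intro k) linarith
  then show ?thesis unfolding fin2_def by blast
qed

lemma ev0_Aop_series: "\<phi> \<in> series \<Longrightarrow> ev0 (\<lambda>i. Aop a (f i) p (\<phi> (n + int i) q w))"
  by (rule ev0_map[OF ev0_series, of _ "\<lambda>i. Aop a (f i) p"]) simp_all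

lemma ev0_series_Aop: "\<phi> \<in> series \<Longrightarrow> ev0 (\<lambda>i. \<phi> (f i) q (Aop a (int i) p w))"
  using ev0_Aop_nat[of a p w] unfolding ev0_def
  by (elim exE, rule_tac x = K in exI) (simp add: series_0)

text \<open>
  \<open>M a j p \<phi>\<close> is the \<open>j\<close>-th product of the current of \<open>a\<close> with \<open>\<phi>\<close>.  It is the difference of
  a left action, through the expansion of \<open>(x - y)\<^sup>j\<close> in powers of \<open>y\<close>, and a right action, through
  the expansion in powers of \<open>x\<close>; the two commute, hence no locality is needed for \<open>M_bracket\<close>.
\<close>

definition M :: "'g \<Rightarrow> int \<Rightarrow> 'i \<Rightarrow> (int \<Rightarrow> 'i \<Rightarrow> 'v \<Rightarrow> 'v) \<Rightarrow> int \<Rightarrow> 'i \<Rightarrow> 'v \<Rightarrow> 'v" where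
  "M a j p \<phi> n q w =
     bsum (-1) j (\<lambda>i. Aop a (j - int i) p (\<phi> (n + int i) (q - p) w)) -
     scale (eps j) (bsum (-1) j (\<lambda>i. \<phi> (n + j - int i) (q - p) (Aop a (int i) p w)))"

lemma M_series:
  assumes \<phi>: "\<phi> \<in> series"
  shows "M a j p \<phi> \<in> series"
proof -
  note e = ev0_Aop_series[OF \<phi>] ev0_series_Aop[OF \<phi>]
  have "M a j p \<phi> n q (v + w) = M a j p \<phi> n q v + M a j p \<phi> n q w" for n q v w
    by (simp add: M_def series_add[OF \<phi>] Aop_add_right bsum_add[OF e(1) e(1)] bsum_add[OF e(2) e(2)]
        scale_right_distrib)
  moreover have "M a j p \<phi> n q (scale c w) = scale c (M a j p \<phi> n q w)" for n q c w
    by (simp add: M_def series_scale[OF \<phi>] Aop_scale_right bsum_scale[OF e(1)] bsum_scale[OF e(2)]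
        scale_right_diff_distrib mult.commute)
  moreover have "\<exists>k. \<forall>n\<ge>k. \<forall>q. M a j p \<phi> n q w = 0" for w
  proof -
    obtain k where k: "\<And>n q. k \<le> n \<Longrightarrow> \<phi> n q w = 0" using series_trunc[OF \<phi>] by blast
    obtain K where K: "\<And>i. K \<le> i \<Longrightarrow> Aop a (int i) p w = 0"
      using ev0_Aop_nat unfolding ev0_def by blast
    have "\<forall>i. \<exists>k. \<forall>n\<ge>k. \<forall>q. \<phi> n q (Aop a (int i) p w) = 0" using series_trunc[OF \<phi>] by blast
    from choice[OF this] obtain f where
      f: "\<And>i n q. f i \<le> n \<Longrightarrow> \<phi> n q (Aop a (int i) p w) = 0" by blast
    \<comment> \<open>The left sum vanishes from \<open>k\<close> on. In the right sum only the
      finitely many vectors with i < K matter: their bounds are added up, \<open>K\<close>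
      compensates for the shift by i, and j for the shift by j.\<close>
    let ?k = "max k ((\<Sum>i<K. \<bar>f i\<bar>) + int K - j)"
    have "M a j p \<phi> n q w = 0" if n: "?k \<le> n" for n q
    proof -
      have 1: "\<phi> (n + int i) (q - p) w = 0" for i using n by (intro k) auto
      have 2: "\<phi> (n + j - int i) (q - p) (Aop a (int i) p w) = 0" for i
      proof (cases "i < K")
        case True
        then have "\<bar>f i\<bar> \<le> (\<Sum>i<K. \<bar>f i\<bar>)" by (intro member_le_sum) auto
        then show ?thesis using n True by (intro f) linarith
      qed (simp add: K series_0[OF \<phi>])
      show ?thesis by (simp add: M_def 1 2)
    qed
    then show ?thesis by blast
  qed
  moreover have "pr (M a j p \<phi> n q w) = M a j p \<phi> n q w" for n q w
    by (simp add: M_def pr_diff pr_scale pr_bsum[OF e(1)] pr_bsum[OF e(2)] pr_Aop pr_series[OF \<phi>])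
  moreover have "M a j p \<phi> n q (pr w) = M a j p \<phi> n q w" for n q w
    by (simp add: M_def Aop_pr series_pr[OF \<phi>])
  ultimately show ?thesis unfolding series_def by blast
qed

lemma M_add:
  assumes \<phi>: "\<phi> \<in> series" and \<psi>: "\<psi> \<in> series"
  shows "M a j p (\<phi> + \<psi>) = M a j p \<phi> + M a j p \<psi>"
proof (intro ext)
  fix n q w
  note e = ev0_Aop_series[OF \<phi>] ev0_series_Aop[OF \<phi>] ev0_Aop_series[OF \<psi>] ev0_series_Aop[OF \<psi>]
  show "M a j p (\<phi> + \<psi>) n q w = (M a j p \<phi> + M a j p \<psi>) n q w"
    by (simp add: M_def Aop_add_right bsum_add[OF e(1,3)] bsum_add[OF e(2,4)] scale_right_distrib)
qed

lemma M_scale: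
  assumes \<phi>: "\<phi> \<in> series"
  shows "M a j p (\<lambda>n q w. scale c (\<phi> n q w)) = (\<lambda>n q w. scale c (M a j p \<phi> n q w))"
proof (intro ext)
  fix n q w
  note e = ev0_Aop_series[OF \<phi>] ev0_series_Aop[OF \<phi>]
  show "M a j p (\<lambda>n q w. scale c (\<phi> n q w)) n q w = scale c (M a j p \<phi> n q w)"
    by (simp add: M_def Aop_scale_right bsum_scale[OF e(1)] bsum_scale[OF e(2)]
        scale_right_diff_distrib mult.commute)
qed

lemma M_add_left:
  assumes \<phi>: "\<phi> \<in> series"
  shows "M (a + b) j p \<phi> = M a j p \<phi> + M b j p \<phi>"
proof (intro ext)
  fix n q w
  note e = ev0_Aop_series[OF \<phi>] ev0_series_Aop[OF \<phi>]
  show "M (a + b) j p \<phi> n q w = (M a j p \<phi> + M b j p \<phi>) n q w"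
    by (simp add: M_def Aop_add_left series_add[OF \<phi>] bsum_add[OF e(1,1)] bsum_add[OF e(2,2)]
        scale_right_distrib)
qed

text \<open>The mixed terms \<open>afb\<close> and \<open>bfa\<close> cancel. What remains is the
  commutator of the modes to the left of the series, with its central term, and the same commutator
  to the right, where the central term drops out.\<close>

lemma M_bracket:
  assumes \<phi>: "\<phi> \<in> series" and a: "a \<in> X p"
  shows "M a j p (M b k q \<phi>) n r w - M b k q (M a j p \<phi>) n r w =
    M (br a b) (j + k) (p + q) \<phi> n r w +
    scale (if j + k = 0 \<and> p + q = 0 then of_int j * \<kappa> a b * lvl else 0) (\<phi> n r w)"
proof -
  define s where "s = r - p - q"
  have s: "r - q - p = s" "r - p - q = s" "r - (p + q) = s" by (simp_all add: s_def algebra_simps)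
  let ?a = "\<lambda>m. Aop a m p" and ?b = "\<lambda>m. Aop b m q" and ?f = "\<lambda>n. \<phi> n s"
  define D where "D = (\<lambda>g. bsum (-1) j (\<lambda>i. bsum (-1) k (g i)))"
  define abf where "abf = (\<lambda>i h. ?a (j - int i) (?b (k - int h) (?f (n + int i + int h) w)))"
  define baf where "baf = (\<lambda>i h. ?b (k - int h) (?a (j - int i) (?f (n + int i + int h) w)))"
  define afb where "afb = (\<lambda>i h. ?a (j - int i) (?f (n + int i + k - int h) (?b (int h) w)))"
  define bfa where "bfa = (\<lambda>i h. ?b (k - int h) (?f (n + int h + j - int i) (?a (int i) w)))"
  define fba where "fba = (\<lambda>i h. ?f (n + j + k - int i - int h) (?b (int h) (?a (int i) w)))"
  define fab where "fab = (\<lambda>i h. ?f (n + j + k - int i - int h) (?a (int i) (?b (int h) w)))"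
  have fin: "fin2 abf" "fin2 baf" "fin2 afb" "fin2 bfa" "fin2 fba" "fin2 fab"
  proof -
    show "fin2 abf" unfolding abf_def by (rule fin2_map[OF fin2_series[OF \<phi>]]) simp
    show "fin2 baf" unfolding baf_def by (rule fin2_map[OF fin2_series[OF \<phi>]]) simp
    have afb: "afb i h = ?a (j - int i) (?f (n + k - int h + int i) (?b (int h) w))" for i h
      by (simp add: afb_def algebra_simps)
    show "fin2 afb"
      by (rule iffD1[OF fin2_flip], rule fin2I_ev0[OF ev0_Aop_nat[of b q w]], unfold afb)
        (simp_all add: series_0[OF \<phi>] ev0_Aop_series[OF \<phi>])
    have bfa: "bfa i h = ?b (k - int h) (?f (n + j - int i + int h) (?a (int i) w))" for i h
      by (simp add: bfa_def algebra_simps)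
    show "fin2 bfa"
      by (rule fin2I_ev0[OF ev0_Aop_nat[of a p w]], unfold bfa[abs_def])
        (simp_all add: series_0[OF \<phi>] ev0_Aop_series[OF \<phi>])
    show "fin2 fba" unfolding fba_def
      by (rule fin2I_ev0[OF ev0_Aop_nat[of a p w]])
        (simp_all add: series_0[OF \<phi>] ev0_series_Aop[OF \<phi>])
    show "fin2 fab" unfolding fab_def
      by (rule iffD1[OF fin2_flip], rule fin2I_ev0[OF ev0_Aop_nat[of b q w]])
        (simp_all add: series_0[OF \<phi>] ev0_series_Aop[OF \<phi>])
  qed
  have D_diff: "D (\<lambda>i h. f i h - g i h) = D f - D g" if f: "fin2 f" and g: "fin2 g" for f g
    unfolding D_def
    by (simp only: bsum_diff[OF fin2_ev0[OF f] fin2_ev0[OF g]]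
        bsum_diff[OF ev0_bsum[OF f] ev0_bsum[OF g]])
  have D_flip: "bsum (-1) k (\<lambda>h. bsum (-1) j (\<lambda>i. g i h)) = D g" if "fin2 g" for g
    unfolding D_def by (rule bsum_swap[OF that, symmetric])
  have row: "bsum (-1) j (\<lambda>i. bsum (-1) k (f i) - scale c (bsum (-1) k (g i))) =
      D f - scale c (D g)" if f: "fin2 f" and g: "fin2 g" for f g c
    unfolding D_def
    by (simp only: bsum_diff[OF ev0_bsum[OF f] ev0_scale[OF ev0_bsum[OF g]]]
        bsum_scale[OF ev0_bsum[OF g]])
  have ev_k: "ev0 (\<lambda>h. bsum (-1) j (\<lambda>i. g i h))" if "fin2 g" for g
    by (rule ev0_bsum[OF iffD2[OF fin2_flip that]])
  have col: "bsum (-1) k (\<lambda>h. bsum (-1) j (\<lambda>i. f i h) - scale c (bsum (-1) j (\<lambda>i. g i h))) =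
      D f - scale c (D g)" if f: "fin2 f" and g: "fin2 g" for f g c
    by (simp only: bsum_diff[OF ev_k[OF f] ev0_scale[OF ev_k[OF g]]]
        bsum_scale[OF ev_k[OF g]] D_flip[OF f] D_flip[OF g])
  note e = ev0_Aop_series[OF \<phi>] ev0_series_Aop[OF \<phi>]
  have ab: "M a j p (M b k q \<phi>) n r w =
      (D abf - scale (eps k) (D afb)) - scale (eps j) (D bfa - scale (eps k) (D fba))"
  proof -
    have 1: "?a (j - int i) (M b k q \<phi> (n + int i) (r - p) w) =
        bsum (-1) k (abf i) - scale (eps k) (bsum (-1) k (afb i))" for i
      unfolding M_def s abf_def afb_def
      by (simp only: Aop_diff_right Aop_scale_right Aop_bsum[OF e(1)] Aop_bsum[OF e(2)])
    have 2: "M b k q \<phi> (n + j - int i) (r - p) (?a (int i) w) =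
        bsum (-1) k (bfa i) - scale (eps k) (bsum (-1) k (fba i))" for i
      unfolding M_def s bfa_def fba_def by (simp add: algebra_simps)
    show ?thesis
      unfolding M_def[of a j p "M b k q \<phi>"] 1 2 row[OF fin(1,3)] row[OF fin(4,5)] ..
  qed
  have ba: "M b k q (M a j p \<phi>) n r w =
      (D baf - scale (eps j) (D bfa)) - scale (eps k) (D afb - scale (eps j) (D fab))"
  proof -
    have 1: "?b (k - int h) (M a j p \<phi> (n + int h) (r - q) w) =
        bsum (-1) j (\<lambda>i. baf i h) - scale (eps j) (bsum (-1) j (\<lambda>i. bfa i h))" for h
    proof -
      have x: "n + int i + int h = n + int h + int i" for i by simp
      show ?thesis
        unfolding M_def s baf_def bfa_def x
        by (simp only: Aop_diff_right Aop_scale_right Aop_bsum[OF e(1)] Aop_bsum[OF e(2)])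
    qed
    have 2: "M a j p \<phi> (n + k - int h) (r - q) (?b (int h) w) =
        bsum (-1) j (\<lambda>i. afb i h) - scale (eps j) (bsum (-1) j (\<lambda>i. fab i h))" for h
      unfolding M_def s afb_def fab_def by (simp add: algebra_simps)
    show ?thesis
      unfolding M_def[of b k q "M a j p \<phi>"] 1 2 col[OF fin(2,4)] col[OF fin(3,6)] ..
  qed
  let ?c = "if p + q = 0 then \<kappa> a b * lvl else 0"
  let ?main = "\<lambda>e. Aop (br a b) (j + k - int e) (p + q) (?f (n + int e) w)"
  \<comment> \<open>The central term needs the mode indices j - i and k - h to add up to 0, hence
    depends only on i + h apart from its factor j - i.\<close>
  let ?cent = "\<lambda>e. if int e = j + k then scale ?c (?f (n + int e) w) else 0"
  have ev_main: "ev0 ?main" by (rule ev0_Aop_series[OF \<phi>])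
  have ev_cent: "ev0 ?cent"
    unfolding ev0_def by (rule exI[of _ "nat (j + k + 1)"]) auto
  have fin2_sum: "fin2 (\<lambda>i h. g (i + h))" if "ev0 g" for g :: "nat \<Rightarrow> 'v"
    using that unfolding ev0_def fin2_def by (meson trans_le_add1 trans_le_add2)
  have left: "D (\<lambda>i h. abf i h - baf i h) =
      bsum (-1) (j + k) ?main + scale (if j + k = 0 \<and> p + q = 0 then of_int j * \<kappa> a b * lvl else 0) (\<phi> n r w)"
  proof -
    have "abf i h - baf i h = ?main (i + h) + scale (of_int (j - int i)) (?cent (i + h))" for i h
      unfolding abf_def baf_def Aop_commutator[OF a]
      by (auto simp: pr_series[OF \<phi>] algebra_simps)
    then have "D (\<lambda>i h. abf i h - baf i h) =
        bsum (-1) j (\<lambda>i. bsum (-1) k (\<lambda>h. ?main (i + h) + scale (of_int (j - int i)) (?cent (i + h))))"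
      by (simp only: D_def)
    also have "\<dots> = bsum (-1) j (\<lambda>i. bsum (-1) k (\<lambda>h. ?main (i + h)) +
        scale (of_int (j - int i)) (bsum (-1) k (\<lambda>h. ?cent (i + h))))"
      by (simp only: bsum_add[OF ev0_shift[OF ev_main] ev0_scale[OF ev0_shift[OF ev_cent]]]
          bsum_scale[OF ev0_shift[OF ev_cent]])
    also have "\<dots> = bsum (-1) j (\<lambda>i. bsum (-1) k (\<lambda>h. ?main (i + h))) +
        bsum (-1) j (\<lambda>i. scale (of_int (j - int i)) (bsum (-1) k (\<lambda>h. ?cent (i + h))))"
      by (intro bsum_add ev0_bsum fin2_sum ev_main
          ev0_map[of _ "\<lambda>i. scale (of_int (j - int i))"] ev_cent) simp
    also have "bsum (-1) j (\<lambda>i. scale (of_int (j - int i)) (bsum (-1) k (\<lambda>h. ?cent (i + h)))) =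
        scale (of_int j) (bsum (-1) (j - 1) (\<lambda>i. bsum (-1) k (\<lambda>h. ?cent (i + h))))"
      by (rule bsum_absorb) (intro ev0_bsum fin2_sum ev_cent)
    also have "bsum (-1) (j - 1) (\<lambda>i. bsum (-1) k (\<lambda>h. ?cent (i + h))) = bsum (-1) (j - 1 + k) ?cent"
      by (rule bsum_Vandermonde[OF ev_cent])
    also have "\<dots> = (if j + k = 0 then scale ?c (?f n w) else 0)"
    proof (cases "0 \<le> j + k")
      case True
      then obtain E where E: "j + k = int E" by (metis nonneg_int_cases)
      \<comment> \<open>The only index with a nonzero entry is E = j + k, and the binomial
        coefficient of E - 1 over E is 0 unless E = 0.\<close>
      have "bsum (-1) (j - 1 + k) ?cent = scale (bcoef (-1) (j - 1 + k) E) (?cent E)"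
        using E by (intro bsum_eq_single) auto
      also have "bcoef (-1) (j - 1 + k) E = (if E = 0 then 1 else 0 :: complex)"
      proof (cases E)
        case (Suc E')
        then have "j - 1 + k = int E'" using E by simp
        then show ?thesis using Suc by (simp add: bcoef_eq_0)
      qed simp
      finally show ?thesis using E by auto
    next
      case False
      then have "?cent = (\<lambda>e. 0)" by auto
      then show ?thesis using False by simp
    qed
    also have "bsum (-1) j (\<lambda>i. bsum (-1) k (\<lambda>h. ?main (i + h))) = bsum (-1) (j + k) ?main"
      by (rule bsum_Vandermonde[OF ev_main])
    finally show ?thesis
    proof (simp, intro impI)
      assume "p + q = 0"
      then have "s = r" using s(3) by simp
      then show "scale (of_int j * (\<kappa> a b * lvl)) (\<phi> n s w) = scale (of_int j * \<kappa> a b * lvl) (\<phi> n r w)"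
        by (simp add: mult.assoc)
    qed
  qed
  have right: "D (\<lambda>i h. fab i h - fba i h) =
      bsum (-1) (j + k) (\<lambda>e. ?f (n + (j + k) - int e) (Aop (br a b) (int e) (p + q) w))"
  proof -
    let ?g = "\<lambda>e. ?f (n + (j + k) - int e) (Aop (br a b) (int e) (p + q) w)"
    have "fab i h - fba i h = ?g (i + h)" for i h
    proof -
      \<comment> \<open>Both mode indices are nonnegative, so a zero sum forces i = 0, and i is the
        factor of the central term.\<close>
      have z: "(if int i + int h = 0 \<and> p + q = 0 then of_int (int i) * \<kappa> a b * lvl else 0) = 0"
        by auto
      have idx: "n + j + k - int i - int h = n + (j + k) - int (i + h)" by simp
      have "fab i h - fba i h = ?f (n + (j + k) - int (i + h))
          (?a (int i) (?b (int h) w) - ?b (int h) (?a (int i) w))"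
        by (simp only: fab_def fba_def series_diff[OF \<phi>] idx)
      also have "?a (int i) (?b (int h) w) - ?b (int h) (?a (int i) w) =
          Aop (br a b) (int (i + h)) (p + q) w"
        unfolding Aop_commutator[OF a] z by simp
      finally show ?thesis .
    qed
    then have "D (\<lambda>i h. fab i h - fba i h) = bsum (-1) j (\<lambda>i. bsum (-1) k (\<lambda>h. ?g (i + h)))"
      by (simp only: D_def)
    also have "\<dots> = bsum (-1) (j + k) ?g"
    proof -
      have "ev0 ?g" by (rule ev0_series_Aop[OF \<phi>])
      from bsum_Vandermonde[OF this] show ?thesis .
    qed
    finally show ?thesis .
  qed
  have "M a j p (M b k q \<phi>) n r w - M b k q (M a j p \<phi>) n r w =
      (D abf - D baf) - scale (eps (j + k)) (D fab - D fba)"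
    unfolding ab ba by (simp add: scale_right_diff_distrib eps_add algebra_simps)
  also have "\<dots> = D (\<lambda>i h. abf i h - baf i h) - scale (eps (j + k)) (D (\<lambda>i h. fab i h - fba i h))"
    by (simp only: D_diff fin)
  finally show ?thesis
    unfolding left right M_def s by simp
qed

text \<open>For k >= 0 both expansions of (x - y)^k are the same polynomial, so the two sums combine
  into one sum of commutators.\<close>

lemma M_nat:
  assumes \<phi>: "\<phi> \<in> series"
  shows "M a (int k) p \<phi> n q w = (\<Sum>i\<le>k. scale (bcoef (-1) (int k) i)
    (Aop a (int (k - i)) p (\<phi> (n + int i) (q - p) w) - \<phi> (n + int i) (q - p) (Aop a (int (k - i)) p w)))"
proof -
  let ?g = "\<lambda>i. \<phi> (n + int k - int i) (q - p) (Aop a (int i) p w)"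
  have "scale (eps (int k)) (bsum (-1) (int k) ?g) =
      (\<Sum>i\<le>k. scale (eps (int k) * bcoef (-1) (int k) i) (?g i))"
    by (simp add: bsum_nat[OF ev0_series_Aop[OF \<phi>]] scale_sum_right)
  also have "\<dots> = (\<Sum>i\<le>k. scale (bcoef (-1) (int k) (k - i)) (?g i))"
    by (intro sum.cong) (auto simp: bcoef_reverse)
  also have "\<dots> = (\<Sum>i\<le>k. scale (bcoef (-1) (int k) i) (?g (k - i)))"
    by (rule sum.reindex_bij_witness[of _ "\<lambda>i. k - i" "\<lambda>i. k - i"]) auto
  also have "\<dots> = (\<Sum>i\<le>k. scale (bcoef (-1) (int k) i)
      (\<phi> (n + int i) (q - p) (Aop a (int (k - i)) p w)))"
    by (intro sum.cong) (auto simp: of_nat_diff)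
  finally show ?thesis
    unfolding M_def bsum_nat[OF ev0_Aop_series[OF \<phi>]]
    by (simp add: sum_subtractf[symmetric] scale_right_diff_distrib of_nat_diff)
qed

text \<open>The series attached to the vector (a, c) of g + C: the current of a plus c times the
  constant identity series.\<close>

definition current :: "'g \<Rightarrow> complex \<Rightarrow> int \<Rightarrow> 'i \<Rightarrow> 'v \<Rightarrow> 'v" where
  "current a c n q w = Aop a n q w + (if n = -1 \<and> q = 0 then scale c (pr w) else 0)"

lemma current_series: "current a c \<in> series"
proof -
  have t: "\<exists>k. \<forall>n\<ge>k. \<forall>q. current a c n q w = 0" for w
  proof -
    obtain k where "\<forall>n\<ge>k. \<forall>q. Aop a n q w = 0" using Aop_trunc by blast
    then have "\<forall>n\<ge>max 0 k. \<forall>q. current a c n q w = 0" by (simp add: current_def)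
    then show ?thesis by blast
  qed
  have c1: "current a c n q (v + w) = current a c n q v + current a c n q w" for n q v w
    by (cases "n = -1"; cases "q = 0"; simp add: current_def Aop_add_right pr_add scale_right_distrib)
  have c2: "current a c n q (scale d w) = scale d (current a c n q w)" for n q d w
    by (cases "n = -1"; cases "q = 0"; simp add: current_def Aop_scale_right pr_scale scale_right_distrib mult.commute)
  have c3: "pr (current a c n q w) = current a c n q w" for n q w
    by (cases "n = -1"; cases "q = 0"; simp add: current_def pr_Aop pr_add pr_scale pr_pr)
  have c4: "current a c n q (pr w) = current a c n q w" for n q w
    by (cases "n = -1"; cases "q = 0"; simp add: current_def Aop_pr pr_pr)
  show ?thesis
    unfolding series_def by (intro CollectI conjI allI c1 c2 c3 c4 t)
qed

text \<open>By \<open>M_nat\<close> the product is a k-th difference in i of commutators, and by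
  \<open>Aop_commutator\<close> these consist of a term independent of i and a central term
  proportional to k - i.\<close>

lemma M_current:
  assumes a: "a \<in> X p"
  shows "M a (int k) p (current b c) =
    current (if k = 0 then br a b else 0) (if k = 1 then \<kappa> a b * lvl else 0)"
proof (intro ext)
  fix n q w
  have zero: "Aop 0 m q w = 0" for m q using Aop_add_left[of 0 0 m q w] by simp
  have "Aop a (int (k - i)) p (current b c (n + int i) (q - p) w) -
      current b c (n + int i) (q - p) (Aop a (int (k - i)) p w) =
      Aop (br a b) (int k + n) q w +
      scale (of_int (int k - int i)) (if int k + n = 0 \<and> q = 0 then scale (\<kappa> a b * lvl) (pr w) else 0)"
    if "i \<le> k" for i
    using that Aop_commutator[OF a, of "int (k - i)" b "n + int i" "q - p" w]
    by (auto simp: current_def Aop_add_right Aop_scale_right Aop_pr pr_Aop of_nat_diff algebra_simps)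
  then have "M a (int k) p (current b c) n q w = (\<Sum>i\<le>k. scale (bcoef (-1) (int k) i)
      (Aop (br a b) (int k + n) q w + scale (of_int (int k - int i))
        (if int k + n = 0 \<and> q = 0 then scale (\<kappa> a b * lvl) (pr w) else 0)))"
    unfolding M_nat[OF current_series] by (intro sum.cong) auto
  also have "\<dots> = scale (\<Sum>i\<le>k. bcoef (-1) (int k) i) (Aop (br a b) (int k + n) q w) +
      scale (\<Sum>i\<le>k. bcoef (-1) (int k) i * of_int (int k - int i))
        (if int k + n = 0 \<and> q = 0 then scale (\<kappa> a b * lvl) (pr w) else 0)"
    by (simp only: scale_right_distrib sum.distrib scale_scale scale_sum_left)
  also have "\<dots> = current (if k = 0 then br a b else 0) (if k = 1 then \<kappa> a b * lvl else 0) n q w"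
    unfolding bcoef_alternating_sum bcoef_alternating_linear_sum
    by (auto simp: current_def zero)
  finally show "M a (int k) p (current b c) n q w =
    current (if k = 0 then br a b else 0) (if k = 1 then \<kappa> a b * lvl else 0) n q w" .
qed

end

section \<open>A concrete model of the induced module\<close>

context induced
begin

text \<open>Discards the basis vectors outside \<open>S\<close>, so that \<open>pr\<close> can be
  defined on the whole type while its values stay over the carrier.\<close>

definition restrict_keys :: "(('a word \<Rightarrow>\<^sub>0 complex) set \<times> 'm \<Rightarrow>\<^sub>0 complex) \<Rightarrow> _" where
  "restrict_keys = lext free_scale (\<lambda>k. if k \<in> S then Poly_Mapping.single k 1 else 0)"

lemma restrict_keys_closed: "Poly_Mapping.keys (restrict_keys F) \<subseteq> S"
proof -
  have "restrict_keys F \<in> {F. Poly_Mapping.keys F \<subseteq> S}"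
    unfolding restrict_keys_def by (intro free.lext_mem[OF subspace_keys]) auto
  then show ?thesis by blast
qed

lemma restrict_keys_id:
  assumes "Poly_Mapping.keys F \<subseteq> S"
  shows "restrict_keys F = F"
  by (rule poly_mapping_induct_single[OF assms]) (simp_all add: restrict_keys_def free.lext_add)

definition complement_projection :: "(('a word \<Rightarrow>\<^sub>0 complex) set \<times> 'm \<Rightarrow>\<^sub>0 complex) \<Rightarrow> _" where
  "complement_projection = (SOME \<pi>. Vector_Spaces.linear free_scale free_scale \<pi> \<and>
    (\<forall>x\<in>R. \<pi> x = 0) \<and> (\<forall>x. \<pi> x - x \<in> R))"

lemma complement_projection:
  "Vector_Spaces.linear free_scale free_scale complement_projection \<and>
    (\<forall>x\<in>R. complement_projection x = 0) \<and> (\<forall>x. complement_projection x - x \<in> R)"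
  using someI_ex[OF free.subspace_complement_projection[OF subspace_R]]
  unfolding complement_projection_def .

lemma complement_projection_linear: "Vector_Spaces.linear free_scale free_scale complement_projection"
  and complement_projection_R: "F \<in> R \<Longrightarrow> complement_projection F = 0"
  and complement_projection_mod: "complement_projection F - F \<in> R"
  by (rule complement_projection[THEN conjunct1]
      complement_projection[THEN conjunct2, THEN conjunct1, THEN bspec]
      complement_projection[THEN conjunct2, THEN conjunct2, THEN spec]; assumption?)+

text \<open>The image of \<open>pr\<close> is a complement of the relations, and hence a copy of the induced module.\<close>

definition pr :: "(('a word \<Rightarrow>\<^sub>0 complex) set \<times> 'm \<Rightarrow>\<^sub>0 complex) \<Rightarrow> _" where
  "pr F = complement_projection (restrict_keys F)"

lemma pr_linear:
  "pr (F + G) = pr F + pr G" "pr (free_scale c F) = free_scale c (pr F)" "pr (F - G) = pr F - pr G"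
  "pr 0 = 0"
proof -
  interpret \<pi>: Vector_Spaces.linear free_scale free_scale complement_projection
    by (rule complement_projection_linear)
  show "pr (F + G) = pr F + pr G" "pr (free_scale c F) = free_scale c (pr F)"
    "pr (F - G) = pr F - pr G" "pr 0 = 0"
    by (simp_all add: pr_def restrict_keys_def free.lext_add free.lext_scale free.lext_diff
        \<pi>.add \<pi>.scale \<pi>.diff \<pi>.zero)
qed

lemma pr_R: "F \<in> R \<Longrightarrow> pr F = 0"
  using subsetD[OF R_subset, of F] by (simp add: pr_def restrict_keys_id complement_projection_R)

lemma pr_mod: "Poly_Mapping.keys F \<subseteq> S \<Longrightarrow> pr F - F \<in> R"
  using complement_projection_mod[of F] by (simp add: pr_def restrict_keys_id)

lemma pr_closed: "Poly_Mapping.keys (pr F) \<subseteq> S"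
proof -
  have "pr F - restrict_keys F \<in> R" by (simp add: pr_def complement_projection_mod)
  then have "pr F - restrict_keys F \<in> {F. Poly_Mapping.keys F \<subseteq> S}" using R_subset by blast
  moreover have "restrict_keys F \<in> {F. Poly_Mapping.keys F \<subseteq> S}" using restrict_keys_closed by blast
  ultimately have "(pr F - restrict_keys F) + restrict_keys F \<in> {F. Poly_Mapping.keys F \<subseteq> S}"
    by (rule free.subspace_add[OF subspace_keys])
  then show ?thesis by simp
qed

lemma pr_cong: "F - G \<in> R \<Longrightarrow> pr F = pr G"
  using pr_R[of "F - G"] by (simp add: pr_linear)

lemma pr_pr [simp]: "pr (pr F) = pr F"
proof -
  interpret \<pi>: Vector_Spaces.linear free_scale free_scale complement_projection
    by (rule complement_projection_linear)
  have "pr F - restrict_keys F \<in> R" by (simp add: pr_def complement_projection_mod)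
  then have "pr (pr F) = pr (restrict_keys F)" by (rule pr_cong)
  then show ?thesis by (simp add: pr_def restrict_keys_id restrict_keys_closed)
qed

definition act_op :: "'a \<Rightarrow> (('a word \<Rightarrow>\<^sub>0 complex) set \<times> 'm \<Rightarrow>\<^sub>0 complex) \<Rightarrow> _" where
  "act_op x F = pr (T x (pr F))"

definition unit_vec :: "'m \<Rightarrow> (('a word \<Rightarrow>\<^sub>0 complex) set \<times> 'm \<Rightarrow>\<^sub>0 complex)" where
  "unit_vec m = pr (tens \<one>\<^bsub>A.U\<^esub> m)"

lemma act_op_linear:
  "act_op x (F + G) = act_op x F + act_op x G" "act_op x (free_scale c F) = free_scale c (act_op x F)"
  "act_op x 0 = 0" "act_op x (F - G) = act_op x F - act_op x G"
  by (simp_all add: act_op_def pr_linear)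

lemma pr_act_op [simp]: "pr (act_op x F) = act_op x F"
  and act_op_pr [simp]: "act_op x (pr F) = act_op x F"
  and pr_unit_vec [simp]: "pr (unit_vec m) = unit_vec m"
  by (simp_all add: act_op_def unit_vec_def)

lemma pr_T: "x \<in> A \<Longrightarrow> Poly_Mapping.keys F \<subseteq> S \<Longrightarrow> pr (T x F) = act_op x F"
  unfolding act_op_def using T_R[of x "pr F - F"] pr_mod[of F] by (intro pr_cong[symmetric]) simp

lemma act_op_add: "x \<in> A \<Longrightarrow> y \<in> A \<Longrightarrow> act_op (x + y) F = act_op x F + act_op y F"
  unfolding act_op_def pr_linear(1)[symmetric]
  by (rule pr_cong) (use T_add[OF _ _ pr_closed, of x y F] in \<open>simp add: diff_diff_eq\<close>)

lemma act_op_scale: "x \<in> A \<Longrightarrow> act_op (sc c x) F = free_scale c (act_op x F)"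
  unfolding act_op_def pr_linear(2)[symmetric]
  by (rule pr_cong) (rule T_scale[OF _ pr_closed])

lemma act_op_bracket:
  assumes x: "x \<in> A" and y: "y \<in> A"
  shows "act_op (br x y) F = act_op x (act_op y F) - act_op y (act_op x F)"
proof -
  have "act_op (br x y) F = pr (T x (T y (pr F)) - T y (T x (pr F)))"
    unfolding act_op_def by (rule pr_cong) (rule T_bracket[OF x y pr_closed])
  moreover have "act_op u (act_op v F) = pr (T u (T v (pr F)))" if "u \<in> A" "v \<in> A" for u v
    using pr_T[OF that(1) T_closed[OF that(2) pr_closed]] act_op_pr[of u "T v (pr F)"]
    by (simp add: act_op_def)
  ultimately show ?thesis using x y by (simp add: pr_linear)
qed

lemma act_op_unit_vec: "x \<in> B \<Longrightarrow> act_op x (unit_vec m) = unit_vec (act x m)"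
proof -
  assume x: "x \<in> B"
  have k: "Poly_Mapping.keys (tens \<one>\<^bsub>A.U\<^esub> m) \<subseteq> S" by (simp add: A.U_one_closed)
  have "act_op x (unit_vec m) = pr (T x (tens \<one>\<^bsub>A.U\<^esub> m))"
    using x B_subset pr_T[OF _ k] by (auto simp: unit_vec_def)
  also have "\<dots> = unit_vec (act x m)"
    unfolding unit_vec_def by (rule pr_cong) (rule T_unit[OF x])
  finally show ?thesis .
qed

lemma unit_vec_linear: "unit_vec (m + n) = unit_vec m + unit_vec n"
  "unit_vec (sm c m) = free_scale c (unit_vec m)" "unit_vec 0 = 0"
proof -
  show "unit_vec (m + n) = unit_vec m + unit_vec n"
    unfolding unit_vec_def pr_linear(1)[symmetric]
    by (rule pr_cong) (use R_add_right[OF A.U_one_closed, of m n] in \<open>simp add: diff_diff_eq\<close>)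
  show scale: "unit_vec (sm c m) = free_scale c (unit_vec m)" for c m
    unfolding unit_vec_def pr_linear(2)[symmetric]
    by (rule pr_cong) (rule R_scale_right[OF A.U_one_closed])
  show "unit_vec 0 = 0" using scale[of 0 0] by simp
qed

text \<open>This is \<open>generation\<close> transported along \<open>pr\<close>: the operators
  \<open>act_op\<close> produce the range of \<open>pr\<close> from the unit vectors.\<close>

lemma pr_induct:
  assumes add: "\<And>u v. Q u \<Longrightarrow> Q v \<Longrightarrow> Q (u + v)" and scale: "\<And>c u. Q u \<Longrightarrow> Q (free_scale c u)"
    and unit: "\<And>m. Q (unit_vec m)" and act: "\<And>x u. x \<in> A \<Longrightarrow> Q u \<Longrightarrow> pr u = u \<Longrightarrow> Q (act_op x u)"
  shows "Q (pr F)"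
proof -
  let ?P = "{F. Poly_Mapping.keys F \<subseteq> S \<and> Q (pr F)}"
  have Q0: "Q 0" using scale[OF unit, of 0] by simp
  note k = subspace_keys[of S, unfolded free.subspace_def]
  have "pr F \<in> ?P"
  proof (rule generation[OF pr_closed])
    show "free.subspace ?P"
      unfolding free.subspace_def
    proof (intro conjI ballI allI)
      show "0 \<in> ?P" using Q0 by (simp add: pr_linear)
      show "u + v \<in> ?P" if "u \<in> ?P" "v \<in> ?P" for u v
        using that k add by (auto simp: pr_linear)
      show "free_scale c u \<in> ?P" if "u \<in> ?P" for c u
        using that k scale by (auto simp: pr_linear)
    qed
    show "R \<subseteq> ?P" using R_subset Q0 by (auto simp: pr_R)
    show "tens \<one>\<^bsub>A.U\<^esub> m \<in> ?P" for m
      using unit[of m] by (simp add: unit_vec_def A.U_one_closed)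
    show "T x F \<in> ?P" if x: "x \<in> A" and F: "F \<in> ?P" for x F
    proof -
      have "Q (act_op x (pr F))" using F by (intro act x) auto
      then show ?thesis using x F T_closed[OF x] by (simp add: pr_T)
    qed
  qed
  then show ?thesis by simp
qed

end

context induced_hom
begin

lemma extension_pr: "Poly_Mapping.keys F \<subseteq> S \<Longrightarrow> extension (pr F) = extension F"
  using extension_R[OF pr_mod[of F]] by simp

lemma extension_unit_vec: "extension (unit_vec m) = \<psi> m"
proof -
  have "Poly_Mapping.keys (tens \<one>\<^bsub>A.U\<^esub> m) \<subseteq> S" by (simp add: A.U_one_closed)
  then show ?thesis unfolding unit_vec_def by (simp only: extension_pr extension_unit)
qed

lemma extension_act_op: "x \<in> A \<Longrightarrow> extension (act_op x F) = act' x (extension (pr F))"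
  unfolding act_op_def
  by (simp only: extension_pr[OF T_closed[OF _ pr_closed]] extension_T[OF _ pr_closed])

end

section \<open>The vertex operators\<close>

definition homogeneous_part ::
  "(int ^ 'r \<Rightarrow> 'g set) \<Rightarrow> int \<times> (int ^ 'r) \<Rightarrow> 'g set" where
  "homogeneous_part gr p = gr (snd p)"

definition homogeneous_nonneg_part ::
  "(int ^ 'r \<Rightarrow> 'g set) \<Rightarrow> int \<times> (int ^ 'r) \<Rightarrow> 'g :: zero set" where
  "homogeneous_nonneg_part gr p = (if 0 \<le> fst p then gr (snd p) else {0})"

context toroidal_setting
begin

abbreviation "LA \<equiv> (L_alg scl \<sigma> N :: ('g, 'r) toroidal set)"
abbreviation "LB \<equiv> (L_nonneg scl \<sigma> N :: ('g, 'r) toroidal set)"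
abbreviation "gC_sc \<equiv> gC_scale scl"
abbreviation "gC_ac \<equiv> (gC_act scl bracket \<kappa> lvl :: ('g, 'r) toroidal \<Rightarrow> _)"

lemma LA_eq: "LA = tor_part (homogeneous_part gr)"
  by (auto simp: L_alg_def tor_part_def homogeneous_part_def)

lemma LB_eq: "LB = tor_part (homogeneous_nonneg_part gr)"
proof -
  have "x \<in> LB \<longleftrightarrow> x \<in> tor_part (homogeneous_nonneg_part gr)" for x
  proof
    assume "x \<in> LB"
    then show "x \<in> tor_part (homogeneous_nonneg_part gr)"
      by (simp add: L_nonneg_def L_alg_def tor_part_def homogeneous_nonneg_part_def)
  next
    assume *: "x \<in> tor_part (homogeneous_nonneg_part gr)"
    have "Poly_Mapping.lookup (fst x) (m0, m) \<in> gr m \<and>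
        (m0 < 0 \<longrightarrow> Poly_Mapping.lookup (fst x) (m0, m) = 0)" for m0 m
      using lookup_tor_part[OF *, of "(m0, m)"] subspace_0[OF subspace_gr, of m]
      by (cases "0 \<le> m0") (simp_all add: homogeneous_nonneg_part_def)
    then show "x \<in> LB" by (simp add: L_nonneg_def L_alg_def)
  qed
  then show ?thesis by blast
qed

lemma homogeneous_part_subspace: "subspace (homogeneous_part gr p)"
  by (simp add: homogeneous_part_def subspace_gr)

lemma homogeneous_part_bracket: "a \<in> homogeneous_part gr p \<Longrightarrow> b \<in> homogeneous_part gr q \<Longrightarrow>
    bracket a b \<in> homogeneous_part gr (p + q)"
  by (simp add: homogeneous_part_def bracket_gr)

lemma homogeneous_nonneg_part_subspace: "subspace (homogeneous_nonneg_part gr p)"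
  by (simp add: homogeneous_nonneg_part_def subspace_gr)

lemma homogeneous_nonneg_part_bracket:
  assumes "a \<in> homogeneous_nonneg_part gr p" "b \<in> homogeneous_nonneg_part gr q"
  shows "bracket a b \<in> homogeneous_nonneg_part gr (p + q)"
proof (cases "0 \<le> fst p \<and> 0 \<le> fst q")
  case True
  then show ?thesis using assms by (simp add: homogeneous_nonneg_part_def bracket_gr)
next
  case False
  then have "bracket a b = 0"
    using assms by (auto simp: homogeneous_nonneg_part_def bracket_simps split: if_splits)
  then show ?thesis
    using subspace_0[OF homogeneous_nonneg_part_subspace] by simp
qed

definition gC_mode :: "int \<times> (int ^ 'r) \<Rightarrow> 'g \<Rightarrow> 'g \<times> complex \<Rightarrow> 'g \<times> complex" where
  "gC_mode p a b = (if fst p = 0 then bracket a (fst b) else 0, if fst p = 1 then \<kappa> a (fst b) * lvl else 0)"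

lemma gC_act_eq: "gC_ac = tor_act gC_sc gC_mode"
  by (intro ext) (simp add: gC_act_def tor_act_def gC_mode_def Let_def)

lemma complex_vector_space_gC: "complex_vector_space gC_sc"
  by unfold_locales
    (simp_all add: gC_scale_def scale_right_distrib scale_left_distrib distrib_left distrib_right)

lemma lie_representation_gC: "lie_representation tor_sc tor_br LB gC_sc gC_ac UNIV"
  unfolding LB_eq gC_act_eq
proof (rule lie_representation_tor[where X = "homogeneous_nonneg_part gr" and E = UNIV and A = gC_mode,
      OF homogeneous_nonneg_part_subspace homogeneous_nonneg_part_bracket
      complex_vector_space_gC])
  interpret gC: complex_vector_space gC_sc by (rule complex_vector_space_gC)
  show "gC.subspace UNIV" by simp
next
  fix p q :: "int \<times> (int ^ 'r)" and a b e
  assume a: "a \<in> homogeneous_nonneg_part gr p" and b: "b \<in> homogeneous_nonneg_part gr q"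
  show "gC_mode (p + q) (bracket a b) e +
      gC_sc ((if p + q = 0 then of_int (fst p) * \<kappa> a b else 0) * lvl) e =
      gC_mode p a (gC_mode q b e) - gC_mode q b (gC_mode p a e)"
  proof (cases "0 \<le> fst p \<and> 0 \<le> fst q")
    case True
    \<comment> \<open>The degrees are nonnegative, so a sum of 0 or 1 leaves few cases. The central
      term has the factor fst p = 0, and the case of degrees 0 and 1 is the invariance of the
      form.\<close>
    then have "fst p + fst q = 0 \<longleftrightarrow> fst p = 0 \<and> fst q = 0"
      "fst p + fst q = 1 \<longleftrightarrow> (fst p = 1 \<and> fst q = 0) \<or> (fst p = 0 \<and> fst q = 1)" by auto
    moreover have "p + q = 0 \<Longrightarrow> fst p + fst q = 0" by (metis fst_add fst_zero)
    moreover have "\<kappa> (bracket a b) (fst e) = - \<kappa> b (bracket a (fst e))"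
    proof -
      have "\<kappa> (bracket a b) (fst e) = \<kappa> (scl (-1) (bracket b a)) (fst e)"
        using bracket_commute[of a b] by simp
      then show ?thesis unfolding kappa_simps kappa_invariant by simp
    qed
    ultimately show ?thesis
      by (auto simp: gC_mode_def gC_scale_def bracket_simps kappa_simps kappa_invariant
          bracket_bracket prod_eq_iff)
  next
    case False
    then have "a = 0 \<or> b = 0"
      using a b by (auto simp: homogeneous_nonneg_part_def split: if_splits)
    then show ?thesis
      by (auto simp: gC_mode_def gC_scale_def bracket_simps kappa_simps prod_eq_iff)
  qed
qed (auto simp: gC_mode_def gC_scale_def bracket_simps kappa_simps algebra_simps
    scale_right_distrib scale_left_distrib)

section \<open>Modes of the currents on the induced module\<close>

sublocale ind: induced tor_sc tor_br LA LB gC_sc gC_ac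
proof (intro induced.intro induced_axioms.intro)
  show "enveloping tor_sc tor_br LA"
    unfolding LA_eq by (rule enveloping_tor_part[where X = "homogeneous_part gr", OF homogeneous_part_subspace homogeneous_part_bracket])
  show "lie_representation tor_sc tor_br LB gC_sc gC_ac UNIV" by (rule lie_representation_gC)
  show "LB \<subseteq> LA" by (auto simp: L_nonneg_def)
qed

abbreviation "pr \<equiv> ind.pr"
abbreviation "unit_vec \<equiv> ind.unit_vec"
abbreviation "act_op \<equiv> ind.act_op"

definition Aop where
  "Aop a m p F = act_op (tor_elem (proj p a) m p) F"

lemma tor_elem_LA: "a \<in> gr p \<Longrightarrow> tor_elem a m p \<in> LA"
  unfolding LA_eq tor_elem_def
  by (rule single_tor_part[OF homogeneous_part_subspace]) (simp add: homogeneous_part_def)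

lemma tor_elem_LB: "a \<in> gr p \<Longrightarrow> 0 \<le> m \<Longrightarrow> tor_elem a m p \<in> LB"
  unfolding LB_eq tor_elem_def
  by (rule single_tor_part[OF homogeneous_nonneg_part_subspace])
    (simp add: homogeneous_nonneg_part_def)

lemma central_LB: "(0, c) \<in> LB"
  by (simp add: L_nonneg_def L_alg_def subspace_0[OF subspace_gr])

lemma central_LA: "(0, c) \<in> LA"
  using central_LB by (simp add: L_nonneg_def)

lemma act_op_zero: "act_op 0 F = 0"
  using ind.act_op_scale[OF central_LA, of 0 0 F] by (simp add: ind.A.scale_zero_left)

lemma gC_act_single: "gC_ac (tor_elem a m p) b = gC_mode (m, p) a b"
  by (cases "a = 0")
    (simp_all add: gC_act_eq tor_act_def tor_elem_def gC_mode_def gC_scale_def bracket_simps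
      kappa_simps zero_prod_def)

text \<open>The scalar is read off on the unit vectors and propagates, because the central element
  commutes with all operators \<open>act_op x\<close>.\<close>

lemma act_op_central: "act_op (0, c) F = free_scale (c * lvl) (pr F)"
proof -
  have "act_op (0, c) (pr F) = free_scale (c * lvl) (pr F)"
  proof (rule ind.pr_induct[where Q = "\<lambda>u. act_op (0, c) u = free_scale (c * lvl) u"])
    fix m
    have "gC_ac (0, c) m = gC_sc (c * lvl) m"
      by (simp add: gC_act_eq tor_act_def)
    then show "act_op (0, c) (unit_vec m) = free_scale (c * lvl) (unit_vec m)"
      by (simp add: ind.act_op_unit_vec[OF central_LB] ind.unit_vec_linear)
  next
    fix x u assume x: "x \<in> LA" and u: "act_op (0, c) u = free_scale (c * lvl) u"
    have "tor_br (0, c) x = 0" by (simp add: tor_br_eq)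
    then have "act_op (0, c) (act_op x u) = act_op x (act_op (0, c) u)"
      using ind.act_op_bracket[OF central_LA x, of c u] by (simp add: act_op_zero)
    then show "act_op (0, c) (act_op x u) = free_scale (c * lvl) (act_op x u)"
      by (simp add: u ind.act_op_linear)
  qed (simp_all add: ind.act_op_linear free.scale_right_distrib mult.commute)
  then show ?thesis by simp
qed

lemma act_op_sum: "(\<And>k. k \<in> K \<Longrightarrow> f k \<in> LA) \<Longrightarrow> act_op (sum f K) F = (\<Sum>k\<in>K. act_op (f k) F)"
proof (induction K rule: infinite_finite_induct)
  case (insert k K)
  have "sum f K \<in> LA"
    unfolding LA_eq by (rule sum_tor_part[OF homogeneous_part_subspace])
      (use insert in \<open>simp add: LA_eq\<close>)
  then show ?case using insert by (simp add: ind.act_op_add)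
qed (simp_all add: act_op_zero)

lemma act_op_decompose:
  assumes x: "x \<in> LA"
  shows "act_op x F = (\<Sum>p\<in>Poly_Mapping.keys (fst x).
    Aop (Poly_Mapping.lookup (fst x) p) (fst p) (snd p) F) + free_scale (snd x * lvl) (pr F)"
proof -
  let ?e = "\<lambda>p. tor_elem (Poly_Mapping.lookup (fst x) p) (fst p) (snd p) :: ('g, 'r) toroidal"
  have lk: "Poly_Mapping.lookup (fst x) p \<in> gr (snd p)" for p
    using lookup_tor_part[of x "homogeneous_part gr" p] x by (simp add: LA_eq homogeneous_part_def)
  have fst_sum: "fst (sum f K) = (\<Sum>k\<in>K. fst (f k))" "snd (sum f K) = (\<Sum>k\<in>K. snd (f k))"
    for f :: "_ \<Rightarrow> ('g, 'r) toroidal" and K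
    by (induction K rule: infinite_finite_induct) auto
  have "fst x = (\<Sum>p\<in>Poly_Mapping.keys (fst x).
      Poly_Mapping.single p (Poly_Mapping.lookup (fst x) p))"
    by (rule poly_mapping_sum_single)
  from this[symmetric] have x_eq: "(\<Sum>p\<in>Poly_Mapping.keys (fst x). ?e p) + (0, snd x) = x"
    unfolding prod_eq_iff fst_add snd_add fst_sum tor_elem_def fst_conv snd_conv by simp
  have S: "(\<Sum>p\<in>Poly_Mapping.keys (fst x). ?e p) \<in> LA"
    unfolding LA_eq by (rule sum_tor_part[OF homogeneous_part_subspace])
      (rule tor_elem_LA[OF lk, unfolded LA_eq])
  have "act_op x F = act_op ((\<Sum>p\<in>Poly_Mapping.keys (fst x). ?e p) + (0, snd x)) F"
    unfolding x_eq ..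
  also have "\<dots> = act_op (\<Sum>p\<in>Poly_Mapping.keys (fst x). ?e p) F + act_op (0, snd x) F"
    by (rule ind.act_op_add[OF S central_LA])
  also have "act_op (\<Sum>p\<in>Poly_Mapping.keys (fst x). ?e p) F =
      (\<Sum>p\<in>Poly_Mapping.keys (fst x). act_op (?e p) F)"
    by (rule act_op_sum) (rule tor_elem_LA[OF lk])
  finally show ?thesis by (simp add: Aop_def proj_gr_same[OF lk] act_op_central)
qed

text \<open>The mode of \<open>b\<close> at index q involves only \<open>proj q b\<close>;
  \<open>proj_bracket\<close> and \<open>kappa_proj\<close> convert the bracket and the form with
  this component into those with \<open>b\<close>.\<close>

lemma Aop_commutator:
  assumes a: "a \<in> gr p"
  shows "Aop a m p (Aop b n q w) - Aop b n q (Aop a m p w) =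
    Aop (bracket a b) (m + n) (p + q) w +
    free_scale (if m + n = 0 \<and> p + q = 0 then of_int m * \<kappa> a b * lvl else 0) (pr w)"
proof -
  let ?c = "if m + n = 0 \<and> p + q = 0 then of_int m * \<kappa> a b else 0"
  have k: "\<kappa> a (proj q b) = \<kappa> a b" if "p + q = 0"
  proof -
    have "q = - p" using that by (simp add: eq_neg_iff_add_eq_0 add.commute)
    then show ?thesis using kappa_proj[OF a] by simp
  qed
  \<comment> \<open>If \<open>proj q b\<close> is 0, the support of its element is empty and
    \<open>tor_br\<close> has no terms at all, so the central term on the other side has to vanish
    too.\<close>
  have k0: "\<kappa> a b = 0" if "p + q = 0" "proj q b = 0"
    using k[OF that(1)] that(2) by (simp add: kappa_simps)
  have e: "tor_br (tor_elem a m p) (tor_elem (proj q b) n q) =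
      tor_elem (proj (p + q) (bracket a b)) (m + n) (p + q) + (0, ?c)"
    unfolding proj_bracket[OF a]
    by (cases "a = 0"; cases "proj q b = 0")
      (auto simp: tor_br_eq tor_elem_def bracket_simps kappa_simps zero_prod_def k k0)
  have "Aop a m p (Aop b n q w) - Aop b n q (Aop a m p w) =
      act_op (tor_br (tor_elem a m p) (tor_elem (proj q b) n q)) w"
    unfolding Aop_def proj_gr_same[OF a]
    by (rule ind.act_op_bracket[symmetric]) (rule tor_elem_LA a proj_mem)+
  also have "\<dots> = Aop (bracket a b) (m + n) (p + q) w + free_scale (?c * lvl) (pr w)"
    unfolding e
    by (simp only: ind.act_op_add[OF tor_elem_LA[OF proj_mem] central_LA] act_op_central Aop_def)
  finally show ?thesis by (simp only: if_distrib[of "\<lambda>c. c * lvl"] mult_zero_left)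
qed

lemma Aop_linear: "Aop a m p (v + w) = Aop a m p v + Aop a m p w"
  "Aop a m p (free_scale c w) = free_scale c (Aop a m p w)" "Aop a m p 0 = 0"
  "Aop (a + b) m p w = Aop a m p w + Aop b m p w"
  "Aop (scl c a) m p w = free_scale c (Aop a m p w)"
  by (simp_all add: Aop_def ind.act_op_linear proj_simps tor_elem_simps ind.act_op_add
      ind.act_op_scale tor_elem_LA proj_mem)

lemma Aop_unit_vec: "0 \<le> m \<Longrightarrow> Aop a m p (unit_vec b) = unit_vec (gC_mode (m, p) (proj p a) b)"
  unfolding Aop_def
  by (simp add: ind.act_op_unit_vec[OF tor_elem_LB[OF proj_mem]] gC_act_single)

text \<open>The bound is uniform in \<open>a\<close> because the induction step passes from
  \<open>a\<close> to brackets with \<open>a\<close>.\<close>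

lemma Aop_truncated: "\<exists>n. \<forall>a. \<forall>m\<ge>n. \<forall>p. Aop a m p F = 0"
proof -
  define Q where "Q = (\<lambda>u. \<exists>n. \<forall>a. \<forall>m\<ge>n. \<forall>p. Aop a m p u = 0)"
  have Q_add: "Q (u + v)" if Qu: "Q u" and Qv: "Q v" for u v
  proof -
    obtain k where "\<forall>a. \<forall>m\<ge>k. \<forall>p. Aop a m p u = 0" using Qu unfolding Q_def by blast
    moreover obtain l where "\<forall>a. \<forall>m\<ge>l. \<forall>p. Aop a m p v = 0" using Qv unfolding Q_def by blast
    ultimately have "\<forall>a. \<forall>m\<ge>max k l. \<forall>p. Aop a m p (u + v) = 0" by (simp add: Aop_linear)
    then show ?thesis unfolding Q_def by blast
  qed
  have Q_scale: "Q (free_scale c u)" if "Q u" for c u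
    using that unfolding Q_def by (auto simp: Aop_linear)
  have Q_sum: "Q (sum f K)" if "\<And>k. k \<in> K \<Longrightarrow> Q (f k)" for f and K :: "(int \<times> (int ^ 'r)) set"
    using that
  proof (induction K rule: infinite_finite_induct)
    case (insert k K)
    then show ?case using Q_add by simp
  qed (simp_all add: Q_def Aop_linear)
  have "Q (pr F)"
  proof (rule ind.pr_induct[OF Q_add Q_scale])
    fix b
    have "gC_mode (m, p) a b = 0" if "2 \<le> m" for m p a
      using that by (simp add: gC_mode_def zero_prod_def)
    then have "\<forall>a. \<forall>m\<ge>2. \<forall>p. Aop a m p (unit_vec b) = 0"
      by (simp add: Aop_unit_vec ind.unit_vec_linear)
    then show "Q (unit_vec b)" unfolding Q_def by blast
  next
    fix x u assume x: "x \<in> LA" and u: "Q u" "pr u = u"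
    have "Q (Aop b k q u)" if b: "b \<in> gr q" for b k q
    proof -
      obtain n where n: "\<And>a m p. n \<le> m \<Longrightarrow> Aop a m p u = 0" using u(1) unfolding Q_def by blast
      \<comment> \<open>The three bounds make the mode m of \<open>a\<close> and the mode k + m of
        the bracket vanish on u, and keep k + m away from 0, where the central term sits.\<close>
      have "Aop a m p (Aop b k q u) = 0" if m: "max n (max (n - k) (1 - k)) \<le> m" for a m p
      proof -
        have 1: "Aop a m p u = 0" "Aop (bracket b a) (k + m) (q + p) u = 0"
          using m by (auto intro!: n)
        have "Aop b k q (Aop a m p u) - Aop a m p (Aop b k q u) = 0"
          using m by (subst Aop_commutator[OF b]) (simp add: 1)
        then show ?thesis by (simp add: 1 Aop_linear)
      qed
      then show ?thesis unfolding Q_def by blast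
    qed
    moreover have "Poly_Mapping.lookup (fst x) p \<in> gr (snd p)" for p
      using lookup_tor_part[of x "homogeneous_part gr" p] x by (simp add: LA_eq homogeneous_part_def)
    ultimately show "Q (act_op x u)"
      unfolding act_op_decompose[OF x] by (intro Q_add Q_sum Q_scale) (simp_all add: u)
  qed
  then show ?thesis unfolding Q_def by (simp add: Aop_def)
qed

sublocale cm: current_modes free_scale Aop pr bracket \<kappa> lvl gr
proof unfold_locales
  show "\<exists>n. \<forall>m\<ge>n. \<forall>p. Aop a m p w = 0" for a w using Aop_truncated[of w] by blast
  show "Aop a m p (Aop b n q w) - Aop b n q (Aop a m p w) = Aop (bracket a b) (m + n) (p + q) w +
      free_scale (if m + n = 0 \<and> p + q = 0 then of_int m * \<kappa> a b * lvl else 0) (pr w)"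
    if "a \<in> gr p" for a p m b n q w using that by (rule Aop_commutator)
qed (simp_all add: Aop_linear ind.pr_linear, simp_all add: Aop_def)

section \<open>The series as a module over the toroidal algebra\<close>

definition series_scale :: "complex \<Rightarrow> (int \<Rightarrow> int ^ 'r \<Rightarrow> 'f \<Rightarrow> ('s \<Rightarrow>\<^sub>0 complex)) \<Rightarrow> int \<Rightarrow> int ^ 'r \<Rightarrow> 'f \<Rightarrow> _" where
  "series_scale c \<phi> = (\<lambda>n q w. free_scale c (\<phi> n q w))"

definition series_mode where
  "series_mode p a = cm.M a (fst p) (snd p)"

lemma complex_vector_space_series: "complex_vector_space series_scale"
  by unfold_locales
    (intro ext; simp add: series_scale_def free.scale_right_distrib free.scale_left_distrib)+

lemma subspace_series: "Modules.module.subspace series_scale cm.series"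
proof -
  interpret sv: complex_vector_space series_scale by (rule complex_vector_space_series)
  show ?thesis
    unfolding sv.subspace_def
  proof (intro conjI ballI allI)
    show "0 \<in> cm.series" unfolding cm.series_def by (simp add: ind.pr_linear)
  next
    fix \<phi> \<psi> assume \<phi>: "\<phi> \<in> cm.series" and \<psi>: "\<psi> \<in> cm.series"
    have "\<exists>k. \<forall>n\<ge>k. \<forall>q. (\<phi> + \<psi>) n q w = 0" for w
    proof -
      obtain k l where "\<forall>n\<ge>k. \<forall>q. \<phi> n q w = 0" "\<forall>n\<ge>l. \<forall>q. \<psi> n q w = 0"
        using cm.series_trunc[OF \<phi>] cm.series_trunc[OF \<psi>] by metis
      then have "\<forall>n\<ge>max k l. \<forall>q. (\<phi> + \<psi>) n q w = 0" by simp
      then show ?thesis by blast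
    qed
    then show "\<phi> + \<psi> \<in> cm.series"
      unfolding cm.series_def
      by (simp add: cm.series_add[OF \<phi>] cm.series_add[OF \<psi>] cm.series_scale[OF \<phi>]
          cm.series_scale[OF \<psi>] free.scale_right_distrib ind.pr_linear cm.pr_series[OF \<phi>]
          cm.pr_series[OF \<psi>] cm.series_pr[OF \<phi>] cm.series_pr[OF \<psi>])
  next
    fix c \<phi> assume \<phi>: "\<phi> \<in> cm.series"
    have "\<exists>k. \<forall>n\<ge>k. \<forall>q. series_scale c \<phi> n q w = 0" for w
      using cm.series_trunc[OF \<phi>, of w] by (auto simp: series_scale_def)
    then show "series_scale c \<phi> \<in> cm.series"
      unfolding cm.series_def
      by (simp add: series_scale_def cm.series_add[OF \<phi>] cm.series_scale[OF \<phi>]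
          free.scale_right_distrib ind.pr_linear cm.pr_series[OF \<phi>] cm.series_pr[OF \<phi>] mult.commute)
  qed
qed

lemma M_scale_left:
  assumes \<phi>: "\<phi> \<in> cm.series"
  shows "cm.M (scl c a) j p \<phi> = series_scale c (cm.M a j p \<phi>)"
proof (intro ext)
  fix n q w
  show "cm.M (scl c a) j p \<phi> n q w = series_scale c (cm.M a j p \<phi>) n q w"
    unfolding cm.M_def series_scale_def Aop_linear(5) cm.series_scale[OF \<phi>]
      cm.bsum_scale[OF cm.ev0_Aop_series[OF \<phi>]] cm.bsum_scale[OF cm.ev0_series_Aop[OF \<phi>]]
      free.scale_right_diff_distrib by (simp only: free.scale_left_commute)
qed

lemma lie_representation_series:
  "lie_representation tor_sc tor_br LA series_scale (tor_act series_scale series_mode) cm.series"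
proof -
  have "lie_representation tor_sc tor_br (tor_part (homogeneous_part gr)) series_scale
      (tor_act series_scale series_mode) cm.series"
  proof (rule lie_representation_tor[where X = "homogeneous_part gr" and E = cm.series and A = series_mode,
      OF homogeneous_part_subspace homogeneous_part_bracket complex_vector_space_series subspace_series])
  fix p q :: "int \<times> (int ^ 'r)" and a b \<phi>
  assume a: "a \<in> homogeneous_part gr p" and b: "b \<in> homogeneous_part gr q" and \<phi>: "\<phi> \<in> cm.series"
  have a': "a \<in> gr (snd p)" using a by (simp add: homogeneous_part_def)
  have pq: "p + q = 0 \<longleftrightarrow> fst p + fst q = 0 \<and> snd p + snd q = 0"
    by (simp add: prod_eq_iff)
  show "series_mode (p + q) (bracket a b) \<phi> +
      series_scale ((if p + q = 0 then of_int (fst p) * \<kappa> a b else 0) * lvl) \<phi> =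
      series_mode p a (series_mode q b \<phi>) - series_mode q b (series_mode p a \<phi>)"
  proof (intro ext)
    fix n r w
    have "(if p + q = 0 then of_int (fst p) * \<kappa> a b else 0) * lvl =
        (if fst p + fst q = 0 \<and> snd p + snd q = 0 then of_int (fst p) * \<kappa> a b * lvl else 0)"
      by (simp add: pq)
    then show "(series_mode (p + q) (bracket a b) \<phi> +
        series_scale ((if p + q = 0 then of_int (fst p) * \<kappa> a b else 0) * lvl) \<phi>) n r w =
        (series_mode p a (series_mode q b \<phi>) - series_mode q b (series_mode p a \<phi>)) n r w"
      using cm.M_bracket[OF \<phi> a', of "fst p" b "fst q" "snd q" n r w]
      by (simp add: series_mode_def series_scale_def)
  qed
qed (simp_all add: series_mode_def cm.M_series cm.M_add cm.M_add_left M_scale_left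
    cm.M_scale series_scale_def[abs_def])
  then show ?thesis unfolding LA_eq[symmetric] .
qed

definition current where "current b = cm.current (fst b) (snd b)"

lemma current_linear: "current (b + b') = current b + current b'"
  "current (gC_sc c b) = series_scale c (current b)" "current 0 = 0"
  by (auto simp: current_def cm.current_def fun_eq_iff Aop_linear gC_scale_def series_scale_def
      free.scale_left_distrib free.scale_right_distrib Aop_linear(5)[of 0 0, simplified])

text \<open>A degree (k, p) that occurs in an element of \<open>LB\<close> has k >= 0, and there the
  claim is \<open>cm.M_current\<close>.\<close>

lemma current_act:
  assumes x: "x \<in> LB"
  shows "current (gC_ac x b) = tor_act series_scale series_mode x (current b)"
proof -
  have current_sum: "current (sum f K) = (\<Sum>k\<in>K. current (f k))"
    for f :: "int \<times> (int ^ 'r) \<Rightarrow> 'g \<times> complex" and K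
    by (induction K rule: infinite_finite_induct) (simp_all add: current_linear)
  have "current (gC_mode p (Poly_Mapping.lookup (fst x) p) b) =
      series_mode p (Poly_Mapping.lookup (fst x) p) (current b)"
    if p: "p \<in> Poly_Mapping.keys (fst x)" for p
  proof -
    let ?a = "Poly_Mapping.lookup (fst x) p"
    have "?a \<in> homogeneous_nonneg_part gr p"
      using lookup_tor_part[of x "homogeneous_nonneg_part gr" p] x by (simp add: LB_eq)
    moreover have "?a \<noteq> 0" using p by (simp add: in_keys_iff)
    ultimately have a: "0 \<le> fst p" "?a \<in> gr (snd p)"
      by (auto simp: homogeneous_nonneg_part_def split: if_splits)
    then obtain k where k: "fst p = int k" by (metis nonneg_int_cases)
    show ?thesis
      unfolding current_def series_mode_def k cm.M_current[OF a(2)]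
      by (simp add: gC_mode_def k)
  qed
  then have "(\<Sum>p\<in>Poly_Mapping.keys (fst x). current (gC_mode p (Poly_Mapping.lookup (fst x) p) b)) =
      (\<Sum>p\<in>Poly_Mapping.keys (fst x). series_mode p (Poly_Mapping.lookup (fst x) p) (current b))"
    by (intro sum.cong refl)
  then show ?thesis
    unfolding gC_act_eq tor_act_def current_linear current_sum by simp
qed

sublocale hom: induced_hom tor_sc tor_br LA LB gC_sc gC_ac series_scale
  "tor_act series_scale series_mode" cm.series current
proof (intro induced_hom.intro induced_hom_axioms.intro)
  show "induced tor_sc tor_br LA LB gC_sc gC_ac" by (rule ind.induced_axioms)
  show "lie_representation tor_sc tor_br LA series_scale (tor_act series_scale series_mode) cm.series"
    by (rule lie_representation_series)
  show "current m \<in> cm.series" for m unfolding current_def by (rule cm.current_series)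
qed (rule current_linear current_act; assumption?)+

section \<open>Vertex operators on the model and their identities\<close>

definition Yw where
  "Yw u n q w = hom.extension (pr u) n q w"

lemma Yw_eq: "Yw u = hom.extension (pr u)"
  by (intro ext) (simp add: Yw_def)

lemma Yw_series: "Yw u \<in> cm.series"
  unfolding Yw_eq by (rule hom.extension_closed[OF ind.pr_closed])

lemma Yw_unit_vec:
  "Yw (unit_vec b) n q w = Aop (fst b) n q w + (if n = -1 \<and> q = 0 then free_scale (snd b) (pr w) else 0)"
  by (simp add: Yw_def hom.extension_unit_vec current_def cm.current_def)

lemma Yw_pr_left: "Yw (pr u) = Yw u"
  and Yw_pr_right: "Yw u n q (pr w) = Yw u n q w"
  and pr_Yw: "pr (Yw u n q w) = Yw u n q w"
  by (simp_all add: Yw_eq cm.series_pr[OF Yw_series[unfolded Yw_eq]]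
      cm.pr_series[OF Yw_series[unfolded Yw_eq]])

lemma Yw_add_left: "Yw (u + v) = Yw u + Yw v"
  and Yw_scale_left: "Yw (free_scale c u) = series_scale c (Yw u)"
  by (simp_all add: Yw_eq ind.pr_linear)

sublocale vm: vertex_modes free_scale Yw
  by unfold_locales
    (simp_all add: Yw_add_left Yw_scale_left series_scale_def cm.series_add[OF Yw_series]
      cm.series_scale[OF Yw_series] cm.series_trunc[OF Yw_series])

lemma Aop_proj: "Aop (proj p a) m p w = Aop a m p w"
  by (simp add: Aop_def proj_gr_same[OF proj_mem])

lemma Aop_0_left: "Aop 0 m p w = 0"
  using Aop_linear(4)[of 0 0 m p w] by simp

lemma M_zero_left: "cm.M 0 m p \<phi> = (\<lambda>n q w. 0)" if "\<phi> \<in> cm.series"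
proof -
  have "cm.bsum c z (\<lambda>i. 0) = 0" for c z by (simp add: cm.bsum_def)
  then show ?thesis by (intro ext) (simp add: cm.M_def Aop_0_left cm.series_0[OF that])
qed

text \<open>This is the equivariance of the extension, since a homogeneous element acts on series by
  \<open>cm.M\<close>. It becomes the iterate formula for the generators.\<close>

lemma Yw_Aop: "Yw (Aop a m p v) = cm.M a m p (Yw v)"
proof -
  have "tor_act series_scale series_mode (tor_elem b m p) \<phi> = cm.M b m p \<phi>"
    if "\<phi> \<in> cm.series" for b \<phi>
    by (cases "b = 0")
      (auto simp: tor_act_def tor_elem_def series_mode_def series_scale_def fun_eq_iff
        M_zero_left[OF that])
  from this[OF Yw_series] have "Yw (Aop a m p v) = cm.M (proj p a) m p (Yw v)"
    by (simp add: Yw_eq Aop_def hom.extension_act_op[OF tor_elem_LA[OF proj_mem]])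
  also have "\<dots> = cm.M a m p (Yw v)"
    by (intro ext) (simp add: cm.M_def Aop_proj)
  finally show ?thesis .
qed

lemma iterate_formula_unit_vec: "vm.iterate_formula (unit_vec b) v"
  unfolding vm.iterate_formula_def
proof (intro allI)
  fix p q :: "int ^ 'r" and l n w
  let ?f = "\<lambda>i. Yw v (n + int i) (q - p) w"
  \<comment> \<open>The vacuum part of the generator. It contributes only at i = l + 1, where the
    binomial coefficient of l over l + 1 vanishes for l >= 0, and there is no such index for l < -1;
    so it survives for l = -1 alone.\<close>
  let ?E = "\<lambda>i. if l - int i = - 1 \<and> p = 0 then free_scale (snd b) (?f i) else 0"
  have left: "Yw (unit_vec b) (l - int i) p (?f i) = Aop (fst b) (l - int i) p (?f i) + ?E i" for i
    by (simp add: Yw_unit_vec pr_Yw)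
  have right: "Yw (unit_vec b) (int i) p w = Aop (fst b) (int i) p w" for i
    by (simp add: Yw_unit_vec)
  have evE: "ev0 ?E"
    unfolding ev0_def by (rule exI[of _ "nat (l + 2)"]) auto
  have E: "cm.bsum (-1) l ?E = (if l = -1 \<and> p = 0 then free_scale (snd b) (Yw v n q w) else 0)"
  proof (cases "p = 0")
    case True
    have "cm.bsum (-1) l ?E = free_scale (bcoef (-1) l (nat (l + 1))) (?E (nat (l + 1)))"
      by (rule cm.bsum_eq_single) auto
    also have "\<dots> = (if l = -1 \<and> p = 0 then free_scale (snd b) (Yw v n q w) else 0)"
    proof (cases "0 \<le> l")
      case True
      then obtain k where k: "l = int k" by (metis nonneg_int_cases)
      then have "bcoef (- 1 :: complex) l (nat (l + 1)) = 0" by (simp add: bcoef_eq_0)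
      then show ?thesis using True by simp
    next
      case False
      then show ?thesis using \<open>p = 0\<close> by auto
    qed
    finally show ?thesis .
  qed (simp add: cm.bsum_def)
  have "Yw (Yw (unit_vec b) l p v) n q w = Yw (Aop (fst b) l p v) n q w +
      (if l = -1 \<and> p = 0 then free_scale (snd b) (Yw v n q w) else 0)"
    by (simp add: Yw_unit_vec[of b l p v] Yw_add_left Yw_scale_left series_scale_def Yw_pr_left)
  also have "\<dots> = vm.commutator_side (unit_vec b) v p q l 0 n w"
    unfolding Yw_Aop cm.M_def vm.commutator_side_def
    by (simp add: left right cm.bsum_add[OF cm.ev0_Aop_series[OF Yw_series] evE] E)
  finally show "Yw (Yw (unit_vec b) l p v) n q w = vm.commutator_side (unit_vec b) v p q l 0 n w" .
qed

lemma Yw_unit_unit: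
  "Yw (unit_vec b) (int i) p (unit_vec b') = unit_vec (gC_mode (int i, p) (proj p (fst b)) b')"
  by (simp add: Yw_unit_vec Aop_unit_vec)

lemma commutator_formula_unit_vec: "vm.commutator_formula (unit_vec b) (unit_vec b')"
  unfolding vm.commutator_formula_def
proof (intro allI)
  fix p q :: "int ^ 'r" and m n w
  let ?a = "proj p (fst b)"
  have Y: "Yw (unit_vec b) n q w = Aop (fst b) n q w + free_scale (if n = -1 \<and> q = 0 then snd b else 0) (pr w)"
    for b n q w by (simp add: Yw_unit_vec)
  \<comment> \<open>Only the products with i = 0 and i = 1 can be nonzero. They give the bracket and
    the form, which are the two terms of the commutator.\<close>
  have "vm.iterate_side (unit_vec b) (unit_vec b') p q 0 m n w = (\<Sum>i<2. free_scale (bcoef 1 m i)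
      (Yw (unit_vec (gC_mode (int i, p) ?a b')) (m + n - int i) q w))"
    unfolding vm.iterate_side_def add_0 Yw_unit_unit
    by (rule cm.bsum_eq) (simp add: gC_mode_def ind.unit_vec_linear flip: zero_prod_def)
  also have "\<dots> = Aop (bracket ?a (fst b')) (m + n) q w +
      free_scale (if m + n = 0 \<and> q = 0 then of_int m * \<kappa> ?a (fst b') * lvl else 0) (pr w)"
    by (auto simp: numeral_2_eq_2 gC_mode_def Yw_unit_vec bcoef_def Aop_0_left)
  also have "\<dots> = Aop (fst b) m p (Aop (fst b') n (q - p) w) - Aop (fst b') n (q - p) (Aop (fst b) m p w)"
    using Aop_commutator[OF proj_mem, of p "fst b" m "fst b'" n "q - p" w] by (simp add: Aop_proj)
  finally show "Yw (unit_vec b) m p (Yw (unit_vec b') n (q - p) w) -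
      Yw (unit_vec b') n (q - p) (Yw (unit_vec b) m p w) =
      vm.iterate_side (unit_vec b) (unit_vec b') p q 0 m n w"
    by (simp add: Y Aop_linear ind.pr_linear cm.Aop_pr cm.pr_Aop free.scale_right_distrib mult.commute)
qed

lemma Yw_embed: "Yw (unit_vec (a, 0)) n q w = Aop a n q w"
  by (simp add: Yw_unit_vec)

lemma pr_generated: "pr F \<in> vm.generated (range unit_vec)"
proof -
  let ?Q = "\<lambda>w. w \<in> vm.generated (range unit_vec) \<and> pr w = w"
  have "?Q (pr F)"
  proof (rule ind.pr_induct[where Q = ?Q])
    fix x u assume x: "x \<in> LA" and u: "?Q u"
    have A: "Aop b k q u \<in> vm.generated (range unit_vec)" for b k q
      using vm.generated.mode[of "unit_vec (b, 0)" "range unit_vec" u k q] u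
      by (simp add: Yw_embed)
    have S: "(\<Sum>k\<in>K. f k) \<in> vm.generated (range unit_vec)"
      if "\<And>k. f k \<in> vm.generated (range unit_vec)" for f and K :: "(int \<times> (int ^ 'r)) set"
    proof (induction K rule: infinite_finite_induct)
      case (insert k K)
      then show ?case using that by (simp add: vm.generated.add)
    qed (use vm.generated.scale[of u "range unit_vec" 0] u in simp_all)
    have "act_op x u \<in> vm.generated (range unit_vec)"
      unfolding act_op_decompose[OF x]
      using u by (intro vm.generated.add vm.generated.scale S A) simp
    then show "?Q (act_op x u)" by simp
  qed (auto intro: vm.generated.intros simp: ind.pr_linear)
  then show ?thesis ..
qed

text \<open>The image of g + C is closed under nonnegative modes, as g + C is a module over
  \<open>LB\<close>; this is the closure that \<open>borcherds_generated\<close> asks for.\<close>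

lemma Yw_borcherds: "vm.borcherds (pr u) (pr v)"
proof (rule vm.borcherds_generated[OF _ _ _ pr_generated pr_generated])
  show "vm.iterate_formula x v" if "x \<in> range unit_vec" for x v
    using that iterate_formula_unit_vec by auto
  show "vm.commutator_formula x y" if "x \<in> range unit_vec" "y \<in> range unit_vec" for x y
    using that commutator_formula_unit_vec by auto
  show "Yw x (int i) p y \<in> range unit_vec" if "x \<in> range unit_vec" "y \<in> range unit_vec" for x y i p
    using that by (auto simp: Yw_unit_unit)
qed

abbreviation "vac \<equiv> unit_vec (0, 1)"

lemma Yw_vac: "Yw vac n q w = (if n = -1 \<and> q = 0 then pr w else 0)"
  by (simp add: Yw_unit_vec Aop_0_left)

lemma Yw_creation: "0 \<le> n \<Longrightarrow> Yw v n q vac = 0"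
proof -
  assume n: "0 \<le> n"
  have "Yw (pr v) n q vac = 0"
  proof (rule vm.creation_generated[OF _ _ pr_generated n])
    show "vm.iterate_formula x v" if "x \<in> range unit_vec" for x v
      using that iterate_formula_unit_vec by auto
    show "Yw x (int i) p vac = 0" if "x \<in> range unit_vec" for x i p
      using that by (auto simp: Yw_unit_unit gC_mode_def bracket_simps kappa_simps
          ind.unit_vec_linear simp flip: zero_prod_def)
  qed
  then show ?thesis by (simp add: Yw_pr_left)
qed

section \<open>The toroidal vertex algebra\<close>

abbreviation "VL \<equiv> V_L scl bracket \<kappa> \<sigma> N lvl"
abbreviation "cl \<equiv> coset ind.R"

lemma VL_eq: "VL = ind.V"
  by (simp add: V_L_def)

lemma cl_closed: "pr F = F \<Longrightarrow> cl F \<in> carrier VL"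
  unfolding VL_eq ind.V_carrier using ind.pr_closed[of F] by (intro imageI) simp

lemma cl_pr: "Poly_Mapping.keys F \<subseteq> ind.S \<Longrightarrow> cl (pr F) = cl F"
  unfolding ind.coset_R_eq_iff by (rule ind.pr_mod)

lemma VL_cases:
  assumes "P \<in> carrier VL"
  obtains F where "P = cl F" "pr F = F"
proof -
  obtain F where F: "P = cl F" "Poly_Mapping.keys F \<subseteq> ind.S"
    using assms unfolding VL_eq ind.V_carrier by auto
  show thesis by (rule that[of "pr F"]) (simp_all add: F cl_pr)
qed

lemma cl_add: "cl F \<oplus>\<^bsub>VL\<^esub> cl G = cl (F + G)"
  and cl_smult: "c \<odot>\<^bsub>VL\<^esub> cl F = cl (free_scale c F)"
  and cl_zero: "\<zero>\<^bsub>VL\<^esub> = cl 0"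
  and module_VL: "Module.module complex_ring VL"
  unfolding VL_eq by (rule ind.V_add ind.V_smult ind.V_zero ind.module_V)+

lemma abelian_group_VL: "abelian_group VL"
  using module_VL by (rule Module.module.axioms)

lemma cl_eq_iff: "pr F = F \<Longrightarrow> pr G = G \<Longrightarrow> cl F = cl G \<longleftrightarrow> F = G"
  using ind.pr_cong[of F G] ind.coset_R_eq_iff[of F G] by auto

lemma cl_minus: "pr F = F \<Longrightarrow> pr G = G \<Longrightarrow> cl F \<ominus>\<^bsub>VL\<^esub> cl G = cl (F - G)"
proof -
  assume F: "pr F = F" and G: "pr G = G"
  interpret abelian_group VL by (rule abelian_group_VL)
  have "pr (- G) = - G" using ind.pr_linear(3)[of 0 G] G by (simp add: ind.pr_linear)
  then have "\<ominus>\<^bsub>VL\<^esub> cl G = cl (- G)"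
    by (intro minus_equality) (simp_all add: cl_add cl_zero cl_closed G)
  then show ?thesis by (simp add: a_minus_def cl_add)
qed

text \<open>The choice is harmless: all elements of a coset have the same image under
  \<open>pr\<close>.\<close>

definition rep where
  "rep P = pr (SOME F. F \<in> P)"

lemma rep_cl: "rep (cl F) = pr F"
proof -
  have "F \<in> cl F" by (rule coset_self[OF free_subspace_add_subgroup[OF ind.subspace_R]])
  then have "(SOME G. G \<in> cl F) \<in> cl F" by (rule someI)
  then show ?thesis unfolding rep_def by (intro ind.pr_cong) (simp add: coset_def)
qed

definition Y_V where
  "Y_V P m0 m Q = cl (Yw (rep P) m0 m (rep Q))"

lemma Y_cl: "Y_V (cl F) m0 m (cl G) = cl (Yw F m0 m G)"
  by (simp add: Y_V_def rep_cl Yw_pr_left Yw_pr_right)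

lemma V_L_unit_eq: "V_L_unit scl bracket \<kappa> \<sigma> N lvl b = cl (unit_vec b)"
  unfolding V_L_unit_def ind.induced_unit_eq ind.unit_vec_def
  by (rule cl_pr[symmetric]) (simp add: ind.A.U_one_closed)

lemma V_L_act_a_L:
  assumes "pr F = F"
  shows "V_L_act scl bracket \<kappa> \<sigma> N lvl (a_L scl \<sigma> N a m0 m) (cl F) = cl (Aop a m0 m F)"
proof -
  have F: "Poly_Mapping.keys F \<subseteq> ind.S" using ind.pr_closed[of F] assms by simp
  note x = tor_elem_LA[OF proj_mem, of m a m0]
  show ?thesis
    unfolding V_L_act_def a_L_eq ind.induced_act_coset[OF x] Aop_def ind.pr_T[OF x F, symmetric]
    by (rule cl_pr[symmetric]) (rule ind.T_closed[OF x F])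
qed

lemma finsum_cl:
  assumes "finite D" "\<And>d. d \<in> D \<Longrightarrow> pr (g d) = g d"
  shows "pr (\<Sum>d\<in>D. g d) = (\<Sum>d\<in>D. g d) \<and> finsum VL (\<lambda>d. cl (g d)) D = cl (\<Sum>d\<in>D. g d)"
  using assms
proof (induction D)
  case empty
  interpret abelian_group VL by (rule abelian_group_VL)
  show ?case by (simp add: cl_zero ind.pr_linear)
next
  case (insert d D)
  interpret abelian_group VL by (rule abelian_group_VL)
  have "finsum VL (\<lambda>d. cl (g d)) (insert d D) = cl (g d) \<oplus>\<^bsub>VL\<^esub> finsum VL (\<lambda>d. cl (g d)) D"
    using insert by (intro finsum_insert) (auto intro: cl_closed)
  then show ?case using insert by (simp add: cl_add ind.pr_linear)
qed

text \<open>In each term of the Jacobi identity the exponents that can contribute form a family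
  \<open>t\<close> with one free index i, and the product of series becomes a binomial sum.\<close>

lemma series_mult_cl:
  assumes t: "inj t" and off: "\<And>d. d \<notin> range t \<Longrightarrow> K d \<odot>\<^bsub>VL\<^esub> F (e - d) = \<zero>\<^bsub>VL\<^esub>"
    and on: "\<And>i. K (t i) \<odot>\<^bsub>VL\<^esub> F (e - t i) = cl (free_scale (bcoef c l i) (g i))"
    and g: "\<And>i. pr (g i) = g i" "ev0 g"
  shows "series_mult VL K F e = cl (cm.bsum c l g)"
proof -
  interpret abelian_group VL by (rule abelian_group_VL)
  let ?h = "\<lambda>i. free_scale (bcoef c l i) (g i)"
  let ?J = "{i. ?h i \<noteq> 0}"
  have h: "pr (?h i) = ?h i" for i by (simp add: ind.pr_linear g)
  have fin: "finite {i. g i \<noteq> 0}"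
    using g(2) unfolding ev0_def by (meson finite_nat_set_iff_bounded mem_Collect_eq not_le_imp_less)
  then have finJ: "finite ?J" by (rule rev_finite_subset) auto
  have z: "cl (?h i) = \<zero>\<^bsub>VL\<^esub> \<longleftrightarrow> ?h i = 0" for i
    unfolding cl_zero by (rule cl_eq_iff[OF h]) (simp add: ind.pr_linear)
  have J: "{i. K (t i) \<odot>\<^bsub>VL\<^esub> F (e - t i) \<noteq> \<zero>\<^bsub>VL\<^esub>} = ?J"
    unfolding on by (simp only: z)
  have image: "{d. X d \<noteq> \<zero>\<^bsub>VL\<^esub>} = t ` {i. X (t i) \<noteq> \<zero>\<^bsub>VL\<^esub>}"
    if X: "\<And>d. d \<notin> range t \<Longrightarrow> X d = \<zero>\<^bsub>VL\<^esub>" for X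
  proof (intro equalityI subsetI)
    fix d assume "d \<in> {d. X d \<noteq> \<zero>\<^bsub>VL\<^esub>}"
    then have d: "X d \<noteq> \<zero>\<^bsub>VL\<^esub>" by simp
    then have "d \<in> range t" using X[of d] by argo
    then obtain i where "d = t i" by (rule rangeE)
    then show "d \<in> t ` {i. X (t i) \<noteq> \<zero>\<^bsub>VL\<^esub>}" using d by simp
  qed (elim imageE, simp)
  have D: "{d. K d \<odot>\<^bsub>VL\<^esub> F (e - d) \<noteq> \<zero>\<^bsub>VL\<^esub>} = t ` ?J"
    unfolding J[symmetric] by (rule image[of "\<lambda>d. K d \<odot>\<^bsub>VL\<^esub> F (e - d)"]) (rule off)
  have "series_mult VL K F e = finsum VL (\<lambda>d. K d \<odot>\<^bsub>VL\<^esub> F (e - d)) (t ` ?J)"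
    unfolding series_mult_def D ..
  also have "\<dots> = finsum VL (\<lambda>i. K (t i) \<odot>\<^bsub>VL\<^esub> F (e - t i)) ?J"
    by (rule finsum_reindex) (auto simp: on cl_closed h intro: inj_on_subset[OF t])
  also have "\<dots> = cl (\<Sum>i\<in>?J. ?h i)"
    unfolding on using finsum_cl[OF finJ, of ?h] h by blast
  also have "(\<Sum>i\<in>?J. ?h i) = cm.bsum c l g"
    unfolding cm.bsum_def using fin by (intro sum.mono_neutral_left) auto
  finally show ?thesis .
qed

lemma neq_of_nonmember_range: "d \<notin> range f \<Longrightarrow> d \<noteq> f i"
  by auto

lemma cl_smult_zero: "c \<odot>\<^bsub>VL\<^esub> \<zero>\<^bsub>VL\<^esub> = \<zero>\<^bsub>VL\<^esub>" and cl_zero_smult: "0 \<odot>\<^bsub>VL\<^esub> cl F = \<zero>\<^bsub>VL\<^esub>"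
  by (simp_all add: cl_zero cl_smult)

text \<open>The exponents a, b, c translate into the mode indices l, m, n. The product of the two
  operators is free of z_0, so the delta factor has to supply the whole exponent a, and only its
  power i of y_0 remains free.\<close>

lemma jacobi_uv_cl:
  fixes p q :: "int ^ 'r"
  assumes l: "l = - a - 1" "m = - b - 1" "n = - c - 1"
  shows "jacobi_uv VL Y_V (cl u) (cl v) (cl w) p q (a, b, c) =
    cl (cm.bsum (-1) l (\<lambda>i. Yw u (l + m - int i) (- p) (Yw v (n + int i) (- q - - p) w)))"
  unfolding jacobi_uv_def
proof (rule series_mult_cl[where t = "\<lambda>i. (a, l - int i, int i)"])
  show "inj (\<lambda>i. (a, l - int i, int i))" by (rule injI) simp
  fix i
  show "(case (a, l - int i, int i) of (a, b, c) \<Rightarrow> delta_coeff 1 a b c) \<odot>\<^bsub>VL\<^esub>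
      (case (a, b, c) - (a, l - int i, int i) of (a, b, c) \<Rightarrow> if a = 0
        then vertex_coeff Y_V (cl u) b p (vertex_coeff Y_V (cl v) c (q - p) (cl w)) else \<zero>\<^bsub>VL\<^esub>) =
      cl (free_scale (bcoef (-1) l i) (Yw u (l + m - int i) (- p) (Yw v (n + int i) (- q - - p) w)))"
    by (simp add: l delta_coeff_def binomial_coeff_def bcoef_def vertex_coeff_def Y_cl cl_smult
        algebra_simps)
next
  fix d assume "d \<notin> range (\<lambda>i. (a, l - int i, int i))"
  from neq_of_nonmember_range[OF this, of "nat (snd (snd d))"]
  show "(case d of (a, b, c) \<Rightarrow> delta_coeff 1 a b c) \<odot>\<^bsub>VL\<^esub>
      (case (a, b, c) - d of (a, b, c) \<Rightarrow> if a = 0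
        then vertex_coeff Y_V (cl u) b p (vertex_coeff Y_V (cl v) c (q - p) (cl w)) else \<zero>\<^bsub>VL\<^esub>) = \<zero>\<^bsub>VL\<^esub>"
    by (cases d) (auto simp: l delta_coeff_def binomial_coeff_def vertex_coeff_def Y_cl
        cl_smult_zero cl_zero_smult)
qed (simp_all add: pr_Yw vm.ev0_Y_right[OF vm.ev0_trunc])

lemma jacobi_vu_cl:
  fixes p q :: "int ^ 'r"
  assumes l: "l = - a - 1" "m = - b - 1" "n = - c - 1"
  shows "jacobi_vu VL Y_V (cl u) (cl v) (cl w) p q (a, b, c) =
    cl (free_scale (eps l) (cm.bsum (-1) l
      (\<lambda>i. Yw v (n + l - int i) (- q - - p) (Yw u (m + int i) (- p) w))))"
proof -
  have ev: "ev0 (\<lambda>i. Yw v (n + l - int i) (- q - - p) (Yw u (m + int i) (- p) w))"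
    by (rule vm.ev0_Y_right[OF vm.ev0_trunc])
  \<comment> \<open>The sign of the delta series at exponent a is (-1)^(a+1), which equals
    (-1)^l.\<close>
  have "l = - (a + 1)" by (simp add: l)
  then have "eps l = (inverse (eps (a + 1)) :: complex)" by (simp only: eps_def power_int_minus)
  also have "\<dots> = eps (a + 1)" by (rule inverse_unique[OF eps_square])
  finally have e: "(-1) powi (a + 1) = (eps l :: complex)" by (simp only: eps_def)
  show ?thesis
    unfolding jacobi_vu_def cm.bsum_scale[OF ev, symmetric]
  proof (rule series_mult_cl[where t = "\<lambda>i. (a, int i, l - int i)"])
    show "inj (\<lambda>i. (a, int i, l - int i))" by (rule injI) simp
    fix i
    show "(case (a, int i, l - int i) of (a, b, c) \<Rightarrow> delta_coeff (-1) a c b) \<odot>\<^bsub>VL\<^esub>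
        (case (a, b, c) - (a, int i, l - int i) of (a, b, c) \<Rightarrow> if a = 0
          then vertex_coeff Y_V (cl v) c (q - p) (vertex_coeff Y_V (cl u) b p (cl w)) else \<zero>\<^bsub>VL\<^esub>) =
        cl (free_scale (bcoef (-1) l i) (free_scale (eps l)
          (Yw v (n + l - int i) (- q - - p) (Yw u (m + int i) (- p) w))))"
      by (simp add: delta_coeff_def e) (simp add: l binomial_coeff_def bcoef_def vertex_coeff_def
          Y_cl cl_smult algebra_simps)
  next
    fix d assume "d \<notin> range (\<lambda>i. (a, int i, l - int i))"
    from neq_of_nonmember_range[OF this, of "nat (fst (snd d))"]
    show "(case d of (a, b, c) \<Rightarrow> delta_coeff (-1) a c b) \<odot>\<^bsub>VL\<^esub>
        (case (a, b, c) - d of (a, b, c) \<Rightarrow> if a = 0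
          then vertex_coeff Y_V (cl v) c (q - p) (vertex_coeff Y_V (cl u) b p (cl w)) else \<zero>\<^bsub>VL\<^esub>) = \<zero>\<^bsub>VL\<^esub>"
      by (cases d) (auto simp: l delta_coeff_def binomial_coeff_def vertex_coeff_def Y_cl
          cl_smult_zero cl_zero_smult)
  next
    show "ev0 (\<lambda>i. free_scale (eps l) (Yw v (n + l - int i) (- q - - p) (Yw u (m + int i) (- p) w)))"
      by (rule ev0_map[OF ev]) simp
  qed (simp add: pr_Yw ind.pr_linear)
qed

lemma jacobi_iterate_cl:
  fixes p q :: "int ^ 'r"
  assumes l: "l = - a - 1" "m = - b - 1" "n = - c - 1"
  shows "jacobi_iterate VL Y_V (cl u) (cl v) (cl w) p q (a, b, c) =
    cl (cm.bsum 1 m (\<lambda>i. Yw (Yw u (l + int i) (- p) v) (m + n - int i) (- q) w))"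
  unfolding jacobi_iterate_def
proof (rule series_mult_cl[where t = "\<lambda>i. (int i, b, m - int i)"])
  show "inj (\<lambda>i. (int i, b, m - int i))" by (rule injI) simp
  fix i
  \<comment> \<open>The delta factor yields, up to sign, the binomial coefficient of b + i over i;
    negating the upper index turns it into that of m = -b - 1 over i.\<close>
  have c: "(-1) ^ i * ((of_int b + of_nat i) gchoose i) = (bcoef 1 m i :: complex)"
    unfolding bcoef_def l by (subst (2) gbinomial_negated_upper) (simp add: algebra_simps)
  show "(case (int i, b, m - int i) of (a, b, c) \<Rightarrow> delta_coeff 1 c b a) \<odot>\<^bsub>VL\<^esub>
      (case (a, b, c) - (int i, b, m - int i) of (a, b, c) \<Rightarrow> if b = 0
        then vertex_coeff Y_V (vertex_coeff Y_V (cl u) a p (cl v)) c q (cl w) else \<zero>\<^bsub>VL\<^esub>) =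
      cl (free_scale (bcoef 1 m i) (Yw (Yw u (l + int i) (- p) v) (m + n - int i) (- q) w))"
    by (simp add: l delta_coeff_def binomial_coeff_def vertex_coeff_def Y_cl cl_smult
        algebra_simps c)
next
  fix d assume "d \<notin> range (\<lambda>i. (int i, b, m - int i))"
  from neq_of_nonmember_range[OF this, of "nat (fst d)"]
  show "(case d of (a, b, c) \<Rightarrow> delta_coeff 1 c b a) \<odot>\<^bsub>VL\<^esub>
      (case (a, b, c) - d of (a, b, c) \<Rightarrow> if b = 0
        then vertex_coeff Y_V (vertex_coeff Y_V (cl u) a p (cl v)) c q (cl w) else \<zero>\<^bsub>VL\<^esub>) = \<zero>\<^bsub>VL\<^esub>"
    by (cases d) (auto simp: l delta_coeff_def binomial_coeff_def vertex_coeff_def Y_cl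
        cl_smult_zero cl_zero_smult)
qed (simp_all add: pr_Yw vm.ev0_Y_left[OF vm.ev0_trunc])

lemma toroidal_vertex_algebra_VL: "toroidal_vertex_algebra VL Y_V (V_L_vacuum scl bracket \<kappa> \<sigma> N lvl)"
proof (intro toroidal_vertex_algebra.intro module_VL toroidal_vertex_algebra_axioms.intro)
  note simps = Y_cl cl_add cl_smult Yw_add_left Yw_scale_left series_scale_def
    vm.Y_add_right vm.Y_scale_right
  fix u v w v' w' :: "((('g, 'r) toroidal word \<Rightarrow>\<^sub>0 complex) set \<times> ('g \<times> complex) \<Rightarrow>\<^sub>0 complex) set"
    and c :: complex and m0 :: int and m :: "int ^ 'r"
  show "V_L_vacuum scl bracket \<kappa> \<sigma> N lvl \<in> carrier VL"
    unfolding V_L_vacuum_def V_L_unit_eq by (rule cl_closed) simp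
  assume v: "v \<in> carrier VL"
  obtain G where G: "v = cl G" "pr G = G" using v by (rule VL_cases)
  show "Y_V v m0 m (V_L_vacuum scl bracket \<kappa> \<sigma> N lvl) = \<zero>\<^bsub>VL\<^esub>" if "0 \<le> m0"
    using that by (simp add: V_L_vacuum_def V_L_unit_eq G Y_cl Yw_creation cl_zero)
  show "Y_V (V_L_vacuum scl bracket \<kappa> \<sigma> N lvl) m0 m v = (if m0 = -1 \<and> m = 0 then v else \<zero>\<^bsub>VL\<^esub>)"
    by (simp add: V_L_vacuum_def V_L_unit_eq G Y_cl Yw_vac cl_zero)
  assume w: "w \<in> carrier VL"
  obtain H where H: "w = cl H" "pr H = H" using w by (rule VL_cases)
  show "Y_V v m0 m w \<in> carrier VL"
    unfolding G H Y_cl by (rule cl_closed) (rule pr_Yw)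
  show "Y_V (c \<odot>\<^bsub>VL\<^esub> v) m0 m w = c \<odot>\<^bsub>VL\<^esub> Y_V v m0 m w"
    "Y_V v m0 m (c \<odot>\<^bsub>VL\<^esub> w) = c \<odot>\<^bsub>VL\<^esub> Y_V v m0 m w"
    by (simp_all add: G H simps)
  show "\<exists>n. \<forall>m0\<ge>n. \<forall>m. Y_V v m0 m w = \<zero>\<^bsub>VL\<^esub>"
  proof -
    obtain n where "\<forall>m\<ge>n. \<forall>p. Yw G m p H = 0" using vm.truncation[of G H] by blast
    then show ?thesis by (intro exI[of _ n]) (simp add: G H Y_cl cl_zero)
  qed
  show "Y_V v m0 m (w \<oplus>\<^bsub>VL\<^esub> w') = Y_V v m0 m w \<oplus>\<^bsub>VL\<^esub> Y_V v m0 m w'" if "w' \<in> carrier VL"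
    using that by (elim VL_cases) (simp add: G H simps)
  assume u: "u \<in> carrier VL"
  obtain F where F: "u = cl F" "pr F = F" using u by (rule VL_cases)
  show "Y_V (u \<oplus>\<^bsub>VL\<^esub> v) m0 m w = Y_V u m0 m w \<oplus>\<^bsub>VL\<^esub> Y_V v m0 m w"
    by (simp add: F G H simps)
  fix p q :: "int ^ 'r" and e :: "int \<times> int \<times> int"
  obtain a b c where e: "e = (a, b, c)" by (cases e)
  let ?l = "- a - 1" and ?m = "- b - 1" and ?n = "- c - 1"
  have ev: "ev0 (\<lambda>i. Yw F (?l + ?m - int i) (- p) (Yw G (?n + int i) (- q - - p) H))"
    "ev0 (\<lambda>i. Yw G (?n + ?l - int i) (- q - - p) (Yw F (?m + int i) (- p) H))"
    by (rule vm.ev0_Y_right[OF vm.ev0_trunc])+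
  have "vm.iterate_side F G (- p) (- q) ?l ?m ?n H = vm.commutator_side F G (- p) (- q) ?l ?m ?n H"
    using Yw_borcherds[of F G] F G by (simp only: vm.borcherds_def)
  then show "jacobi_uv VL Y_V u v w p q e \<ominus>\<^bsub>VL\<^esub> jacobi_vu VL Y_V u v w p q e = jacobi_iterate VL Y_V u v w p q e"
    unfolding e F G H jacobi_uv_cl[OF refl refl refl] jacobi_vu_cl[OF refl refl refl]
      jacobi_iterate_cl[OF refl refl refl] vm.iterate_side_def vm.commutator_side_def
    by (simp only: cl_minus cm.pr_bsum[OF ev(1)] cm.pr_bsum[OF ev(2)] ind.pr_linear pr_Yw)
qed

lemma V_L_structure_VL: "V_L_structure scl bracket \<kappa> \<sigma> N lvl Y_V"
  unfolding V_L_structure_def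
proof (intro conjI toroidal_vertex_algebra_VL allI ballI)
  fix a m0 m v assume "v \<in> carrier VL"
  then obtain F where F: "v = cl F" "pr F = F" by (rule VL_cases)
  show "Y_V (V_L_embed scl bracket \<kappa> \<sigma> N lvl a) m0 m v =
      V_L_act scl bracket \<kappa> \<sigma> N lvl (a_L scl \<sigma> N a m0 m) v"
    by (simp add: F V_L_act_a_L V_L_embed_def V_L_unit_eq Y_cl Yw_embed)
qed

end

section \<open>Uniqueness\<close>

context toroidal_vertex_algebra
begin

text \<open>
  At the exponent \<open>-1\<close> of \<open>x\<^sub>0\<close>, the binomial \<open>(x\<^sub>0 - z\<^sub>0)\<^sup>n\<close> contributes only for \<open>n = -1\<close>, through its leading
  term, so that this coefficient isolates a single mode of an iterate.
\<close>

lemma jacobi_iterate_single: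
  assumes "u \<in> carrier V" "v \<in> carrier V" "w \<in> carrier V"
  shows "jacobi_iterate V Y u v w (- p) (- q) (- k - 1, - 1, - n - 1) = Y (Y u k p v) n q w"
proof -
  let ?K = "\<lambda>(a, b, c). delta_coeff 1 c b a"
  let ?F = "\<lambda>(a, b, c). if b = 0
    then vertex_coeff Y (vertex_coeff Y u a (- p) v) c (- q) w else \<zero>"
  let ?t = "\<lambda>d. ?K d \<odot> ?F ((- k - 1, - 1, - n - 1) - d)"
  have closed: "?F d \<in> carrier V" for d :: "int \<times> int \<times> int"
    using assms by (cases d) (simp add: vertex_coeff_def Y_closed)
  have K: "?K (a, - 1, c) = 0" if "(a, c) \<noteq> (0, 0)" for a c
  proof (cases "0 \<le> a \<and> a = - c")
    case True
    then obtain i where a: "a = int i" by (auto elim: nonneg_int_cases)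
    then have i: "a = int i" "c = - int i" "0 < i" using True that by auto
    \<comment> \<open>Here (x_0 - z_0)^(i-1) is a polynomial of degree i - 1, so its coefficient of
      z_0^i is 0.\<close>
    then have "of_int (- c - 1) = (of_nat (i - 1) :: complex)" by (simp add: of_nat_diff)
    then have "(of_int (- c - 1) gchoose nat a) = (of_nat (i - 1 choose i) :: complex)"
      by (simp only: binomial_gbinomial i nat_int)
    then show ?thesis using i by (simp add: delta_coeff_def binomial_coeff_def)
  next
    case False
    then show ?thesis by (auto simp: delta_coeff_def binomial_coeff_def)
  qed
  have off: "?t d = \<zero>" if "d \<noteq> (0, - 1, 0)" for d
  proof -
    obtain a b c where d: "d = (a, b, c)" by (cases d)
    show ?thesis
    proof (cases "b = - 1")
      case True
      then have "?K d = 0" using that K[of a c] by (simp add: d)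
      then show ?thesis using closed smult_l_null by (simp add: complex_ring_simps)
    next
      case False
      then show ?thesis by (simp add: d)
    qed
  qed
  have on: "?t (0, - 1, 0) = Y (Y u k p v) n q w"
    using assms smult_one[of "Y (Y u k p v) n q w"]
    by (simp add: delta_coeff_def binomial_coeff_def vertex_coeff_def complex_ring_simps Y_closed)
  have closed': "Y (Y u k p v) n q w \<in> carrier V" using assms by (simp add: Y_closed)
  define D where "D = {d. ?t d \<noteq> \<zero>}"
  have mem: "(0, - 1, 0) \<in> D \<longleftrightarrow> Y (Y u k p v) n q w \<noteq> \<zero>"
    unfolding D_def mem_Collect_eq on ..
  have sub: "D \<subseteq> {(0, - 1, 0)}"
  proof
    fix d assume "d \<in> D"
    then have "?t d \<noteq> \<zero>" unfolding D_def by (rule CollectD)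
    then have "d = (0, - 1, 0)" using off[of d] by argo
    then show "d \<in> {(0, - 1, 0)}" by (simp only: singleton_iff)
  qed
  have "jacobi_iterate V Y u v w (- p) (- q) (- k - 1, - 1, - n - 1) = finsum V ?t D"
    unfolding jacobi_iterate_def series_mult_def D_def ..
  also have "\<dots> = Y (Y u k p v) n q w"
  proof (cases "Y (Y u k p v) n q w = \<zero>")
    case True
    then have "D = {}" using mem sub by blast
    then show ?thesis unfolding True by (simp only: finsum_empty)
  next
    case False
    then have "D = {(0, - 1, 0)}" using mem sub by blast
    moreover have "finsum V ?t {(0, - 1, 0)} = ?t (0, - 1, 0) \<oplus> finsum V ?t {}"
      by (rule finsum_insert) (simp_all only: on closed' finite.emptyI empty_iff Pi_empty UNIV_I not_False_eq_True)
    ultimately show ?thesis unfolding on finsum_empty by (simp only: r_zero[OF closed'])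
  qed
  finally show ?thesis .
qed

end

context toroidal_setting
begin

lemma V_L_structure_unique:
  assumes Y: "V_L_structure scl bracket \<kappa> \<sigma> N lvl Y" and Y': "V_L_structure scl bracket \<kappa> \<sigma> N lvl Y'"
    and u: "u \<in> carrier VL" and v: "v \<in> carrier VL"
  shows "Y u m0 m v = Y' u m0 m v"
proof -
  interpret Y: toroidal_vertex_algebra VL Y "V_L_vacuum scl bracket \<kappa> \<sigma> N lvl"
    using Y unfolding V_L_structure_def by blast
  interpret Y': toroidal_vertex_algebra VL Y' "V_L_vacuum scl bracket \<kappa> \<sigma> N lvl"
    using Y' unfolding V_L_structure_def by blast
  \<comment> \<open>Agreement is asked for all vectors on the right, so that both orders of the two
    operators in the Jacobi identity can be compared.\<close>
  define G where "G = {u \<in> carrier VL. \<forall>n q. \<forall>w \<in> carrier VL. Y' u n q w = Y u n q w}"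
  have GI: "u \<in> G" if "u \<in> carrier VL" "\<And>n q w. w \<in> carrier VL \<Longrightarrow> Y' u n q w = Y u n q w" for u
    using that unfolding G_def by simp
  have GD: "u \<in> carrier VL" "w \<in> carrier VL \<Longrightarrow> Y' u n q w = Y u n q w" if "u \<in> G" for u n q w
    using that unfolding G_def by simp_all
  have add: "u \<oplus>\<^bsub>VL\<^esub> v \<in> G" if "u \<in> G" "v \<in> G" for u v
    using that by (intro GI) (simp_all add: Y.Y_add_left Y'.Y_add_left GD)
  have smult: "c \<odot>\<^bsub>VL\<^esub> u \<in> G" if "u \<in> G" for c u
    using that by (intro GI) (simp_all add: Y.Y_smult_left Y'.Y_smult_left GD complex_ring_simps)
  have Y_embed: "Y (cl (unit_vec (a, 0))) n q (cl w) = cl (Aop a n q w)"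
    and Y'_embed: "Y' (cl (unit_vec (a, 0))) n q (cl w) = cl (Aop a n q w)" if "pr w = w" for a n q w
    using Y Y' cl_closed[OF that] unfolding V_L_structure_def V_L_embed_def V_L_unit_eq
    by (simp_all add: V_L_act_a_L[OF that])
  have embed: "cl (unit_vec (a, 0)) \<in> G" for a
    by (intro GI cl_closed ind.pr_unit_vec, elim VL_cases) (simp add: Y_embed Y'_embed)
  have vacuum: "cl (unit_vec (0, 1)) \<in> G"
    using Y.vacuum Y'.vacuum unfolding V_L_vacuum_def V_L_unit_eq
    by (intro GI cl_closed ind.pr_unit_vec) simp
  have coeffs: "vertex_coeff Y' u j s (vertex_coeff Y' v i t w) = vertex_coeff Y u j s (vertex_coeff Y v i t w)"
    if "u \<in> G" "v \<in> G" "w \<in> carrier VL" for u v w i j s t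
    using that by (simp add: vertex_coeff_def Y.Y_closed GD)
  have mode: "Y u k p v \<in> G" if u: "u \<in> G" and v: "v \<in> G" for u k p v
  proof (rule GI)
    show "Y u k p v \<in> carrier VL" using u v by (simp add: Y.Y_closed GD)
  next
    fix n :: int and q :: "int ^ 'r" and w assume w: "w \<in> carrier VL"
    let ?e = "(- k - 1, - 1, - n - 1)"
    have "Y' (Y u k p v) n q w = Y' (Y' u k p v) n q w" using u v by (simp add: GD)
    also have "\<dots> = jacobi_uv VL Y' u v w (- p) (- q) ?e \<ominus>\<^bsub>VL\<^esub> jacobi_vu VL Y' u v w (- p) (- q) ?e"
      using u v w by (simp only: Y'.jacobi Y'.jacobi_iterate_single GD(1))
    also have "\<dots> = jacobi_uv VL Y u v w (- p) (- q) ?e \<ominus>\<^bsub>VL\<^esub> jacobi_vu VL Y u v w (- p) (- q) ?e"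
      unfolding jacobi_uv_def jacobi_vu_def coeffs[OF u v w] coeffs[OF v u w] ..
    also have "\<dots> = Y (Y u k p v) n q w"
      using u v w by (simp only: Y.jacobi Y.jacobi_iterate_single GD(1))
    finally show "Y' (Y u k p v) n q w = Y (Y u k p v) n q w" .
  qed
  obtain F where F: "u = cl F" "pr F = F" using u by (rule VL_cases)
  have "cl (pr F) \<in> G"
  proof (rule ind.pr_induct[where Q = "\<lambda>w. cl w \<in> G"])
    show "cl (u + v) \<in> G" if "cl u \<in> G" "cl v \<in> G" for u v
      using add[OF that] by (simp only: cl_add)
    show scale: "cl (free_scale c u) \<in> G" if "cl u \<in> G" for c u
      using smult[OF that] by (simp only: cl_smult)
    show "cl (unit_vec b) \<in> G" for b
    proof -
      have "b = (fst b, 0) + gC_sc (snd b) (0, 1)" by (simp add: gC_scale_def)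
      then have "unit_vec b = unit_vec (fst b, 0) + free_scale (snd b) (unit_vec (0, 1))"
        unfolding ind.unit_vec_linear(1,2)[symmetric] by (rule arg_cong)
      then show ?thesis using add[OF embed smult[OF vacuum]] by (simp only: cl_add cl_smult)
    qed
    fix x u assume x: "x \<in> LA" and u: "cl u \<in> G" "pr u = u"
    have A: "cl (Aop a n q u) \<in> G" for a n q
      using mode[OF embed u(1)] by (simp only: Y_embed[OF u(2)])
    have S: "cl (\<Sum>k\<in>K. f k) \<in> G" if "\<And>k. cl (f k) \<in> G" for f and K :: "(int \<times> (int ^ 'r)) set"
    proof (induction K rule: infinite_finite_induct)
      case (insert k K)
      then show ?case using add[OF that insert.IH] by (simp add: cl_add)
    qed (use scale[OF u(1), of 0] in simp_all)
    show "cl (act_op x u) \<in> G"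
      unfolding act_op_decompose[OF x] u(2) cl_add[symmetric]
      by (intro add S A scale u(1))
  qed
  then show ?thesis using v by (simp add: F GD(2))
qed

end

theorem theorem4p5:
  fixes scl :: "complex \<Rightarrow> 'g :: ab_group_add \<Rightarrow> 'g"
    and bracket :: "'g \<Rightarrow> 'g \<Rightarrow> 'g"
    and \<kappa> :: "'g \<Rightarrow> 'g \<Rightarrow> complex"
    and \<sigma> :: "'r :: finite \<Rightarrow> 'g \<Rightarrow> 'g"
    and N :: "'r \<Rightarrow> nat"
    and lvl :: complex
  assumes "simple_lie_algebra scl bracket"
    and "lie_algebra.normalized_killing_form scl bracket \<kappa>"
    and "\<And>i. lie_algebra.lie_automorphism scl bracket (\<sigma> i)"
    and "\<And>i. has_order (\<sigma> i) (N i)"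
    and "\<And>i j. \<sigma> i \<circ> \<sigma> j = \<sigma> j \<circ> \<sigma> i"
  shows "(\<exists>Y. V_L_structure scl bracket \<kappa> \<sigma> N lvl Y) \<and>
    (\<forall>Y Y'. V_L_structure scl bracket \<kappa> \<sigma> N lvl Y \<and> V_L_structure scl bracket \<kappa> \<sigma> N lvl Y' \<longrightarrow>
      (\<forall>u \<in> carrier (V_L scl bracket \<kappa> \<sigma> N lvl). \<forall>v \<in> carrier (V_L scl bracket \<kappa> \<sigma> N lvl).
        \<forall>m0 m. Y u m0 m v = Y' u m0 m v))"
proof -
  interpret g: simple_lie_algebra scl bracket by (rule assms(1))
  have "\<exists>c. \<kappa> = (\<lambda>x y. c * g.killing_form x y)"
    using assms(2) unfolding g.normalized_killing_form_def by (rule conjunct1)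
  then have *: "toroidal_setting scl bracket \<kappa> \<sigma> N"
    by (intro toroidal_setting.intro assms(1) toroidal_setting_axioms.intro assms(3-5))
  show ?thesis
  proof (intro conjI allI impI ballI)
    show "\<exists>Y. V_L_structure scl bracket \<kappa> \<sigma> N lvl Y"
      by (rule exI) (rule toroidal_setting.V_L_structure_VL[OF *])
  qed (elim conjE, rule toroidal_setting.V_L_structure_unique[OF *])
qed

end
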